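(* Let $(X_n)_{n\ge 0}$ be an irreducible aperiodic positive Markov chain on $\mathcal{S}$ which is geometrically ergodic, with stationary distribution $\pi$. Let $C$ be a small set as in the definition of geometric ergodicity, i.e. a nonempty set satisfying conditions (i) and (ii) of the context for some $m,\nu,\delta,\kappa$. Then there exists a constant $M_0>0$ (depending on the chain and on $C$) with the following property. Let $n\in\mathbb{N}$, and let $K:\mathcal{S}^n\to\mathbb{R}$ be a measurable function which is separately bounded with constants $L_0,\dots,L_{n-1}\ge 0$. Then, for all $t>0$, $$\mathbb{P}_{\pi}\bigl(|K(X_0,\dots,X_{n-1})-\mathbb{E}_\pi K(X_0,\dots,X_{n-1})|>t\bigr)\le 2\exp\Bigl(-\frac{M_0^{-1}t^2}{\sum_{i=0}^{n-1} L_i^2}\Bigr),$$ and, for all $t>0$ and all $x\in C$, $$\mathbb{P}_{x}\bigl(|K(X_0,\dots,X_{n-1})-\mathbb{E}_x K(X_0,\dots,X_{n-1})|>t\bigr)\le 2\exp\Bigl(-\frac{M_0^{-1}t^2}{\sum_{i=0}^{n-1} L_i^2}\Bigr).$$ The constant $M_0$ does not depend on $n$, $K$, the $L_i$, $t$ or $x$.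
   Context: $\mathcal{S}$ is a general state space (a measurable space with countably generated $\sigma$-algebra) and $P(x,A)$ is a measurable transition kernel on $\mathcal{S}$, with $n$-step kernel $P^n$. $\mathbb{P}_x,\mathbb{E}_x$ (resp. $\mathbb{P}_\pi,\mathbb{E}_\pi$) denote probability and expectation for the Markov chain $(X_n)_{n\ge0}$ with kernel $P$ started from $X_0=x$ (resp. $X_0\sim\pi$). Irreducible, aperiodic and positive: there exists a (necessarily unique) stationary probability measure $\pi$ such that, for all $x\in\mathcal{S}$, all measurable $A$ with $\pi(A)>0$, and all large enough $n$ (depending on $x$ and $A$), one has $P^n(x,A)>0$. Geometrically ergodic: an irreducible aperiodic positive chain is geometrically ergodic if there exist a nonempty measurable set $C\subset\mathcal{S}$, an integer $m>0$, a probability measure $\nu$ on $\mathcal{S}$, and $\delta\in(0,1)$, $\kappa>1$ such that (i) for all $x\in C$, $P^m(x,\cdot)\ge\delta\nu$; (ii) $\sup_{x\in C}\mathbb{E}_x(\kappa^{\tau_C})<\infty$, where $\tau_C=\inf\{n\ge1: X_n\in C\}$ is the return time to $C$. Separately bounded: $K:\mathcal{S}^n\to\mathbb{R}$ is separately bounded with constants $L_i$ if for every $i$ and all $x_0,\dots,x_{n-1},x_i'\in\mathcal{S}$, $$|K(x_0,\dots,x_{i-1},x_i,x_{i+1},\dots,x_{n-1})-K(x_0,\dots,x_{i-1},x_i',x_{i+1},\dots,x_{n-1})|\le L_i.$$ If $\sum L_i^2=0$, the right-hand sides are interpreted as $0$. *)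

theory Defs
  imports "HOL-Probability.Probability"
begin

text \<open>
  Only the space and the measurable sets of the measure \<open>S\<close> matter: it stands for the
  state space, a measurable space.
\<close>

definition countably_generated :: "'a measure \<Rightarrow> bool" where
  "countably_generated S \<longleftrightarrow>
     (\<exists>G. countable G \<and> G \<subseteq> Pow (space S) \<and> sets S = sigma_sets (space S) G)"

definition markov_kernel :: "'a measure \<Rightarrow> ('a \<Rightarrow> 'a measure) \<Rightarrow> bool" where
  "markov_kernel S P \<longleftrightarrow> P \<in> S \<rightarrow>\<^sub>M prob_algebra S"

primrec kernel_power :: "'a measure \<Rightarrow> ('a \<Rightarrow> 'a measure) \<Rightarrow> nat \<Rightarrow> 'a \<Rightarrow> 'a measure" where
  "kernel_power S P 0 x = return S x"
| "kernel_power S P (Suc n) x = kernel_power S P n x \<bind> P"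

definition chain_step ::
    "('a \<Rightarrow> 'a measure) \<Rightarrow> 'a measure \<Rightarrow> nat \<Rightarrow> (nat \<Rightarrow> 'a) \<Rightarrow> 'a measure" where
  "chain_step P \<mu> n \<omega> = (case n of 0 \<Rightarrow> \<mu> | Suc k \<Rightarrow> P (\<omega> k))"

text \<open>
  The law of the whole trajectory of the chain with kernel \<open>P\<close> and initial distribution
  \<open>\<mu>\<close>, on the product sigma-algebra of the trajectories \<open>nat \<Rightarrow> 'a\<close> (the Ionescu-Tulcea
  extension). The chain is the coordinate process \<open>X\<^sub>n \<omega> = \<omega> n\<close>.
\<close>

definition markov_law :: "'a measure \<Rightarrow> ('a \<Rightarrow> 'a measure) \<Rightarrow> 'a measure \<Rightarrow> (nat \<Rightarrow> 'a) measure" where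
  "markov_law S P \<mu> =
     projective_family.lim UNIV (Ionescu_Tulcea.CI (chain_step P \<mu>) (\<lambda>_. S)) (\<lambda>_. S)"

abbreviation markov_law_from :: "'a measure \<Rightarrow> ('a \<Rightarrow> 'a measure) \<Rightarrow> 'a \<Rightarrow> (nat \<Rightarrow> 'a) measure" where
  "markov_law_from S P x \<equiv> markov_law S P (return S x)"

lemma Ionescu_Tulcea_chain_step:
  assumes "markov_kernel S P" and "\<mu> \<in> space (prob_algebra S)"
  shows "Ionescu_Tulcea (chain_step P \<mu>) (\<lambda>_. S)"
proof (rule Ionescu_Tulcea.intro)
  note P [measurable] = assms(1) [unfolded markov_kernel_def]
  have meas: "chain_step P \<mu> n \<in> PiM {0..<n} (\<lambda>_. S) \<rightarrow>\<^sub>M prob_algebra S" for n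
  proof (cases n)
    case 0
    have "chain_step P \<mu> 0 = (\<lambda>_. \<mu>)"
      by (simp add: chain_step_def fun_eq_iff)
    with 0 assms(2) show ?thesis
      by simp
  next
    case (Suc k)
    have "chain_step P \<mu> (Suc k) = (\<lambda>\<omega>. P (\<omega> k))"
      by (simp add: chain_step_def fun_eq_iff)
    with Suc show ?thesis
      by simp
  qed
  show "chain_step P \<mu> n \<in> PiM {0..<n} (\<lambda>_. S) \<rightarrow>\<^sub>M subprob_algebra S" for n
    using meas by (rule measurable_prob_algebraD)
  fix n :: nat and \<omega>
  assume "\<omega> \<in> space (PiM {0..<n} (\<lambda>_. S))"
  from measurable_space [OF meas this] show "prob_space (chain_step P \<mu> n \<omega>)"
    by (simp add: space_prob_algebra)
qed

lemma
  assumes "markov_kernel S P" and "\<mu> \<in> space (prob_algebra S)"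
  shows prob_space_markov_law: "prob_space (markov_law S P \<mu>)"
    and sets_markov_law: "sets (markov_law S P \<mu>) = sets (PiM UNIV (\<lambda>_. S))"
    and space_markov_law: "space (markov_law S P \<mu>) = space (PiM UNIV (\<lambda>_. S))"
    and markov_law_restrict:
      "distr (markov_law S P \<mu>) (PiM {0..<n} (\<lambda>_. S)) (\<lambda>\<omega>. restrict \<omega> {0..<n}) =
       Ionescu_Tulcea.C (chain_step P \<mu>) (\<lambda>_. S) 0 n (\<lambda>_. undefined)"
proof -
  interpret IT: Ionescu_Tulcea "chain_step P \<mu>" "\<lambda>_. S"
    by (rule Ionescu_Tulcea_chain_step [OF assms])
  have lim: "markov_law S P \<mu> = IT.PF.lim"
    by (simp add: markov_law_def)
  show sets: "sets (markov_law S P \<mu>) = sets (PiM UNIV (\<lambda>_. S))"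
    unfolding lim by (rule IT.PF.sets_lim)
  then show "space (markov_law S P \<mu>) = space (PiM UNIV (\<lambda>_. S))"
    by (rule sets_eq_imp_space_eq)
  have marginal: "distr (markov_law S P \<mu>) (PiM J (\<lambda>_. S)) (\<lambda>\<omega>. restrict \<omega> J) = IT.CI J"
    if "finite J" for J
    unfolding lim using that by (rule IT.distr_lim)
  have "prob_space (IT.CI {})"
    by (rule IT.PF.prob_space_P) simp_all
  then have *: "prob_space (distr (markov_law S P \<mu>) (PiM {} (\<lambda>_. S)) (\<lambda>\<omega>. restrict \<omega> {}))"
    by (simp only: marginal finite.emptyI)
  have [measurable_cong]: "sets (markov_law S P \<mu>) = sets (PiM UNIV (\<lambda>_. S))"
    by (rule sets)
  show "prob_space (markov_law S P \<mu>)"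
    by (rule prob_space_distrD [OF _ *]) (auto intro!: measurable_restrict)
  have up: "IT.up_to {0..<n} = n"
    using IT.up_to [of "{0..<n}"] by (intro antisym) (auto simp: IT.up_to_iff ivl_subset)
  show "distr (markov_law S P \<mu>) (PiM {0..<n} (\<lambda>_. S)) (\<lambda>\<omega>. restrict \<omega> {0..<n}) =
       IT.C 0 n (\<lambda>_. undefined)"
    using IT.distr_C [of n n "\<lambda>_. undefined" 0] by (simp add: marginal IT.CI_def up)
qed

definition stationary_distribution :: "'a measure \<Rightarrow> ('a \<Rightarrow> 'a measure) \<Rightarrow> 'a measure \<Rightarrow> bool" where
  "stationary_distribution S P \<pi> \<longleftrightarrow> \<pi> \<in> space (prob_algebra S) \<and> \<pi> \<bind> P = \<pi>"

text \<open>
  The stationary distribution, which is unique, is an explicit argument of the next predicate.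
\<close>

definition irreducible_aperiodic_positive ::
    "'a measure \<Rightarrow> ('a \<Rightarrow> 'a measure) \<Rightarrow> 'a measure \<Rightarrow> bool" where
  "irreducible_aperiodic_positive S P \<pi> \<longleftrightarrow>
     stationary_distribution S P \<pi> \<and>
     (\<forall>x\<in>space S. \<forall>A\<in>sets S. measure \<pi> A > 0 \<longrightarrow>
        (\<forall>\<^sub>F n in sequentially. measure (kernel_power S P n x) A > 0))"

definition return_time :: "'a set \<Rightarrow> (nat \<Rightarrow> 'a) \<Rightarrow> enat" where
  "return_time C \<omega> = Inf {enat n | n. n \<ge> 1 \<and> \<omega> n \<in> C}"

definition power_enat :: "real \<Rightarrow> enat \<Rightarrow> ennreal" where
  "power_enat \<kappa> k = (case k of enat n \<Rightarrow> ennreal (\<kappa> ^ n) | \<infinity> \<Rightarrow> \<infinity>)"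

definition geometric_small_set :: "'a measure \<Rightarrow> ('a \<Rightarrow> 'a measure) \<Rightarrow> 'a set \<Rightarrow> bool" where
  "geometric_small_set S P C \<longleftrightarrow>
     C \<in> sets S \<and> C \<noteq> {} \<and>
     (\<exists>(m::nat) \<nu> (\<delta>::real) (\<kappa>::real).
        m > 0 \<and> \<nu> \<in> space (prob_algebra S) \<and> 0 < \<delta> \<and> \<delta> < 1 \<and> \<kappa> > 1 \<and>
        (\<forall>x\<in>C. \<forall>A\<in>sets S. measure (kernel_power S P m x) A \<ge> \<delta> * measure \<nu> A) \<and>
        (SUP x\<in>C. \<integral>\<^sup>+\<omega>. power_enat \<kappa> (return_time C \<omega>) \<partial>markov_law_from S P x) < \<infinity>)"

definition geometrically_ergodic ::
    "'a measure \<Rightarrow> ('a \<Rightarrow> 'a measure) \<Rightarrow> 'a measure \<Rightarrow> bool" where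
  "geometrically_ergodic S P \<pi> \<longleftrightarrow>
     irreducible_aperiodic_positive S P \<pi> \<and> (\<exists>C. geometric_small_set S P C)"

text \<open>
  A point of the \<open>n\<close>-fold product of \<open>S\<close> is a function in
  \<open>PiE {..<n} (\<lambda>_. space S)\<close>.
\<close>

definition separately_bounded ::
    "'a measure \<Rightarrow> nat \<Rightarrow> ((nat \<Rightarrow> 'a) \<Rightarrow> real) \<Rightarrow> (nat \<Rightarrow> real) \<Rightarrow> bool" where
  "separately_bounded S n K L \<longleftrightarrow>
     (\<forall>i<n. \<forall>x\<in>PiE {..<n} (\<lambda>_. space S). \<forall>y\<in>space S. \<bar>K x - K (x(i := y))\<bar> \<le> L i)"

definition deviation_prob ::
    "(nat \<Rightarrow> 'a) measure \<Rightarrow> nat \<Rightarrow> ((nat \<Rightarrow> 'a) \<Rightarrow> real) \<Rightarrow> real \<Rightarrow> real" where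
  "deviation_prob M n K t =
     measure M {\<omega>\<in>space M.
       \<bar>K (restrict \<omega> {..<n}) - (\<integral>\<omega>'. K (restrict \<omega>' {..<n}) \<partial>M)\<bar> > t}"

text \<open>
  The degenerate case is singled out because \<open>x / 0 = 0\<close> would turn the bound into 2.
\<close>

definition concentration_bound :: "real \<Rightarrow> nat \<Rightarrow> (nat \<Rightarrow> real) \<Rightarrow> real \<Rightarrow> real" where
  "concentration_bound M\<^sub>0 n L t =
     (if (\<Sum>i<n. (L i)\<^sup>2) = 0 then 0
      else 2 * exp (- (inverse M\<^sub>0 * t\<^sup>2 / (\<Sum>i<n. (L i)\<^sup>2))))"

end

theory Submission
  imports Defs
begin

text \<open>
  Let \<open>V x\<close> be the exponential moment of the hitting time of \<open>C\<close>. It satisfies a geometric drift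
  condition, and irreducibility and aperiodicity make its sublevel sets small for some iterate of
  the kernel, so the argument of Hairer and Mattingly yields
  \<open>\<bar>P\<^sup>n \<phi> x - P\<^sup>n \<phi> y\<bar> \<le> A * \<rho> ^ n * (V x + V y)\<close> for \<open>\<bar>\<phi>\<bar> \<le> 1\<close>. Following Dedecker and Gouezel, the
  martingale of conditional expectations of \<open>K\<close> is looked at only at the visits to \<open>C\<close>: by the
  contraction, its increment over an excursion of length \<open>\<tau>\<close> starting at time \<open>k\<close> is at most a
  constant times \<open>\<Sum>l\<ge>k. L l * \<rho> ^ (l - k - \<tau>)\<close> (truncated subtraction). As \<open>\<tau>\<close> has exponential
  moments, this gives \<open>E exp (K - E K) \<le> exp (M * (\<Sum>i<n. (L i)\<^sup>2))\<close> as long as all \<open>L i\<close> are small.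
  Coordinates with a large \<open>L i\<close> are frozen, and a Chernoff bound concludes.
\<close>

subsection \<open>Markov kernels acting on bounded measurable functions\<close>

text \<open>The obstacle is the weight \<open>W x + W y\<close> in the contraction: it is unbounded
  off \<open>C\<close>, so one-step martingale increments are unbounded and the Azuma-Hoeffding
  argument does not apply. On \<open>C\<close> the weight of a point is 1, which is why increments
  are cut there. An excursion of length \<open>q\<close> then costs
  \<open>exp (gap_const * \<epsilon>) ^ q\<close> in the exponential and
  \<open>\<rho> ^ (- 2 * q)\<close> in the squared influences; once \<rho> is enlarged so that
  \<open>1 \<le> \<kappa> * \<rho> ^ 4\<close>, the factor \<open>\<kappa> ^ q\<close> granted by
  the drift pays for both. Multiplying \<open>K\<close> by the Laplace parameter destroys any
  smallness of the \<open>L i\<close>, hence the freezing. \<open>V\<close> may be infinite, so the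
  estimates live on the set \<open>good\<close> where it is finite; the chain started there almost
  surely stays there. Conditional expectations are iterated integrals, defined at every trajectory,
  so that inductions can be pointwise. One constant serves \<pi> and all \<open>x\<close> in
  \<open>C\<close> because the initial law enters only through the bound \<open>b\<close> on its
  integral of \<open>V\<close>.\<close>

definition bmeas :: "'a measure \<Rightarrow> ('a \<Rightarrow> real) \<Rightarrow> bool" where
  "bmeas M f \<longleftrightarrow> f \<in> borel_measurable M \<and> (\<exists>b. \<forall>x\<in>space M. \<bar>f x\<bar> \<le> b)"

lemma bmeasI: "f \<in> borel_measurable M \<Longrightarrow> (\<And>x. x \<in> space M \<Longrightarrow> \<bar>f x\<bar> \<le> b) \<Longrightarrow> bmeas M f"
  unfolding bmeas_def by blast

lemma bmeas_measurable [measurable_dest]: "bmeas M f \<Longrightarrow> f \<in> borel_measurable M"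
  by (simp add: bmeas_def)

lemma bmeas_bounded:
  assumes "bmeas M f"
  obtains b where "b \<ge> 0" "\<And>x. x \<in> space M \<Longrightarrow> \<bar>f x\<bar> \<le> b"
proof -
  from assms obtain b where "\<forall>x\<in>space M. \<bar>f x\<bar> \<le> b"
    unfolding bmeas_def by blast
  then show ?thesis
    by (intro that [of "max 0 b"]) (auto intro: order_trans)
qed

lemma bmeas_const: "bmeas M (\<lambda>x. c)"
  by (rule bmeasI [where b = "\<bar>c\<bar>"]) auto

lemma bmeas_add:
  assumes "bmeas M f" "bmeas M g"
  shows "bmeas M (\<lambda>x. f x + g x)"
proof -
  obtain a b where "\<And>x. x \<in> space M \<Longrightarrow> \<bar>f x\<bar> \<le> a" "\<And>x. x \<in> space M \<Longrightarrow> \<bar>g x\<bar> \<le> b"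
    using assms by (metis bmeas_bounded)
  then have "\<bar>f x + g x\<bar> \<le> a + b" if "x \<in> space M" for x
    using that abs_triangle_ineq [of "f x" "g x"] by fastforce
  then show ?thesis
    using assms by (intro bmeasI [where b = "a + b"]) (auto simp: bmeas_def)
qed

lemma bmeas_mult:
  assumes "bmeas M f" "bmeas M g"
  shows "bmeas M (\<lambda>x. f x * g x)"
proof -
  obtain a b where "a \<ge> 0" "\<And>x. x \<in> space M \<Longrightarrow> \<bar>f x\<bar> \<le> a" "\<And>x. x \<in> space M \<Longrightarrow> \<bar>g x\<bar> \<le> b"
    using assms by (metis bmeas_bounded)
  then have "\<bar>f x * g x\<bar> \<le> a * b" if "x \<in> space M" for x
    using that by (auto simp: abs_mult intro!: mult_mono)
  then show ?thesis
    using assms by (intro bmeasI [where b = "a * b"]) (auto simp: bmeas_def)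
qed

lemma bmeas_diff:
  assumes "bmeas M f" "bmeas M g"
  shows "bmeas M (\<lambda>x. f x - g x)"
  using bmeas_add [OF assms(1) bmeas_mult [OF bmeas_const [of M "-1"] assms(2)]] by simp

lemma bmeas_exp:
  assumes "bmeas M f"
  shows "bmeas M (\<lambda>x. exp (f x))"
proof -
  obtain b where "\<And>x. x \<in> space M \<Longrightarrow> \<bar>f x\<bar> \<le> b"
    using assms by (metis bmeas_bounded)
  then have "exp (f x) \<le> exp b" if "x \<in> space M" for x
    using that by (fastforce simp: abs_le_iff)
  then show ?thesis
    using assms by (intro bmeasI [where b = "exp b"]) (auto simp: bmeas_def)
qed

lemma bmeas_indicator: "A \<in> sets M \<Longrightarrow> bmeas M (indicator A)"
  by (rule bmeasI [where b = 1]) (auto split: split_indicator)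

lemma bmeas_If:
  assumes "bmeas M f" "bmeas M g" "A \<in> sets M"
  shows "bmeas M (\<lambda>x. if x \<in> A then f x else g x)"
proof -
  have "bmeas M (\<lambda>x. indicator A x * f x + (1 - indicator A x) * g x)"
    using assms by (intro bmeas_add bmeas_mult bmeas_diff bmeas_const bmeas_indicator)
  also have "(\<lambda>x. indicator A x * f x + (1 - indicator A x) * g x)
      = (\<lambda>x. if x \<in> A then f x else g x)"
    by (auto split: split_indicator)
  finally show ?thesis .
qed

lemma prob_algebraD:
  assumes "N \<in> space (prob_algebra M)"
  shows "prob_space N" "sets N = sets M" "space N = space M"
  using assms by (auto simp: space_prob_algebra dest: sets_eq_imp_space_eq)

lemma bmeas_integrable:
  assumes "bmeas M f" "N \<in> space (prob_algebra M)"
  shows "integrable N f"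
proof -
  interpret prob_space N using prob_algebraD(1) [OF assms(2)] .
  obtain b where b: "\<And>x. x \<in> space M \<Longrightarrow> \<bar>f x\<bar> \<le> b"
    using assms by (metis bmeas_bounded)
  have "f \<in> borel_measurable N"
    using assms(1) prob_algebraD [OF assms(2)] by (auto simp: bmeas_def cong: measurable_cong_sets)
  then show ?thesis
    using b prob_algebraD [OF assms(2)] by (intro integrable_const_bound [where B = b] AE_I2) auto
qed

lemma integral_add_const:
  fixes f :: "'a \<Rightarrow> real"
  assumes "prob_space N" "integrable N f"
  shows "(\<integral>x. f x + c \<partial>N) = (\<integral>x. f x \<partial>N) + c"
proof -
  interpret prob_space N by fact
  show ?thesis using assms by (simp add: prob_space)
qed

lemma integral_abs_le:
  fixes f :: "'a \<Rightarrow> real"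
  assumes "f \<in> borel_measurable M" "N \<in> space (prob_algebra M)"
    and b: "\<And>x. x \<in> space M \<Longrightarrow> \<bar>f x\<bar> \<le> b"
  shows "\<bar>\<integral>x. f x \<partial>N\<bar> \<le> b"
proof -
  interpret prob_space N using prob_algebraD(1) [OF assms(2)] .
  have i: "integrable N f"
    using assms by (metis bmeasI bmeas_integrable)
  have "\<bar>\<integral>x. f x \<partial>N\<bar> \<le> (\<integral>x. \<bar>f x\<bar> \<partial>N)"
    by (rule integral_abs_bound)
  also have "\<dots> \<le> b"
    using b prob_algebraD [OF assms(2)] i by (intro integral_le_const AE_I2) auto
  finally show ?thesis .
qed

text \<open>Pushing \<open>L x\<close> forward under \<open>Pair x\<close> moves the dependence on
  \<open>x\<close> from the integrand into the measure, and the integral of a fixed function is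
  measurable in the measure.\<close>

lemma integral_measurable_subprob_algebra2:
  fixes f :: "'a \<Rightarrow> 'b \<Rightarrow> real"
  assumes f [measurable]: "(\<lambda>(x, y). f x y) \<in> borel_measurable (M \<Otimes>\<^sub>M N)"
    and L [measurable]: "L \<in> M \<rightarrow>\<^sub>M subprob_algebra N"
  shows "(\<lambda>x. \<integral>y. f x y \<partial>L x) \<in> borel_measurable M"
proof -
  have "(\<lambda>x. \<integral>z. (case z of (x, y) \<Rightarrow> f x y) \<partial>distr (L x) (M \<Otimes>\<^sub>M N) (Pair x)) \<in> borel_measurable M"
    by (rule measurable_compose [OF _ integral_measurable_subprob_algebra [OF f]])
       (rule measurable_distr2 [OF _ L], simp)
  also have "?this \<longleftrightarrow> ?thesis"
  proof (rule measurable_cong)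
    fix x assume x: "x \<in> space M"
    then have [measurable_cong]: "sets (L x) = sets N"
      by (rule subprob_measurableD(2) [OF L])
    show "(\<integral>z. (case z of (x, y) \<Rightarrow> f x y) \<partial>distr (L x) (M \<Otimes>\<^sub>M N) (Pair x)) = (\<integral>y. f x y \<partial>L x)"
      using x by (subst integral_distr) auto
  qed
  finally show ?thesis .
qed

lemma integral_bind_bmeas:
  assumes N: "N \<in> space (prob_algebra M)" and Q: "Q \<in> M \<rightarrow>\<^sub>M prob_algebra B" and f: "bmeas B f"
  shows "(\<integral>x. f x \<partial>(N \<bind> Q)) = (\<integral>x. \<integral>y. f y \<partial>Q x \<partial>N)"
proof -
  obtain b where b: "\<And>x. x \<in> space B \<Longrightarrow> \<bar>f x\<bar> \<le> b"
    using f by (metis bmeas_bounded)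
  \<comment> \<open>Adding the bound makes the integrand nonnegative, so
    \<open>nn_integral_bind\<close> applies; all measures have mass 1, so the shift appears as
    \<open>b\<close> on both sides.\<close>
  define g where "g x = f x + b" for x
  have g0: "0 \<le> g x" if "x \<in> space B" for x
    using b [OF that] by (simp add: g_def abs_le_iff)
  have g: "bmeas B g"
    unfolding g_def by (intro bmeas_add f bmeas_const)
  have NQ: "N \<bind> Q \<in> space (prob_algebra B)"
    using measurable_bind_prob_space [of "\<lambda>_. N" "count_space UNIV" M Q B] N Q
    by (auto dest!: measurable_space)
  have QN: "Q x \<in> space (prob_algebra B)" if "x \<in> space N" for x
    using that Q prob_algebraD [OF N] by (auto dest: measurable_space)
  have inner: "bmeas M (\<lambda>x. \<integral>y. h y \<partial>Q x)" if h: "bmeas B h" for h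
  proof -
    obtain b where b: "\<And>x. x \<in> space B \<Longrightarrow> \<bar>h x\<bar> \<le> b"
      using h by (metis bmeas_bounded)
    have "(\<lambda>x. \<integral>y. h y \<partial>Q x) \<in> borel_measurable M"
      using h Q by (intro integral_measurable_subprob_algebra2 [where N = B])
        (auto simp: measurable_prob_algebraD bmeas_def)
    then show ?thesis
      using QN prob_algebraD [OF N] b h
      by (intro bmeasI [where b = b] integral_abs_le) (auto simp: bmeas_def)
  qed
  have "ennreal (\<integral>x. g x \<partial>(N \<bind> Q)) = (\<integral>\<^sup>+x. g x \<partial>(N \<bind> Q))"
    using g0 prob_algebraD [OF NQ]
    by (intro nn_integral_eq_integral [symmetric] bmeas_integrable [OF g NQ] AE_I2) auto
  also have "\<dots> = (\<integral>\<^sup>+x. \<integral>\<^sup>+y. g y \<partial>Q x \<partial>N)"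
    using g Q prob_algebraD [OF N]
    by (intro nn_integral_bind [where B = B]) (auto simp: bmeas_def measurable_prob_algebraD cong: measurable_cong_sets)
  also have "\<dots> = (\<integral>\<^sup>+x. ennreal (\<integral>y. g y \<partial>Q x) \<partial>N)"
    using g0 prob_algebraD [OF QN]
    by (intro nn_integral_cong nn_integral_eq_integral bmeas_integrable [OF g QN] AE_I2) auto
  also have "\<dots> = ennreal (\<integral>x. \<integral>y. g y \<partial>Q x \<partial>N)"
    using g0 prob_algebraD [OF QN]
    by (intro nn_integral_eq_integral bmeas_integrable [OF inner [OF g] N] AE_I2) (auto intro!: Bochner_Integration.integral_nonneg)
  finally have "(\<integral>x. g x \<partial>(N \<bind> Q)) = (\<integral>x. \<integral>y. g y \<partial>Q x \<partial>N)"
    using g0 prob_algebraD [OF NQ] prob_algebraD [OF QN]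
    by (subst (asm) ennreal_inj) (auto intro!: Bochner_Integration.integral_nonneg)
  moreover have "(\<integral>x. g x \<partial>(N \<bind> Q)) = (\<integral>x. f x \<partial>(N \<bind> Q)) + b"
    unfolding g_def using prob_algebraD [OF NQ] bmeas_integrable [OF f NQ]
    by (simp add: integral_add_const)
  moreover have "(\<integral>x. \<integral>y. g y \<partial>Q x \<partial>N) = (\<integral>x. (\<integral>y. f y \<partial>Q x) + b \<partial>N)"
    unfolding g_def using prob_algebraD [OF QN] bmeas_integrable [OF f QN]
    by (intro Bochner_Integration.integral_cong) (auto simp: integral_add_const)
  moreover have "\<dots> = (\<integral>x. \<integral>y. f y \<partial>Q x \<partial>N) + b"
    using prob_algebraD [OF N] bmeas_integrable [OF inner [OF f] N]
    by (simp add: integral_add_const)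
  ultimately show ?thesis by simp
qed

definition kop :: "('a \<Rightarrow> 'a measure) \<Rightarrow> ('a \<Rightarrow> real) \<Rightarrow> 'a \<Rightarrow> real" where
  "kop Q \<phi> x = (\<integral>y. \<phi> y \<partial>Q x)"

locale kernel =
  fixes S :: "'a measure" and P :: "'a \<Rightarrow> 'a measure"
  assumes kernel [measurable]: "P \<in> S \<rightarrow>\<^sub>M prob_algebra S"
begin

lemma kernel_subprob [measurable]: "P \<in> S \<rightarrow>\<^sub>M subprob_algebra S"
  by (rule measurable_prob_algebraD) (rule kernel)

lemma kernel_space: "x \<in> space S \<Longrightarrow> P x \<in> space (prob_algebra S)"
  using kernel by (rule measurable_space)

lemma kop_abs_le:
  assumes "\<phi> \<in> borel_measurable S" "\<And>x. x \<in> space S \<Longrightarrow> \<bar>\<phi> x\<bar> \<le> b" "x \<in> space S"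
  shows "\<bar>kop P \<phi> x\<bar> \<le> b"
  unfolding kop_def using assms kernel_space by (intro integral_abs_le [where M = S]) auto

lemma kop_measurable:
  assumes [measurable]: "\<phi> \<in> borel_measurable S"
  shows "kop P \<phi> \<in> borel_measurable S"
  unfolding kop_def by (rule integral_measurable_subprob_algebra2 [where N = S]) auto

lemma bmeas_kop:
  assumes "bmeas S \<phi>"
  shows "bmeas S (kop P \<phi>)"
proof -
  obtain b where "\<And>x. x \<in> space S \<Longrightarrow> \<bar>\<phi> x\<bar> \<le> b"
    using assms by (metis bmeas_bounded)
  then show ?thesis
    using assms by (intro bmeasI [where b = b] kop_abs_le kop_measurable) (auto simp: bmeas_def)
qed

lemma bmeas_kop_funpow: "bmeas S \<phi> \<Longrightarrow> bmeas S ((kop P ^^ n) \<phi>)"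
  by (induction n) (auto intro: bmeas_kop)

lemma kop_funpow_abs_le:
  assumes "\<phi> \<in> borel_measurable S" "\<And>x. x \<in> space S \<Longrightarrow> \<bar>\<phi> x\<bar> \<le> b" "x \<in> space S"
  shows "\<bar>(kop P ^^ n) \<phi> x\<bar> \<le> b"
  using assms(3)
proof (induction n arbitrary: x)
  case (Suc n)
  have "bmeas S ((kop P ^^ n) \<phi>)"
    using assms by (intro bmeas_kop_funpow bmeasI) auto
  with Suc show ?case
    by (auto intro!: kop_abs_le simp: bmeas_def)
qed (use assms in auto)

lemma kop_mono:
  assumes "bmeas S \<phi>" "bmeas S \<psi>" "\<And>x. x \<in> space S \<Longrightarrow> \<phi> x \<le> \<psi> x" "x \<in> space S"
  shows "kop P \<phi> x \<le> kop P \<psi> x"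
  unfolding kop_def using assms prob_algebraD(3) [OF kernel_space [OF assms(4)]]
  by (intro integral_mono bmeas_integrable [OF _ kernel_space]) auto

lemma kop_const: "x \<in> space S \<Longrightarrow> kop P (\<lambda>_. c) x = c"
  unfolding kop_def using prob_space.prob_space [OF prob_algebraD(1) [OF kernel_space]] by simp

lemma kernel_power_measurable [measurable]: "kernel_power S P n \<in> S \<rightarrow>\<^sub>M prob_algebra S"
proof (induction n)
  case 0
  then show ?case
    by (simp add: measurable_return_prob_space cong: measurable_cong)
next
  case (Suc n)
  then show ?case
    using measurable_bind_prob_space [OF Suc kernel] by simp
qed

lemma kernel_power_space: "x \<in> space S \<Longrightarrow> kernel_power S P n x \<in> space (prob_algebra S)"
  using kernel_power_measurable by (rule measurable_space)

text \<open>\<open>kernel_power\<close> splits off the last step of the chain,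
  \<open>kop P ^^ Suc n\<close> the first one; the induction therefore replaces \<phi> by
  \<open>kop P \<phi>\<close> and commutes the powers at the end.\<close>

lemma integral_kernel_power:
  "bmeas S \<phi> \<Longrightarrow> x \<in> space S \<Longrightarrow> (\<integral>y. \<phi> y \<partial>kernel_power S P n x) = (kop P ^^ n) \<phi> x"
proof (induction n arbitrary: \<phi>)
  case 0
  then show ?case
    by (simp add: integral_return bmeas_def)
next
  case (Suc n)
  have "(\<integral>y. \<phi> y \<partial>kernel_power S P (Suc n) x) = (\<integral>y. kop P \<phi> y \<partial>kernel_power S P n x)"
    unfolding kop_def kernel_power.simps
    by (rule integral_bind_bmeas [OF kernel_power_space kernel]) (use Suc in auto)
  also have "\<dots> = (kop P ^^ n) (kop P \<phi>) x"
    by (rule Suc.IH [OF bmeas_kop]) (use Suc in auto)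
  finally show ?case
    by (simp add: funpow_swap1)
qed

lemma measure_kernel_power:
  assumes "x \<in> space S" "A \<in> sets S"
  shows "measure (kernel_power S P n x) A = (kop P ^^ n) (indicator A) x"
  using integral_kernel_power [OF bmeas_indicator [OF assms(2)] assms(1), of n]
    prob_algebraD [OF kernel_power_space [OF assms(1)], of n] assms(2)
  by simp

end

subsection \<open>Contraction under a drift and a minorization condition\<close>

text \<open>The oscillation estimates need real arithmetic while \<open>V\<close> may be infinite; a
  finite integral permits the passage to \<open>enn2real\<close>.\<close>

lemma prob_integrable_enn2real:
  assumes N: "N \<in> space (prob_algebra M)" and V: "V \<in> borel_measurable M"
    and le: "(\<integral>\<^sup>+x. V x \<partial>N) \<le> ennreal b" and b: "0 \<le> b"
  shows "AE x in N. V x < \<infinity>" "integrable N (\<lambda>x. enn2real (V x))" "(\<integral>x. enn2real (V x) \<partial>N) \<le> b"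
proof -
  have [measurable]: "V \<in> borel_measurable N"
    using V prob_algebraD [OF N] by (auto cong: measurable_cong_sets)
  have fin: "(\<integral>\<^sup>+x. V x \<partial>N) < \<infinity>"
    using le by (auto simp: less_top [symmetric] top_unique)
  then have "AE x in N. V x \<noteq> \<infinity>"
    by (intro nn_integral_PInf_AE) auto
  then show ae: "AE x in N. V x < \<infinity>"
    by (auto simp: less_top)
  have eq: "(\<integral>\<^sup>+x. ennreal (enn2real (V x)) \<partial>N) = (\<integral>\<^sup>+x. V x \<partial>N)"
    using ae by (intro nn_integral_cong_AE) auto
  show i: "integrable N (\<lambda>x. enn2real (V x))"
    using fin eq by (intro integrableI_nonneg) auto
  have "ennreal (\<integral>x. enn2real (V x) \<partial>N) \<le> ennreal b"
    using le eq nn_integral_eq_integral [OF i] by simp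
  then show "(\<integral>x. enn2real (V x) \<partial>N) \<le> b"
    using b by simp
qed

lemma nn_integral_minorized:
  assumes N: "N \<in> space (prob_algebra M)" and \<nu>: "\<nu> \<in> space (prob_algebra M)" and \<epsilon>: "0 < \<epsilon>"
    and minor: "\<And>A. A \<in> sets M \<Longrightarrow> \<epsilon> * measure \<nu> A \<le> measure N A"
    and f: "f \<in> borel_measurable M"
  shows "ennreal \<epsilon> * (\<integral>\<^sup>+x. f x \<partial>\<nu>) \<le> (\<integral>\<^sup>+x. f x \<partial>N)"
proof -
  note P = prob_algebraD [OF N] and Q = prob_algebraD [OF \<nu>]
  interpret N: prob_space N by (rule P)
  interpret \<nu>: prob_space \<nu> by (rule Q)
  have "scale_measure (ennreal \<epsilon>) \<nu> \<le> N"
  proof (subst le_measure; safe?)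
    fix A assume "A \<in> sets (scale_measure (ennreal \<epsilon>) \<nu>)"
    then show "emeasure (scale_measure (ennreal \<epsilon>) \<nu>) A \<le> emeasure N A"
      using minor [of A] \<epsilon> Q(2)
      by (simp add: N.emeasure_eq_measure \<nu>.emeasure_eq_measure flip: ennreal_mult)
  qed (use P Q in auto)
  moreover have [measurable]: "f \<in> borel_measurable \<nu>"
    using f Q(2) by (auto cong: measurable_cong_sets)
  ultimately show ?thesis
    using nn_integral_mono_measure [of "scale_measure (ennreal \<epsilon>) \<nu>" N f] P Q
    by (simp add: nn_integral_scale_measure)
qed

context kernel
begin

context
  fixes V :: "'a \<Rightarrow> ennreal" and g B :: real
  assumes V [measurable]: "V \<in> borel_measurable S"
    and V_ge_1: "x \<in> space S \<Longrightarrow> 1 \<le> V x"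
    and drift: "x \<in> space S \<Longrightarrow> (\<integral>\<^sup>+y. V y \<partial>P x) \<le> ennreal g * V x + ennreal B"
    and g: "0 \<le> g" "g < 1" and B: "0 \<le> B"
begin

lemma drift_finite:
  assumes "x \<in> space S" "V x < \<infinity>"
  shows "AE y in P x. V y < \<infinity>" "integrable (P x) (\<lambda>y. enn2real (V y))"
    "(\<integral>y. enn2real (V y) \<partial>P x) \<le> g * enn2real (V x) + B"
proof -
  have "(\<integral>\<^sup>+y. V y \<partial>P x) \<le> ennreal g * V x + ennreal B"
    using assms drift by blast
  also have "\<dots> = ennreal (g * enn2real (V x) + B)"
    using assms(2) g B by (simp add: ennreal_mult flip: less_top)
  finally have *: "(\<integral>\<^sup>+y. V y \<partial>P x) \<le> ennreal (g * enn2real (V x) + B)" .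
  note prob_integrable_enn2real [OF kernel_space V *] 
  then show "AE y in P x. V y < \<infinity>" "integrable (P x) (\<lambda>y. enn2real (V y))"
    "(\<integral>y. enn2real (V y) \<partial>P x) \<le> g * enn2real (V x) + B"
    using assms g B by auto
qed

text \<open>The bound on \<psi> is only assumed where \<open>V\<close> is finite; by the drift this
  is almost everywhere under \<open>P x\<close>.\<close>

lemma kop_le_drift:
  assumes \<psi>: "bmeas S \<psi>" and x: "x \<in> space S" "V x < \<infinity>" and r: "0 \<le> r" and \<beta>: "0 \<le> \<beta>"
    and le: "\<And>y. y \<in> space S \<Longrightarrow> V y < \<infinity> \<Longrightarrow> \<psi> y \<le> r * (1 + \<beta> * enn2real (V y))"
  shows "kop P \<psi> x \<le> r * (1 + \<beta> * (g * enn2real (V x) + B))"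
proof -
  note P = prob_algebraD [OF kernel_space [OF x(1)]]
  interpret prob_space "P x" by (rule P)
  note d = drift_finite [OF x]
  have "kop P \<psi> x \<le> (\<integral>y. r * (1 + \<beta> * enn2real (V y)) \<partial>P x)"
    unfolding kop_def using d(1) P(3) le
    by (intro integral_mono_AE bmeas_integrable [OF \<psi> kernel_space [OF x(1)]]) (auto simp: d)
  also have "\<dots> = r * (1 + \<beta> * (\<integral>y. enn2real (V y) \<partial>P x))"
    using d(2) by (simp add: prob_space)
  also have "\<dots> \<le> r * (1 + \<beta> * (g * enn2real (V x) + B))"
    using d(3) r \<beta> by (intro mult_left_mono add_mono) auto
  finally show ?thesis .
qed

text \<open>The slack \<open>r * (1 + \<beta> * V) - \<psi>\<close> is nonnegative, so its
  \<open>P x\<close>-integral is at least \<epsilon> times its \<nu>-integral, which is at least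
  \<open>r\<close> minus the \<nu>-integral of \<psi>. This is the gain over
  \<open>kop_le_drift\<close>.\<close>

lemma kop_le_drift_minorized:
  assumes \<psi>: "bmeas S \<psi>" and x: "x \<in> space S" "V x < \<infinity>" and r: "0 \<le> r" and \<beta>: "0 \<le> \<beta>"
    and le: "\<And>y. y \<in> space S \<Longrightarrow> V y < \<infinity> \<Longrightarrow> \<psi> y \<le> r * (1 + \<beta> * enn2real (V y))"
    and \<nu>: "\<nu> \<in> space (prob_algebra S)" and \<epsilon>: "0 < \<epsilon>"
    and minor: "\<And>A. A \<in> sets S \<Longrightarrow> \<epsilon> * measure \<nu> A \<le> measure (P x) A"
  shows "kop P \<psi> x \<le> r * (1 + \<beta> * (g * enn2real (V x) + B)) - \<epsilon> * (r - (\<integral>y. \<psi> y \<partial>\<nu>))"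
proof -
  note P = prob_algebraD [OF kernel_space [OF x(1)]]
  note N = prob_algebraD [OF \<nu>]
  interpret prob_space "P x" by (rule P)
  interpret N: prob_space \<nu> by (rule N)
  note d = drift_finite [OF x]
  define f where "f y = r * (1 + \<beta> * enn2real (V y)) - \<psi> y" for y
  note [measurable] = bmeas_measurable [OF \<psi>]
  have [measurable]: "f \<in> borel_measurable S"
    unfolding f_def by measurable
  have [measurable_cong]: "sets (P x) = sets S" "sets \<nu> = sets S"
    using P N by auto
  have f0: "0 \<le> f y" if "y \<in> space S" "V y < \<infinity>" for y
    using le [OF that] by (simp add: f_def)
  have inf_set: "{y\<in>space S. \<not> V y < \<infinity>} \<in> sets S"
    by measurable
  \<comment> \<open>\<open>P x\<close> does not charge the set where \<open>V\<close> is infinite,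
    and the minorization transfers this to \<nu>.\<close>
  have "prob {y\<in>space S. \<not> V y < \<infinity>} = 0"
    using d(1) P by (subst prob_eq_0) (auto simp: inf_set)
  then have "measure \<nu> {y\<in>space S. \<not> V y < \<infinity>} \<le> 0"
    using minor [OF inf_set] \<epsilon> by (simp add: mult_le_0_iff)
  then have aeN: "AE y in \<nu>. V y < \<infinity>"
    using N inf_set N.prob_eq_0 [of "{y\<in>space S. \<not> V y < \<infinity>}"] 
    by (auto simp: measure_le_0_iff elim!: AE_mp)
  have "ennreal \<epsilon> * (\<integral>\<^sup>+y. f y \<partial>\<nu>) \<le> (\<integral>\<^sup>+y. f y \<partial>P x)"
    by (intro nn_integral_minorized [OF kernel_space [OF x(1)] \<nu> \<epsilon> minor]) auto
  moreover have i: "integrable (P x) f"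
    unfolding f_def using d(2) bmeas_integrable [OF \<psi> kernel_space [OF x(1)]] by simp
  moreover have ae: "AE y in P x. 0 \<le> f y"
    using d(1) P f0 by auto
  ultimately have le': "ennreal \<epsilon> * (\<integral>\<^sup>+y. f y \<partial>\<nu>) \<le> ennreal (\<integral>y. f y \<partial>P x)"
    by (simp add: nn_integral_eq_integral)
  then have "(\<integral>\<^sup>+y. f y \<partial>\<nu>) < \<infinity>"
    using \<epsilon> by (auto simp: less_top [symmetric] top_unique ennreal_mult_eq_top_iff)
  moreover have aeN': "AE y in \<nu>. 0 \<le> f y"
    using aeN N f0 by auto
  ultimately have iN: "integrable \<nu> f"
    by (intro integrableI_nonneg) auto
  have "ennreal (\<epsilon> * (\<integral>y. f y \<partial>\<nu>)) \<le> ennreal (\<integral>y. f y \<partial>P x)"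
    using le' nn_integral_eq_integral [OF iN aeN'] \<epsilon> by (simp add: ennreal_mult')
  then have "\<epsilon> * (\<integral>y. f y \<partial>\<nu>) \<le> (\<integral>y. f y \<partial>P x)"
    using ae by (simp add: integral_nonneg_AE)
  moreover have "r - (\<integral>y. \<psi> y \<partial>\<nu>) \<le> (\<integral>y. f y \<partial>\<nu>)"
  proof -
    have "(\<integral>y. r - \<psi> y \<partial>\<nu>) \<le> (\<integral>y. f y \<partial>\<nu>)"
    proof (rule integral_mono [OF _ iN])
      show "r - \<psi> y \<le> f y" for y
        using r \<beta> by (simp add: f_def algebra_simps)
    qed (use bmeas_integrable [OF \<psi> \<nu>] in simp)
    then show ?thesis
      using bmeas_integrable [OF \<psi> \<nu>] by (simp add: N.prob_space)
  qed
  moreover have "(\<integral>y. f y \<partial>P x) = r * (1 + \<beta> * (\<integral>y. enn2real (V y) \<partial>P x)) - kop P \<psi> x"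
    unfolding f_def kop_def using d(2) bmeas_integrable [OF \<psi> kernel_space [OF x(1)]]
    by (simp add: prob_space)
  moreover have "r * (1 + \<beta> * (\<integral>y. enn2real (V y) \<partial>P x)) \<le> r * (1 + \<beta> * (g * enn2real (V x) + B))"
    using d(3) r \<beta> by (intro mult_left_mono add_mono) auto
  ultimately show ?thesis
    using mult_left_mono [of "r - (\<integral>y. \<psi> y \<partial>\<nu>)" "\<integral>y. f y \<partial>\<nu>" \<epsilon>] \<epsilon> by linarith
qed

text \<open>
  The argument of Hairer and Mattingly: a function whose oscillation is controlled by
  \<open>2 + \<beta> * (V x + V y)\<close> is, up to an additive constant, controlled by \<open>1 + \<beta> * V x\<close>. When
  \<open>V x + V y\<close> is large the drift contracts, and otherwise the minorization does.
\<close>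

lemma harris_step:
  assumes R: "0 < R" "2 * B < (1 - g) * R"
    and \<nu>: "\<nu> \<in> space (prob_algebra S)" and \<epsilon>: "0 < \<epsilon>" "\<epsilon> < 1"
    and minor: "\<And>x A. x \<in> space S \<Longrightarrow> V x \<le> ennreal R \<Longrightarrow> A \<in> sets S \<Longrightarrow>
                  \<epsilon> * measure \<nu> A \<le> measure (P x) A"
  obtains \<alpha> \<beta> where "0 < \<alpha>" "\<alpha> < 1" "0 < \<beta>" "\<beta> \<le> 1"
    "\<And>r \<phi> x y. 0 \<le> r \<Longrightarrow> bmeas S \<phi> \<Longrightarrow>
       (\<And>x y. x \<in> space S \<Longrightarrow> V x < \<infinity> \<Longrightarrow> y \<in> space S \<Longrightarrow> V y < \<infinity> \<Longrightarrow>
          \<phi> x - \<phi> y \<le> r * (2 + \<beta> * (enn2real (V x) + enn2real (V y)))) \<Longrightarrow>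
       x \<in> space S \<Longrightarrow> V x < \<infinity> \<Longrightarrow> y \<in> space S \<Longrightarrow> V y < \<infinity> \<Longrightarrow>
       kop P \<phi> x - kop P \<phi> y \<le> \<alpha> * r * (2 + \<beta> * (enn2real (V x) + enn2real (V y)))"
proof -
  define W where "W x = enn2real (V x)" for x
  \<comment> \<open>With \<open>2 * B * \<beta> \<le> \<epsilon>\<close> the additive drift constant
    uses up at most half of the gain \<open>2 * \<epsilon>\<close> of the minorization.\<close>
  define \<beta> where "\<beta> = min 1 (\<epsilon> / (2 * B + 1))"
  \<comment> \<open>For \<open>w \<ge> R\<close> the constant \<open>2 * B\<close> is at most
    \<open>2 * B / R * w\<close>. Absorbing it raises the slope of the drift to \<open>g'\<close>,
    and \<open>g' < 1\<close> is the assumption on \<open>R\<close>.\<close>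
  define g' where "g' = g + 2 * B / R"
  \<comment> \<open>\<open>1 - \<epsilon> / 2\<close> and \<open>g\<close> bound the constant and
    the linear part when the minorization applies; the quotient is the contraction factor for large
    \<open>w\<close>, worst at \<open>w = R\<close>.\<close>
  define \<alpha> where "\<alpha> = max (max (1 - \<epsilon> / 2) g) ((2 + \<beta> * g' * R) / (2 + \<beta> * R))"
  have \<beta>: "0 < \<beta>" "\<beta> \<le> 1"
    using \<epsilon> B by (auto simp: \<beta>_def)
  have "2 * B * \<beta> \<le> 2 * B * (\<epsilon> / (2 * B + 1))"
    using B by (intro mult_left_mono) (auto simp: \<beta>_def)
  also have "\<dots> \<le> \<epsilon>"
    using B \<epsilon> by (simp add: field_simps)
  finally have \<beta>B: "2 * B * \<beta> \<le> \<epsilon>" .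
  have g': "0 \<le> g'" "g' < 1"
    using R g B by (auto simp: g'_def field_simps)
  have den: "0 < 2 + \<beta> * R"
    using \<beta> R by (simp add: add_pos_pos)
  have "\<beta> * g' * R < \<beta> * R"
    using g' \<beta> R by simp
  then have \<alpha>: "0 < \<alpha>" "\<alpha> < 1"
    using \<epsilon> g den by (auto simp: \<alpha>_def less_max_iff_disj)
  have large: "2 + \<beta> * (g * w + 2 * B) \<le> \<alpha> * (2 + \<beta> * w)" if w: "R \<le> w" for w
  proof -
    have "2 * B \<le> 2 * B / R * w"
      using w R B mult_left_mono [of R w "2 * B"] by (simp add: field_simps)
    then have "2 + \<beta> * (g * w + 2 * B) \<le> 2 + \<beta> * (g' * w)"
      using \<beta> by (simp add: g'_def distrib_right)
    also have "\<dots> \<le> (2 + \<beta> * g' * R) / (2 + \<beta> * R) * (2 + \<beta> * w)"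
    proof -
      have "0 \<le> 2 * \<beta> * (w - R) * (1 - g')"
        using w \<beta> g' by simp
      then have "(2 + \<beta> * (g' * w)) * (2 + \<beta> * R) \<le> (2 + \<beta> * g' * R) * (2 + \<beta> * w)"
        by (simp add: algebra_simps)
      then show ?thesis
        using den by (simp add: pos_le_divide_eq)
    qed
    also have "\<dots> \<le> \<alpha> * (2 + \<beta> * w)"
      using \<beta> R w by (intro mult_right_mono) (auto simp: \<alpha>_def)
    finally show ?thesis .
  qed
  have small: "2 + \<beta> * (g * w + 2 * B) - 2 * \<epsilon> \<le> \<alpha> * (2 + \<beta> * w)" if w: "0 \<le> w" for w
  proof -
    have "2 + \<beta> * (g * w + 2 * B) - 2 * \<epsilon> \<le> (1 - \<epsilon> / 2) * 2 + g * (\<beta> * w)"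
      using \<beta>B by (simp add: algebra_simps)
    also have "\<dots> \<le> \<alpha> * 2 + \<alpha> * (\<beta> * w)"
      using w \<beta> by (intro add_mono mult_right_mono) (auto simp: \<alpha>_def)
    finally show ?thesis by (simp add: algebra_simps)
  qed
  show ?thesis
  proof (rule that [OF \<alpha> \<beta>])
    fix r \<phi> x y
    assume r: "0 \<le> r" and \<phi>: "bmeas S \<phi>"
      and osc: "\<And>x y. x \<in> space S \<Longrightarrow> V x < \<infinity> \<Longrightarrow> y \<in> space S \<Longrightarrow> V y < \<infinity> \<Longrightarrow>
          \<phi> x - \<phi> y \<le> r * (2 + \<beta> * (enn2real (V x) + enn2real (V y)))"
      and x: "x \<in> space S" "V x < \<infinity>" and y: "y \<in> space S" "V y < \<infinity>"
    define S' where "S' = {x\<in>space S. V x < \<infinity>}"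
    define u where "u z = r * (1 + \<beta> * W z)" for z
    \<comment> \<open>By the oscillation bound every value of \<open>\<phi> - u\<close> lies below
      every value of \<open>\<phi> + u\<close>; a number in between is the additive constant
      sought.\<close>
    define c where "c = (INF z\<in>S'. \<phi> z + u z)"
    have two: "\<phi> z - u z \<le> \<phi> z' + u z'" if "z \<in> S'" "z' \<in> S'" for z z'
      using osc [of z z'] that by (simp add: S'_def u_def W_def algebra_simps)
    have xS': "x \<in> S'" using x by (simp add: S'_def)
    have c1: "\<phi> z - u z \<le> c" if "z \<in> S'" for z
      unfolding c_def using two [OF that] xS' by (intro cINF_greatest) auto
    have c2: "c \<le> \<phi> z + u z" if "z \<in> S'" for z
      unfolding c_def using two [OF xS'] that by (intro cINF_lower bdd_belowI2) auto
    have up: "\<phi> z - c \<le> r * (1 + \<beta> * enn2real (V z))" if "z \<in> space S" "V z < \<infinity>" for z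
      using c1 [of z] that by (simp add: S'_def u_def W_def)
    have lo: "c - \<phi> z \<le> r * (1 + \<beta> * enn2real (V z))" if "z \<in> space S" "V z < \<infinity>" for z
      using c2 [of z] that by (simp add: S'_def u_def W_def)
    have b: "bmeas S (\<lambda>z. \<phi> z - c)" "bmeas S (\<lambda>z. c - \<phi> z)"
      by (intro bmeas_diff \<phi> bmeas_const)+
    have kop: "kop P (\<lambda>z. \<phi> z - c) z = kop P \<phi> z - c" "kop P (\<lambda>z. c - \<phi> z) z = c - kop P \<phi> z"
      if z: "z \<in> space S" for z
    proof -
      interpret prob_space "P z" by (rule prob_algebraD [OF kernel_space [OF z]])
      show "kop P (\<lambda>z. \<phi> z - c) z = kop P \<phi> z - c" "kop P (\<lambda>z. c - \<phi> z) z = c - kop P \<phi> z"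
        unfolding kop_def using bmeas_integrable [OF \<phi> kernel_space [OF z]]
        by (simp_all add: prob_space)
    qed
    let ?w = "W x + W y"
    have w0: "0 \<le> ?w" by (simp add: W_def)
    show "kop P \<phi> x - kop P \<phi> y \<le> \<alpha> * r * (2 + \<beta> * (enn2real (V x) + enn2real (V y)))"
    proof (cases "R \<le> ?w")
      case True
      have "kop P \<phi> x - kop P \<phi> y \<le> r * (1 + \<beta> * (g * W x + B)) + r * (1 + \<beta> * (g * W y + B))"
        using kop_le_drift [OF b(1) x r _ up] kop_le_drift [OF b(2) y r _ lo] kop [OF x(1)] kop [OF y(1)] \<beta>
        by (simp add: W_def)
      also have "\<dots> = r * (2 + \<beta> * (g * ?w + 2 * B))"
        by (simp add: algebra_simps)
      also have "\<dots> \<le> r * (\<alpha> * (2 + \<beta> * ?w))"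
        using large [OF True] r by (intro mult_left_mono)
      finally show ?thesis by (simp add: W_def mult_ac)
    next
      case False
      interpret N: prob_space \<nu> by (rule prob_algebraD [OF \<nu>])
      have "W x \<le> R" "W y \<le> R"
        using False enn2real_nonneg [of "V x"] enn2real_nonneg [of "V y"] unfolding W_def by linarith+
      then have VR: "V x \<le> ennreal R" "V y \<le> ennreal R"
        using x(2) y(2) R by (auto simp: W_def ennreal_le_iff2 elim!: less_top_ennreal [THEN iffD1, THEN exE])
      \<comment> \<open>Both points are minorized by the same \<nu>, so \<open>?e\<close> enters the
        two bounds with opposite signs and cancels, leaving the gain
        \<open>2 * \<epsilon> * r\<close>.\<close>
      let ?e = "(\<integral>z. \<phi> z \<partial>\<nu>) - c"
      have e: "(\<integral>z. \<phi> z - c \<partial>\<nu>) = ?e" "(\<integral>z. c - \<phi> z \<partial>\<nu>) = - ?e"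
        using bmeas_integrable [OF \<phi> \<nu>] by (simp_all add: N.prob_space)
      have "kop P \<phi> x - kop P \<phi> y
          \<le> r * (1 + \<beta> * (g * W x + B)) - \<epsilon> * (r - ?e) + (r * (1 + \<beta> * (g * W y + B)) - \<epsilon> * (r + ?e))"
        using kop_le_drift_minorized [OF b(1) x r _ up \<nu> \<epsilon>(1) minor [OF x(1) VR(1)]]
          kop_le_drift_minorized [OF b(2) y r _ lo \<nu> \<epsilon>(1) minor [OF y(1) VR(2)]]
          kop [OF x(1)] kop [OF y(1)] \<beta> e
        by (simp add: W_def algebra_simps)
      also have "\<dots> = r * (2 + \<beta> * (g * ?w + 2 * B) - 2 * \<epsilon>)"
        by (simp add: algebra_simps)
      also have "\<dots> \<le> r * (\<alpha> * (2 + \<beta> * ?w))"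
        using small [OF w0] r by (intro mult_left_mono)
      finally show ?thesis by (simp add: W_def mult_ac)
    qed
  qed
qed

text \<open>A bound by 1 gives the oscillation condition with \<open>r = 1\<close>, and each step
  multiplies \<open>r\<close> by \<alpha>. Finally \<open>V \<ge> 1\<close> and
  \<open>\<beta> \<le> 1\<close> turn \<open>2 + \<beta> * s\<close> into \<open>2 * s\<close>,
  which removes \<beta> from the conclusion.\<close>

lemma harris_iterate:
  assumes "0 < R" "2 * B < (1 - g) * R"
    and "\<nu> \<in> space (prob_algebra S)" and "0 < \<epsilon>" "\<epsilon> < 1"
    and "\<And>x A. x \<in> space S \<Longrightarrow> V x \<le> ennreal R \<Longrightarrow> A \<in> sets S \<Longrightarrow>
           \<epsilon> * measure \<nu> A \<le> measure (P x) A"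
  obtains \<alpha> where "0 < \<alpha>" "\<alpha> < 1"
    "\<And>\<phi> x y n. \<phi> \<in> borel_measurable S \<Longrightarrow> (\<And>z. z \<in> space S \<Longrightarrow> \<bar>\<phi> z\<bar> \<le> 1) \<Longrightarrow>
       x \<in> space S \<Longrightarrow> V x < \<infinity> \<Longrightarrow> y \<in> space S \<Longrightarrow> V y < \<infinity> \<Longrightarrow>
       (kop P ^^ n) \<phi> x - (kop P ^^ n) \<phi> y \<le> 2 * \<alpha> ^ n * (enn2real (V x) + enn2real (V y))"
proof -
  obtain \<alpha> \<beta> where \<alpha>: "0 < \<alpha>" "\<alpha> < 1" and \<beta>: "0 < \<beta>" "\<beta> \<le> 1"
    and step: "\<And>r \<phi> x y. 0 \<le> r \<Longrightarrow> bmeas S \<phi> \<Longrightarrow>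
       (\<And>x y. x \<in> space S \<Longrightarrow> V x < \<infinity> \<Longrightarrow> y \<in> space S \<Longrightarrow> V y < \<infinity> \<Longrightarrow>
          \<phi> x - \<phi> y \<le> r * (2 + \<beta> * (enn2real (V x) + enn2real (V y)))) \<Longrightarrow>
       x \<in> space S \<Longrightarrow> V x < \<infinity> \<Longrightarrow> y \<in> space S \<Longrightarrow> V y < \<infinity> \<Longrightarrow>
       kop P \<phi> x - kop P \<phi> y \<le> \<alpha> * r * (2 + \<beta> * (enn2real (V x) + enn2real (V y)))"
    using harris_step [OF assms] by blast
  show ?thesis
  proof (rule that [OF \<alpha>])
    fix \<phi> :: "'a \<Rightarrow> real" and x y n
    assume \<phi>: "\<phi> \<in> borel_measurable S" "\<And>z. z \<in> space S \<Longrightarrow> \<bar>\<phi> z\<bar> \<le> 1"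
      and xy: "x \<in> space S" "V x < \<infinity>" "y \<in> space S" "V y < \<infinity>"
    have "(kop P ^^ n) \<phi> x - (kop P ^^ n) \<phi> y \<le> \<alpha> ^ n * (2 + \<beta> * (enn2real (V x) + enn2real (V y)))"
      using xy
    proof (induction n arbitrary: x y)
      case 0
      have "\<phi> x - \<phi> y \<le> 2"
        using \<phi>(2) [OF 0(1)] \<phi>(2) [OF 0(3)] by linarith
      also have "\<dots> \<le> 2 + \<beta> * (enn2real (V x) + enn2real (V y))"
        using \<beta> by simp
      finally show ?case by simp
    next
      case (Suc n)
      have "bmeas S ((kop P ^^ n) \<phi>)"
        using \<phi> by (intro bmeas_kop_funpow bmeasI)
      then show ?case
        using step [of "\<alpha> ^ n" "(kop P ^^ n) \<phi>" x y] Suc \<alpha> by simp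
    qed
    also have "\<dots> \<le> \<alpha> ^ n * (2 * (enn2real (V x) + enn2real (V y)))"
    proof (intro mult_left_mono)
      have W: "1 \<le> enn2real (V z)" if "z \<in> space S" "V z < \<infinity>" for z
        using enn2real_mono [OF V_ge_1 [OF that(1)]] that(2) by simp
      define s where "s = enn2real (V x) + enn2real (V y)"
      have "2 \<le> s"
        using W [OF xy(1,2)] W [OF xy(3,4)] by (simp add: s_def)
      moreover from this have "\<beta> * s \<le> 1 * s"
        using \<beta> by (intro mult_right_mono) auto
      ultimately show "2 + \<beta> * (enn2real (V x) + enn2real (V y)) \<le> 2 * (enn2real (V x) + enn2real (V y))"
        unfolding s_def [symmetric] by linarith
    qed (use \<alpha> in auto)
    finally show "(kop P ^^ n) \<phi> x - (kop P ^^ n) \<phi> y \<le> 2 * \<alpha> ^ n * (enn2real (V x) + enn2real (V y))"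
      by (simp add: algebra_simps)
  qed
qed

end

end

subsection \<open>Conditional expectations along trajectories\<close>

text \<open>The conditional expectation given the coordinates before time \<open>k\<close>, for \<open>f\<close> depending on those before \<open>k + d\<close>.\<close>

primrec cexp :: "('a \<Rightarrow> 'a measure) \<Rightarrow> 'a measure \<Rightarrow> nat \<Rightarrow> nat \<Rightarrow> ((nat \<Rightarrow> 'a) \<Rightarrow> real) \<Rightarrow> (nat \<Rightarrow> 'a) \<Rightarrow> real"
where
  "cexp P \<mu> k 0 f w = f w"
| "cexp P \<mu> k (Suc d) f w = (\<integral>y. cexp P \<mu> (Suc k) d f (w(k := y)) \<partial>chain_step P \<mu> k w)"

lemma cexp_0 [simp]: "cexp P \<mu> k 0 f = f"
  by (simp add: fun_eq_iff)

definition depends_on :: "'a measure \<Rightarrow> nat set \<Rightarrow> ((nat \<Rightarrow> 'a) \<Rightarrow> 'b) \<Rightarrow> bool" where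
  "depends_on S I f \<longleftrightarrow>
     (\<forall>w\<in>space (PiM UNIV (\<lambda>_. S)). \<forall>w'\<in>space (PiM UNIV (\<lambda>_. S)).
        (\<forall>i\<in>I. w i = w' i) \<longrightarrow> f w = f w')"

lemma depends_onI:
  "(\<And>w w'. w \<in> space (PiM UNIV (\<lambda>_. S)) \<Longrightarrow> w' \<in> space (PiM UNIV (\<lambda>_. S)) \<Longrightarrow>
     (\<And>i. i \<in> I \<Longrightarrow> w i = w' i) \<Longrightarrow> f w = f w') \<Longrightarrow> depends_on S I f"
  unfolding depends_on_def by blast

lemma depends_onD:
  "depends_on S I f \<Longrightarrow> w \<in> space (PiM UNIV (\<lambda>_. S)) \<Longrightarrow> w' \<in> space (PiM UNIV (\<lambda>_. S)) \<Longrightarrow>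
     (\<And>i. i \<in> I \<Longrightarrow> w i = w' i) \<Longrightarrow> f w = f w'"
  unfolding depends_on_def by blast

lemma depends_on_mono: "depends_on S I f \<Longrightarrow> I \<subseteq> J \<Longrightarrow> depends_on S J f"
  unfolding depends_on_def by blast

locale chain = kernel S P for S :: "'a measure" and P +
  fixes \<mu> :: "'a measure"
  assumes initial: "\<mu> \<in> space (prob_algebra S)"
begin

abbreviation path_space :: "(nat \<Rightarrow> 'a) measure" where
  "path_space \<equiv> PiM UNIV (\<lambda>_. S)"

abbreviation law :: "(nat \<Rightarrow> 'a) measure" where
  "law \<equiv> markov_law S P \<mu>"

lemma markov_kernel: "markov_kernel S P"
  using kernel by (simp add: markov_kernel_def)

lemma path_space_iff: "w \<in> space path_space \<longleftrightarrow> (\<forall>i. w i \<in> space S)"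
  by (auto simp: space_PiM)

lemma fun_upd_path_space:
  "w \<in> space path_space \<Longrightarrow> y \<in> space S \<Longrightarrow> w(k := y) \<in> space path_space"
  by (simp add: path_space_iff)

lemma law_space: "law \<in> space (prob_algebra path_space)"
  using prob_space_markov_law [OF markov_kernel initial] sets_markov_law [OF markov_kernel initial]
  by (simp add: space_prob_algebra)

lemma chain_step_measurable: "chain_step P \<mu> k \<in> path_space \<rightarrow>\<^sub>M prob_algebra S"
proof (cases k)
  case 0
  then have "chain_step P \<mu> k = (\<lambda>_. \<mu>)"
    by (simp add: chain_step_def fun_eq_iff)
  then show ?thesis
    using initial by simp
next
  case (Suc j)
  then have "chain_step P \<mu> k = (\<lambda>w. P (w j))"
    by (simp add: chain_step_def fun_eq_iff)
  then show ?thesis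
    by simp
qed

lemma chain_step_space: "w \<in> space path_space \<Longrightarrow> chain_step P \<mu> k w \<in> space (prob_algebra S)"
  using chain_step_measurable by (rule measurable_space)

lemma chain_step_cong: "(\<And>i. Suc i = k \<Longrightarrow> w i = w' i) \<Longrightarrow> chain_step P \<mu> k w = chain_step P \<mu> k w'"
  by (auto simp: chain_step_def split: nat.split)

lemma fun_upd_measurable: "(\<lambda>(w, y). w(k := y)) \<in> path_space \<Otimes>\<^sub>M S \<rightarrow>\<^sub>M path_space"
  unfolding case_prod_beta
  by (rule measurable_fun_upd [where J = UNIV]) auto

lemma bmeas_fun_upd:
  assumes "bmeas path_space f" "w \<in> space path_space"
  shows "bmeas S (\<lambda>y. f (w(k := y)))"
proof -
  obtain b where "\<And>w. w \<in> space path_space \<Longrightarrow> \<bar>f w\<bar> \<le> b"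
    using assms by (metis bmeas_bounded)
  moreover have "(\<lambda>y. w(k := y)) \<in> S \<rightarrow>\<^sub>M path_space"
    using measurable_compose [OF measurable_Pair1' [OF assms(2)] fun_upd_measurable [of k]] by simp
  ultimately show ?thesis
    using assms by (intro bmeasI [where b = b] measurable_compose [of _ S path_space f])
      (auto simp: bmeas_def fun_upd_path_space)
qed

lemma cexp_bound_measurable:
  assumes "f \<in> borel_measurable path_space" "\<And>w. w \<in> space path_space \<Longrightarrow> \<bar>f w\<bar> \<le> b"
  shows "cexp P \<mu> k d f \<in> borel_measurable path_space \<and>
    (\<forall>w\<in>space path_space. \<bar>cexp P \<mu> k d f w\<bar> \<le> b)"
proof (induction d arbitrary: k)
  case 0
  then show ?case
    using assms by simp
next
  case (Suc d)
  define h where "h = cexp P \<mu> (Suc k) d f"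
  have h: "bmeas path_space h" "\<And>w. w \<in> space path_space \<Longrightarrow> \<bar>h w\<bar> \<le> b"
    using Suc [of "Suc k"] by (auto simp: h_def intro!: bmeasI)
  have eq: "cexp P \<mu> k (Suc d) f = (\<lambda>w. \<integral>y. h (w(k := y)) \<partial>chain_step P \<mu> k w)"
    by (simp add: fun_eq_iff h_def)
  have "(\<lambda>w. \<integral>y. h (w(k := y)) \<partial>chain_step P \<mu> k w) \<in> borel_measurable path_space"
    using measurable_compose [OF fun_upd_measurable bmeas_measurable [OF h(1)]] chain_step_measurable
    by (intro integral_measurable_subprob_algebra2 [where N = S])
       (auto simp: case_prod_beta intro: measurable_prob_algebraD)
  moreover have "\<bar>\<integral>y. h (w(k := y)) \<partial>chain_step P \<mu> k w\<bar> \<le> b" if "w \<in> space path_space" for w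
    using bmeas_fun_upd [OF h(1) that] chain_step_space [OF that] h(2) fun_upd_path_space [OF that]
    by (intro integral_abs_le [where M = S]) (auto simp: bmeas_def)
  ultimately show ?case
    unfolding eq by blast
qed

lemma bmeas_cexp: "bmeas path_space f \<Longrightarrow> bmeas path_space (cexp P \<mu> k d f)"
  using cexp_bound_measurable unfolding bmeas_def by metis

lemma cexp_abs_le:
  assumes "bmeas path_space f" "\<And>w. w \<in> space path_space \<Longrightarrow> \<bar>f w\<bar> \<le> b" "w \<in> space path_space"
  shows "\<bar>cexp P \<mu> k d f w\<bar> \<le> b"
  using cexp_bound_measurable [of f b] assms by (auto simp: bmeas_def)

lemma cexp_step_integrable:
  assumes "bmeas path_space f" "w \<in> space path_space"
  shows "integrable (chain_step P \<mu> k w) (\<lambda>y. cexp P \<mu> j d f (w(k := y)))"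
  by (intro bmeas_integrable [OF bmeas_fun_upd chain_step_space] bmeas_cexp assms)

text \<open>Only coordinates from \<open>k\<close> on are overwritten, so the past of
  \<open>w\<close> may be treated as a fixed parameter of the function.\<close>

lemma cexp_cong:
  assumes "\<And>w'. w' \<in> space path_space \<Longrightarrow> (\<And>i. i < k \<Longrightarrow> w' i = w i) \<Longrightarrow> f w' = g w'"
    and "w \<in> space path_space"
  shows "cexp P \<mu> k d f w = cexp P \<mu> k d g w"
  using assms
proof (induction d arbitrary: k w)
  case (Suc d)
  have "cexp P \<mu> (Suc k) d f (w(k := y)) = cexp P \<mu> (Suc k) d g (w(k := y))" if "y \<in> space S" for y
  proof (rule Suc.IH)
    show "w(k := y) \<in> space path_space"
      by (intro fun_upd_path_space Suc.prems that)
    fix w' assume "w' \<in> space path_space" "\<And>i. i < Suc k \<Longrightarrow> w' i = (w(k := y)) i"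
    then show "f w' = g w'"
      by (intro Suc.prems(1)) (metis fun_upd_other less_SucI nat_neq_iff)+
  qed
  then show ?case
    unfolding cexp.simps using prob_algebraD(3) [OF chain_step_space [OF Suc.prems(2)]]
    by (intro Bochner_Integration.integral_cong) auto
qed simp

lemma cexp_diff:
  assumes "bmeas path_space f" "bmeas path_space g" "w \<in> space path_space"
  shows "cexp P \<mu> k d (\<lambda>w. f w - g w) w = cexp P \<mu> k d f w - cexp P \<mu> k d g w"
  using assms(3)
proof (induction d arbitrary: k w)
  case (Suc d)
  have IH: "cexp P \<mu> (Suc k) d (\<lambda>w. f w - g w) (w(k := y))
      = cexp P \<mu> (Suc k) d f (w(k := y)) - cexp P \<mu> (Suc k) d g (w(k := y))" if "y \<in> space S" for y
    by (intro Suc.IH fun_upd_path_space Suc.prems that)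
  have "cexp P \<mu> k (Suc d) (\<lambda>w. f w - g w) w =
      (\<integral>y. cexp P \<mu> (Suc k) d f (w(k := y)) - cexp P \<mu> (Suc k) d g (w(k := y)) \<partial>chain_step P \<mu> k w)"
    unfolding cexp.simps using prob_algebraD(3) [OF chain_step_space [OF Suc.prems]] IH
    by (intro Bochner_Integration.integral_cong) auto
  then show ?case
    using cexp_step_integrable [OF assms(1) Suc.prems] cexp_step_integrable [OF assms(2) Suc.prems]
    by simp
qed simp

lemma cexp_const: "w \<in> space path_space \<Longrightarrow> cexp P \<mu> k d (\<lambda>_. c) w = c"
proof (induction d arbitrary: k w)
  case (Suc d)
  interpret prob_space "chain_step P \<mu> k w"
    by (rule prob_algebraD [OF chain_step_space [OF Suc.prems]])
  have IH: "cexp P \<mu> (Suc k) d (\<lambda>_. c) (w(k := y)) = c" if "y \<in> space S" for y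
    by (intro Suc.IH fun_upd_path_space Suc.prems that)
  have "cexp P \<mu> k (Suc d) (\<lambda>_. c) w = (\<integral>y. c \<partial>chain_step P \<mu> k w)"
    unfolding cexp.simps using prob_algebraD(3) [OF chain_step_space [OF Suc.prems]] IH
    by (intro Bochner_Integration.integral_cong) auto
  then show ?case
    by (simp add: prob_space)
qed simp

lemma cexp_add: "cexp P \<mu> k (d + e) f w = cexp P \<mu> k d (cexp P \<mu> (k + d) e f) w"
  by (induction d arbitrary: k w) auto

text \<open>The Markov property: once the block from \<open>k\<close> to \<open>k + d - 1\<close> is
  integrated out, the kernel brings in coordinate \<open>k - 1\<close>, or nothing if
  \<open>k = 0\<close>, where the step is the initial law. A general \<open>J\<close> allows a gap
  between past and future coordinates, as freezing produces it.\<close>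

lemma depends_on_cexp:
  "depends_on S (J \<union> {k..<k+d}) f \<Longrightarrow> depends_on S (J \<union> {i. Suc i = k}) (cexp P \<mu> k d f)"
proof (induction d arbitrary: J k)
  case 0
  have "depends_on S (J \<union> {i. Suc i = k}) f"
    by (rule depends_on_mono [OF 0]) auto
  then show ?case
    by simp
next
  case (Suc d)
  have "J \<union> {k..<k + Suc d} = insert k J \<union> {Suc k..<Suc k + d}"
    by auto
  with Suc.prems have "depends_on S (insert k J \<union> {i. Suc i = Suc k}) (cexp P \<mu> (Suc k) d f)"
    by (intro Suc.IH) simp
  then have IH: "depends_on S (insert k J) (cexp P \<mu> (Suc k) d f)"
    by (rule depends_on_mono) auto
  show ?case
  proof (rule depends_onI)
    fix w w'
    assume *: "w \<in> space path_space" "w' \<in> space path_space"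
      and eq: "\<And>i. i \<in> J \<union> {i. Suc i = k} \<Longrightarrow> w i = w' i"
    have "chain_step P \<mu> k w = chain_step P \<mu> k w'"
      using eq by (intro chain_step_cong) auto
    moreover have "cexp P \<mu> (Suc k) d f (w(k := y)) = cexp P \<mu> (Suc k) d f (w'(k := y))"
      if "y \<in> space S" for y
      by (rule depends_onD [OF IH fun_upd_path_space fun_upd_path_space]) (use * eq that in auto)
    ultimately show "cexp P \<mu> k (Suc d) f w = cexp P \<mu> k (Suc d) f w'"
      unfolding cexp.simps using prob_algebraD(3) [OF chain_step_space [OF *(2)]]
      by (intro Bochner_Integration.integral_cong) auto
  qed
qed

text \<open>At index \<open>Suc k\<close> the last known coordinate is \<open>k\<close>, so
  coordinate \<open>k + d\<close> lies exactly \<open>d\<close> kernel steps ahead.\<close>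

lemma cexp_coordinate:
  assumes "bmeas S \<phi>" "w \<in> space path_space"
  shows "cexp P \<mu> (Suc k) d (\<lambda>w. \<phi> (w (k + d))) w = (kop P ^^ d) \<phi> (w k)"
  using assms(2)
proof (induction d arbitrary: k w)
  case (Suc d)
  have "cexp P \<mu> (Suc (Suc k)) d (\<lambda>w. \<phi> (w (k + Suc d))) (w(Suc k := y)) = (kop P ^^ d) \<phi> y"
    if "y \<in> space S" for y
    using Suc.IH [of "w(Suc k := y)" "Suc k"] fun_upd_path_space [OF Suc.prems that, of "Suc k"]
    by (simp add: fun_upd_same del: fun_upd_apply)
  then have "cexp P \<mu> (Suc k) (Suc d) (\<lambda>w. \<phi> (w (k + Suc d))) w
      = (\<integral>y. (kop P ^^ d) \<phi> y \<partial>chain_step P \<mu> (Suc k) w)"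
    unfolding cexp.simps using prob_algebraD(3) [OF chain_step_space [OF Suc.prems]]
    by (intro Bochner_Integration.integral_cong) auto
  then show ?case
    by (simp add: chain_step_def kop_def [of P "(kop P ^^ d) \<phi>"])
qed simp

text \<open>Links the trajectory measure with the iterated integrals: the law of the first
  \<open>Suc k\<close> coordinates is that of the first \<open>k\<close>, extended by one
  step.\<close>

lemma integral_law_step:
  assumes f: "bmeas path_space f" and dep: "depends_on S {..<Suc k} f"
  shows "(\<integral>w. f w \<partial>law) = (\<integral>w. cexp P \<mu> k 1 f w \<partial>law)"
proof -
  interpret IT: Ionescu_Tulcea "chain_step P \<mu>" "\<lambda>_. S"
    by (rule Ionescu_Tulcea_chain_step [OF markov_kernel initial])
  obtain z where z: "z \<in> space S"
    using prob_space.not_empty [OF prob_algebraD(1) [OF initial]] prob_algebraD [OF initial] by blast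
  \<comment> \<open>The finite-dimensional laws live on functions that are \<open>undefined\<close>
    from \<open>j\<close> on; padding with a point of \<open>S\<close> makes them
    trajectories.\<close>
  define ext :: "nat \<Rightarrow> (nat \<Rightarrow> 'a) \<Rightarrow> (nat \<Rightarrow> 'a)" where "ext j w = (\<lambda>i. if i < j then w i else z)" for j w
  have ext [measurable]: "ext j \<in> PiM {0..<j} (\<lambda>_. S) \<rightarrow>\<^sub>M path_space" for j
  proof (rule measurable_PiM_single')
    show "(\<lambda>w. ext j w i) \<in> PiM {0..<j} (\<lambda>_. S) \<rightarrow>\<^sub>M S" for i
      using z by (cases "i < j") (auto simp: ext_def)
  qed (use z in \<open>auto simp: ext_def space_PiM\<close>)
  have restr [measurable]: "(\<lambda>w. restrict w {0..<j}) \<in> law \<rightarrow>\<^sub>M PiM {0..<j} (\<lambda>_. S)" for j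
    using prob_algebraD(2) [OF law_space] by (auto intro!: measurable_restrict cong: measurable_cong_sets)
  have fold: "(\<integral>w. h w \<partial>law) = (\<integral>w. h (ext j w) \<partial>IT.C 0 j (\<lambda>_. undefined))"
    if h: "bmeas path_space h" and "depends_on S {..<j} h" for h j
  proof -
    have "(\<integral>w. h w \<partial>law) = (\<integral>w. h (ext j (restrict w {0..<j})) \<partial>law)"
      using prob_algebraD(3) [OF law_space] z
      by (intro Bochner_Integration.integral_cong depends_onD [OF that(2)])
         (auto simp: ext_def space_PiM)
    also have "\<dots> = (\<integral>w. h (ext j w) \<partial>distr law (PiM {0..<j} (\<lambda>_. S)) (\<lambda>w. restrict w {0..<j}))"
      using measurable_compose [OF ext bmeas_measurable [OF h]]
      by (intro integral_distr [symmetric] restr)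
    finally show ?thesis
      unfolding markov_law_restrict [OF markov_kernel initial] .
  qed
  have C: "IT.C 0 k (\<lambda>_. undefined) \<in> space (prob_algebra (PiM {0..<k} (\<lambda>_. S)))"
    using IT.prob_space_C [of "\<lambda>_. undefined" 0 k] IT.sets_C [of "\<lambda>_. undefined" 0 k]
    by (auto simp: space_prob_algebra space_PiM)
  have eP: "IT.eP k \<in> PiM {0..<k} (\<lambda>_. S) \<rightarrow>\<^sub>M prob_algebra (PiM {0..<Suc k} (\<lambda>_. S))"
    by (intro measurable_prob_algebraI IT.prob_space_eP IT.measurable_eP)
  have fext: "bmeas (PiM {0..<Suc k} (\<lambda>_. S)) (\<lambda>w. f (ext (Suc k) w))"
  proof -
    obtain b where "\<And>w. w \<in> space path_space \<Longrightarrow> \<bar>f w\<bar> \<le> b"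
      using f by (metis bmeas_bounded)
    then show ?thesis
      using measurable_space [OF ext] measurable_compose [OF ext bmeas_measurable [OF f]]
      by (intro bmeasI [where b = b]) auto
  qed
  have "(\<integral>w. f w \<partial>law) = (\<integral>w. \<integral>w'. f (ext (Suc k) w') \<partial>IT.eP k w \<partial>IT.C 0 k (\<lambda>_. undefined))"
    using integral_bind_bmeas [OF C eP fext] fold [OF f dep] by simp
  also have "\<dots> = (\<integral>w. cexp P \<mu> k 1 f (ext k w) \<partial>IT.C 0 k (\<lambda>_. undefined))"
  proof (rule Bochner_Integration.integral_cong)
    fix w assume "w \<in> space (IT.C 0 k (\<lambda>_. undefined))"
    then have w: "w \<in> space (PiM {0..<k} (\<lambda>_. S))"
      using prob_algebraD(3) [OF C] by simp
    then have ext': "ext k w \<in> space path_space"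
      using ext by (rule measurable_space [rotated])
    have step: "chain_step P \<mu> k w = chain_step P \<mu> k (ext k w)"
      by (rule chain_step_cong) (auto simp: ext_def)
    note sp = prob_algebraD [OF chain_step_space [OF ext', of k]]
    have "(\<integral>w'. f (ext (Suc k) w') \<partial>IT.eP k w)
        = (\<integral>y. f (ext (Suc k) (w(k := y))) \<partial>chain_step P \<mu> k w)"
      unfolding IT.eP_def
    proof (rule integral_distr)
      have "fun_upd w k \<in> S \<rightarrow>\<^sub>M PiM {0..<Suc k} (\<lambda>_. S)"
        using w by (intro measurable_fun_upd [where J = "{0..<k}"]) auto
      then show "fun_upd w k \<in> chain_step P \<mu> k w \<rightarrow>\<^sub>M PiM {0..<Suc k} (\<lambda>_. S)"
        using sp step by (auto cong: measurable_cong_sets)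
    qed (use fext in \<open>simp add: bmeas_def\<close>)
    also have "\<dots> = (\<integral>y. f ((ext k w)(k := y)) \<partial>chain_step P \<mu> k w)"
    proof -
      have "ext (Suc k) (w(k := y)) = (ext k w)(k := y)" for y
        by (auto simp: ext_def fun_eq_iff)
      then show ?thesis by simp
    qed
    finally show "(\<integral>w'. f (ext (Suc k) w') \<partial>IT.eP k w) = cexp P \<mu> k 1 f (ext k w)"
      by (simp add: step)
  qed simp
  also have "\<dots> = (\<integral>w. cexp P \<mu> k 1 f w \<partial>law)"
  proof (rule fold [symmetric])
    have "depends_on S ({..<k} \<union> {k..<k+1}) f"
      using dep by (rule depends_on_mono) auto
    then have "depends_on S ({..<k} \<union> {i. Suc i = k}) (cexp P \<mu> k 1 f)"
      by (rule depends_on_cexp)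
    then show "depends_on S {..<k} (cexp P \<mu> k 1 f)"
      by (rule depends_on_mono) auto
  qed (rule bmeas_cexp [OF f])
  finally show ?thesis .
qed

text \<open>Coordinates are integrated out from the last to the first. What remains depends on no
  coordinate, hence equals its own integral.\<close>

lemma integral_law:
  assumes f: "bmeas path_space f" and dep: "depends_on S {..<n} f" and w: "w \<in> space path_space"
  shows "(\<integral>w. f w \<partial>law) = cexp P \<mu> 0 n f w"
proof -
  have *: "(\<integral>w. f w \<partial>law) = (\<integral>w. cexp P \<mu> (n - d) d f w \<partial>law)" if "d \<le> n" for d
    using that
  proof (induction d)
    case (Suc d)
    define k where "k = n - Suc d"
    have k: "n - d = Suc k" "n = k + Suc d"
      using Suc.prems by (auto simp: k_def)
    have "depends_on S ({..k} \<union> {Suc k..<Suc k + d}) f"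
      using dep by (rule depends_on_mono) (auto simp: k(2))
    then have "depends_on S ({..k} \<union> {i. Suc i = Suc k}) (cexp P \<mu> (Suc k) d f)"
      by (rule depends_on_cexp)
    then have "depends_on S {..<Suc k} (cexp P \<mu> (Suc k) d f)"
      by (rule depends_on_mono) auto
    then have "(\<integral>w. cexp P \<mu> (Suc k) d f w \<partial>law) = (\<integral>w. cexp P \<mu> k 1 (cexp P \<mu> (Suc k) d f) w \<partial>law)"
      by (intro integral_law_step bmeas_cexp f)
    moreover have "cexp P \<mu> k 1 (cexp P \<mu> (Suc k) d f) = cexp P \<mu> k (Suc d) f"
      by (simp add: fun_eq_iff)
    moreover have "(\<integral>w. f w \<partial>law) = (\<integral>w. cexp P \<mu> (Suc k) d f w \<partial>law)"
      using Suc.IH Suc.prems unfolding k(1) by simp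
    ultimately show ?case
      unfolding k_def [symmetric] by simp
  qed simp
  have "depends_on S ({} \<union> {i. Suc i = 0}) (cexp P \<mu> 0 n f)"
    by (rule depends_on_cexp, rule depends_on_mono [OF dep]) auto
  then have "cexp P \<mu> 0 n f w' = cexp P \<mu> 0 n f w" if "w' \<in> space path_space" for w'
    using that w by (auto intro: depends_onD)
  then have "(\<integral>w. cexp P \<mu> 0 n f w \<partial>law) = (\<integral>w'. cexp P \<mu> 0 n f w \<partial>law)"
    using prob_algebraD [OF law_space] by (intro Bochner_Integration.integral_cong) auto
  also have "\<dots> = cexp P \<mu> 0 n f w"
    using prob_space.prob_space [OF prob_algebraD(1) [OF law_space]] by simp
  finally show ?thesis
    using * [of n] by simp
qed

end

subsection \<open>Geometric drift towards a small set\<close>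

text \<open>\<open>hit_bound \<kappa> C n w = \<kappa> ^ min n (\<tau>\<^sub>C w)\<close>, written so that it depends on the first coordinates only.\<close>

definition hit_bound :: "real \<Rightarrow> 'a set \<Rightarrow> nat \<Rightarrow> (nat \<Rightarrow> 'a) \<Rightarrow> real" where
  "hit_bound \<kappa> C n w = (\<Prod>j<n. if \<forall>i\<in>{1..j}. w i \<notin> C then \<kappa> else 1)"

lemma lessThan_Int_eq: "{..<m} \<inter> {..<n} = {..<min m n}" for m n :: "'a::linorder"
  by auto

text \<open>The factor with index \<open>j\<close> is \<kappa> exactly when the return time exceeds
  \<open>j\<close>; for \<open>j = 0\<close> the condition is vacuous, as return times start at
  1.\<close>

lemma hit_bound_le_power_enat:
  assumes "1 \<le> \<kappa>"
  shows "ennreal (hit_bound \<kappa> C n w) \<le> power_enat \<kappa> (return_time C w)"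
proof (cases "\<exists>t\<ge>1. w t \<in> C")
  case False
  then have "{enat n | n. n \<ge> 1 \<and> w n \<in> C} = {}"
    by auto
  then show ?thesis
    by (simp only: return_time_def power_enat_def) (simp add: top_enat_def)
next
  case True
  define t where "t = (LEAST t. t \<ge> 1 \<and> w t \<in> C)"
  have t: "t \<ge> 1" "w t \<in> C"
    using LeastI_ex [of "\<lambda>t. t \<ge> 1 \<and> w t \<in> C"] True by (auto simp: t_def)
  have "return_time C w = enat t"
    unfolding return_time_def
  proof (rule antisym)
    show "Inf {enat n | n. n \<ge> 1 \<and> w n \<in> C} \<le> enat t"
      using t by (intro Inf_lower) auto
    show "enat t \<le> Inf {enat n | n. n \<ge> 1 \<and> w n \<in> C}"
      by (intro Inf_greatest) (auto simp: t_def intro: Least_le)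
  qed
  moreover have "hit_bound \<kappa> C n w \<le> \<kappa> ^ t"
  proof -
    have "hit_bound \<kappa> C n w \<le> (\<Prod>j<n. if j < t then \<kappa> else 1)"
      unfolding hit_bound_def using assms t by (intro prod_mono) (auto simp: not_less)
    also have "\<dots> = (\<Prod>j\<in>{..<n} \<inter> {..<t}. \<kappa>)"
      by (subst prod.inter_restrict) auto
    also have "\<dots> = \<kappa> ^ min n t"
      by (simp add: lessThan_Int_eq)
    also have "\<dots> \<le> \<kappa> ^ t"
      using assms by (intro power_increasing) auto
    finally show ?thesis .
  qed
  ultimately show ?thesis
    by (simp add: power_enat_def ennreal_leI)
qed

context kernel
begin

context
  fixes \<kappa> :: real and C :: "'a set"
  assumes C: "C \<in> sets S" and \<kappa>: "1 < \<kappa>"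
begin

text \<open>The mean of \<open>\<kappa> ^ min n \<sigma>\<close> from \<open>x\<close>, with
  \<sigma> the hitting time of \<open>C\<close>, time 0 included, expressed by first-step
  analysis.\<close>

primrec hit_moment :: "nat \<Rightarrow> 'a \<Rightarrow> real" where
  "hit_moment 0 x = 1"
| "hit_moment (Suc n) x = (if x \<in> C then 1 else \<kappa> * kop P (hit_moment n) x)"

lemma bmeas_hit_moment: "bmeas S (hit_moment n)"
proof (induction n)
  case 0
  have "hit_moment 0 = (\<lambda>_. 1)" by (simp add: fun_eq_iff)
  then show ?case by (simp add: bmeas_const)
next
  case (Suc n)
  have "hit_moment (Suc n) = (\<lambda>x. if x \<in> C then 1 else \<kappa> * kop P (hit_moment n) x)"
    by (simp add: fun_eq_iff)
  then show ?case
    using C Suc by (simp add: bmeas_If bmeas_mult bmeas_const bmeas_kop)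
qed

lemma hit_moment_ge_1: "x \<in> space S \<Longrightarrow> 1 \<le> hit_moment n x"
proof (induction n arbitrary: x)
  case (Suc n)
  have "1 \<le> kop P (hit_moment n) x"
    using kop_mono [OF bmeas_const bmeas_hit_moment Suc.IH] Suc.prems kop_const by fastforce
  then have "1 * 1 \<le> \<kappa> * kop P (hit_moment n) x"
    using \<kappa> by (intro mult_mono) auto
  then show ?case by simp
qed simp

lemma hit_moment_mono: "x \<in> space S \<Longrightarrow> hit_moment n x \<le> hit_moment (Suc n) x"
proof (induction n arbitrary: x)
  case 0
  then show ?case
    using hit_moment_ge_1 [OF 0, of 1] by simp
next
  case (Suc n)
  have "kop P (hit_moment n) x \<le> kop P (hit_moment (Suc n)) x"
    by (intro kop_mono bmeas_hit_moment Suc)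
  then show ?case
    using \<kappa> by (auto simp: mult_left_mono)
qed

text \<open>By monotone convergence the mean of \<open>\<kappa> ^ \<sigma>\<close>. Off
  \<open>C\<close> it may be infinite, since the moment assumption concerns starting points in
  \<open>C\<close>.\<close>

definition lyapunov :: "'a \<Rightarrow> ennreal" where
  "lyapunov x = (SUP n. ennreal (hit_moment n x))"

lemma lyapunov_measurable: "lyapunov \<in> borel_measurable S"
proof -
  note [measurable] = bmeas_measurable [OF bmeas_hit_moment]
  show ?thesis unfolding lyapunov_def by measurable
qed

lemma lyapunov_ge_1: "1 \<le> lyapunov x"
  unfolding lyapunov_def by (rule SUP_upper2 [of 0]) auto

lemma lyapunov_eq_1: "x \<in> C \<Longrightarrow> lyapunov x = 1"
proof -
  assume "x \<in> C"
  then have "hit_moment n x = 1" for n by (cases n) auto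
  then show ?thesis by (simp add: lyapunov_def)
qed

lemma nn_integral_lyapunov:
  assumes x: "x \<in> space S"
  shows "(\<integral>\<^sup>+y. lyapunov y \<partial>P x) = (SUP n. ennreal (kop P (hit_moment n) x))"
proof -
  note Px = prob_algebraD [OF kernel_space [OF x]]
  have "(\<integral>\<^sup>+y. lyapunov y \<partial>P x) = (SUP n. \<integral>\<^sup>+y. ennreal (hit_moment n y) \<partial>P x)"
    unfolding lyapunov_def
  proof (rule nn_integral_monotone_convergence_SUP_AE)
    show "AE y in P x. ennreal (hit_moment n y) \<le> ennreal (hit_moment (Suc n) y)" for n
      using Px hit_moment_mono by (intro AE_I2 ennreal_leI) auto
    show "(\<lambda>y. ennreal (hit_moment n y)) \<in> borel_measurable (P x)" for n
      using bmeas_measurable [OF bmeas_hit_moment [of n]] Px(2) by (auto cong: measurable_cong_sets)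
  qed
  also have "\<dots> = (SUP n. ennreal (kop P (hit_moment n) x))"
    unfolding kop_def using Px hit_moment_ge_1
    by (intro SUP_cong refl nn_integral_eq_integral AE_I2 bmeas_integrable [OF bmeas_hit_moment kernel_space] x)
       (auto intro: order_trans [OF zero_le_one])
  finally show ?thesis .
qed

text \<open>Away from \<open>C\<close> the recursion merely shifts the index by one, and the
  supremum absorbs the shift.\<close>

lemma lyapunov_drift:
  assumes x: "x \<in> space S" "x \<notin> C"
  shows "ennreal \<kappa> * (\<integral>\<^sup>+y. lyapunov y \<partial>P x) \<le> lyapunov x"
proof -
  have "ennreal \<kappa> * (\<integral>\<^sup>+y. lyapunov y \<partial>P x) = (SUP n. ennreal \<kappa> * ennreal (kop P (hit_moment n) x))"
    by (simp add: nn_integral_lyapunov x SUP_mult_left_ennreal)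
  also have "\<dots> = (SUP n. ennreal (hit_moment (Suc n) x))"
    using \<kappa> x by (simp add: ennreal_mult')
  also have "\<dots> \<le> lyapunov x"
    unfolding lyapunov_def by (rule SUP_mono) blast
  finally show ?thesis .
qed

end

end

context chain
begin

lemma bmeas_hit_bound:
  assumes "C \<in> sets S" "1 \<le> \<kappa>"
  shows "bmeas path_space (hit_bound \<kappa> C n)"
proof (rule bmeasI [where b = "\<kappa> ^ n"])
  note [measurable] = assms(1)
  show "hit_bound \<kappa> C n \<in> borel_measurable path_space"
    unfolding hit_bound_def by measurable
  have "0 \<le> hit_bound \<kappa> C n w" for w
    unfolding hit_bound_def using assms(2) by (intro prod_nonneg) auto
  moreover have "hit_bound \<kappa> C n w \<le> (\<Prod>j<n. \<kappa>)" for w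
    unfolding hit_bound_def using assms(2) by (intro prod_mono) auto
  ultimately show "\<bar>hit_bound \<kappa> C n w\<bar> \<le> \<kappa> ^ n" for w
    by simp
qed

lemma depends_on_hit_bound: "depends_on S {..<Suc n} (hit_bound \<kappa> C n)"
  by (rule depends_onI) (auto simp: hit_bound_def intro!: prod.cong)

text \<open>Without a visit before time \<open>k\<close> the product has collected
  \<open>\<kappa> ^ k\<close>; a visit at \<open>k\<close> stops it, otherwise it continues as the
  hitting moment from \<open>w k\<close>. Coordinate 0 may lie in \<open>C\<close>, as for the
  return time.\<close>

lemma cexp_hit_bound:
  assumes C: "C \<in> sets S" and \<kappa>: "1 < \<kappa>" and w: "w \<in> space path_space"
    and "1 \<le> k" and no_hit: "\<And>i. 1 \<le> i \<Longrightarrow> i < k \<Longrightarrow> w i \<notin> C"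
  shows "cexp P \<mu> (Suc k) d (hit_bound \<kappa> C (k + d)) w = \<kappa> ^ k * hit_moment \<kappa> C d (w k)"
  using w \<open>1 \<le> k\<close> no_hit
proof (induction d arbitrary: k w)
  case 0
  have "hit_bound \<kappa> C k w = (\<Prod>j<k. \<kappa>)"
    unfolding hit_bound_def using 0 by (intro prod.cong) auto
  then show ?case
    by (simp add: hit_moment.simps [OF C \<kappa>])
next
  case (Suc d)
  show ?case
  proof (cases "w k \<in> C")
    case True
    have hb: "hit_bound \<kappa> C (k + Suc d) w' = \<kappa> ^ k" if "\<And>i. i < Suc k \<Longrightarrow> w' i = w i" for w'
    proof -
      have "w' k \<in> C"
        using that [of k] True by simp
      then have "hit_bound \<kappa> C (k + Suc d) w' = (\<Prod>j<k + Suc d. if j < k then \<kappa> else 1)"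
        unfolding hit_bound_def using Suc.prems that True
        by (intro prod.cong) (auto simp: not_less dest: bspec [of _ _ k])
      also have "\<dots> = (\<Prod>j\<in>{..<k + Suc d} \<inter> {..<k}. \<kappa>)"
        by (subst prod.inter_restrict) auto
      finally show ?thesis
        by (simp add: lessThan_Int_eq)
    qed
    have "cexp P \<mu> (Suc k) (Suc d) (hit_bound \<kappa> C (k + Suc d)) w = cexp P \<mu> (Suc k) (Suc d) (\<lambda>_. \<kappa> ^ k) w"
      by (rule cexp_cong [OF hb Suc.prems(1)])
    then show ?thesis
      using True Suc.prems by (simp only: cexp_const hit_moment.simps [OF C \<kappa>]) simp
  next
    case False
    have IH: "cexp P \<mu> (Suc (Suc k)) d (hit_bound \<kappa> C (k + Suc d)) (w(Suc k := y))
        = \<kappa> ^ Suc k * hit_moment \<kappa> C d y" if "y \<in> space S" for y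
    proof -
      have "cexp P \<mu> (Suc (Suc k)) d (hit_bound \<kappa> C (Suc k + d)) (w(Suc k := y))
          = \<kappa> ^ Suc k * hit_moment \<kappa> C d ((w(Suc k := y)) (Suc k))"
      proof (rule Suc.IH)
        show "w(Suc k := y) \<in> space path_space"
          by (intro fun_upd_path_space Suc.prems that)
        show "(w(Suc k := y)) i \<notin> C" if "1 \<le> i" "i < Suc k" for i
          using Suc.prems(3) [of i] False that by (cases "i = k") auto
      qed simp
      then show ?thesis by (simp del: fun_upd_apply add: fun_upd_same)
    qed
    have "cexp P \<mu> (Suc k) (Suc d) (hit_bound \<kappa> C (k + Suc d)) w
        = (\<integral>y. \<kappa> ^ Suc k * hit_moment \<kappa> C d y \<partial>chain_step P \<mu> (Suc k) w)"
      unfolding cexp.simps using prob_algebraD(3) [OF chain_step_space [OF Suc.prems(1)]] IH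
      by (intro Bochner_Integration.integral_cong) auto
    also have "\<dots> = \<kappa> ^ k * (\<kappa> * kop P (hit_moment \<kappa> C d) (w k))"
      by (simp add: chain_step_def kop_def)
    finally show ?thesis
      using False by (simp add: hit_moment.simps [OF C \<kappa>])
  qed
qed

end

context kernel
begin

text \<open>From \<open>x\<close> the return time is one plus the hitting time from the next state,
  so its truncated moment is \<kappa> times the left-hand side. This turns the return time
  assumption into a drift bound on \<open>C\<close>.\<close>

lemma kop_hit_moment_le:
  assumes C: "C \<in> sets S" and \<kappa>: "1 < \<kappa>" and x: "x \<in> space S"
  shows "ennreal (kop P (hit_moment \<kappa> C n) x) \<le> (\<integral>\<^sup>+w. power_enat \<kappa> (return_time C w) \<partial>markov_law_from S P x)"
proof -
  interpret chain S P "return S x"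
    by unfold_locales (use x measurable_space [OF measurable_return_prob_space] in auto)
  have const: "(\<lambda>_. x) \<in> space path_space"
    using x by (simp add: path_space_iff)
  let ?h = "hit_bound \<kappa> C (Suc n)"
  have h: "bmeas path_space ?h"
    using C \<kappa> by (intro bmeas_hit_bound) auto
  have upd: "(\<lambda>_. x)(0 := x, Suc 0 := y) \<in> space path_space" if "y \<in> space S" for y
    by (intro fun_upd_path_space const x that)
  have IH: "cexp P (return S x) 2 n ?h ((\<lambda>_. x)(0 := x, Suc 0 := y)) = \<kappa> * hit_moment \<kappa> C n y"
    if "y \<in> space S" for y
    using cexp_hit_bound [OF C \<kappa> upd [OF that], of 1 n]
    by (simp add: numeral_2_eq_2 fun_upd_same del: fun_upd_apply)
  have "(\<integral>w. ?h w \<partial>law) = cexp P (return S x) 0 (Suc (Suc n)) ?h (\<lambda>_. x)"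
    by (intro integral_law h depends_on_hit_bound const)
  also have "\<dots> = cexp P (return S x) 1 (Suc n) ?h ((\<lambda>_. x)(0 := x))"
  proof -
    define g where "g = (\<lambda>y. cexp P (return S x) 1 (Suc n) ?h ((\<lambda>_. x)(0 := y)))"
    have "g \<in> borel_measurable S"
      unfolding g_def by (rule bmeas_measurable [OF bmeas_fun_upd [OF bmeas_cexp [OF h] const]])
    then have "(\<integral>y. g y \<partial>return S x) = g x"
      using x by (intro integral_return)
    moreover have "cexp P (return S x) 0 (Suc (Suc n)) ?h (\<lambda>_. x) = (\<integral>y. g y \<partial>return S x)"
      by (subst cexp.simps(2)) (simp only: g_def chain_step_def nat.case One_nat_def)
    ultimately show ?thesis
      by (simp only: g_def)
  qed
  also have "\<dots> = (\<integral>y. \<kappa> * hit_moment \<kappa> C n y \<partial>P x)"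
    unfolding cexp.simps One_nat_def
    using prob_algebraD(3) [OF kernel_space [OF x]] IH
    by (intro Bochner_Integration.integral_cong)
       (auto simp: chain_step_def numeral_2_eq_2 simp del: fun_upd_apply simp add: fun_upd_same)
  finally have eq: "(\<integral>w. ?h w \<partial>law) = \<kappa> * kop P (hit_moment \<kappa> C n) x"
    by (simp add: kop_def)
  have "0 \<le> kop P (hit_moment \<kappa> C n) x"
    using kop_mono [OF bmeas_const bmeas_hit_moment [OF C \<kappa>] hit_moment_ge_1 [OF C \<kappa>] x, of n] kop_const [OF x, of 1]
    by simp
  then have "kop P (hit_moment \<kappa> C n) x \<le> (\<integral>w. ?h w \<partial>law)"
    using \<kappa> mult_right_mono [of 1 \<kappa>] by (simp add: eq)
  then have "ennreal (kop P (hit_moment \<kappa> C n) x) \<le> ennreal (\<integral>w. ?h w \<partial>law)"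
    by (rule ennreal_leI)
  also have "\<dots> = (\<integral>\<^sup>+w. ennreal (?h w) \<partial>law)"
    using \<kappa> by (intro nn_integral_eq_integral [symmetric] bmeas_integrable [OF h law_space] AE_I2)
      (auto simp: hit_bound_def intro!: prod_nonneg)
  also have "\<dots> \<le> (\<integral>\<^sup>+w. power_enat \<kappa> (return_time C w) \<partial>law)"
    using \<kappa> by (intro nn_integral_mono hit_bound_le_power_enat) auto
  finally show ?thesis .
qed

end

subsection \<open>Geometric ergodicity\<close>

lemma minorization_integral:
  assumes N: "N \<in> space (prob_algebra M)" and \<nu>: "\<nu> \<in> space (prob_algebra M)" and \<epsilon>: "0 < \<epsilon>"
    and minor: "\<And>A. A \<in> sets M \<Longrightarrow> \<epsilon> * measure \<nu> A \<le> measure N A"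
    and f: "bmeas M f" "\<And>x. x \<in> space M \<Longrightarrow> 0 \<le> f x"
  shows "\<epsilon> * (\<integral>x. f x \<partial>\<nu>) \<le> (\<integral>x. f x \<partial>N)"
proof -
  note P = prob_algebraD [OF N] and Q = prob_algebraD [OF \<nu>]
  have "ennreal \<epsilon> * (\<integral>\<^sup>+x. f x \<partial>\<nu>) \<le> (\<integral>\<^sup>+x. f x \<partial>N)"
    using bmeas_measurable [OF f(1)] by (intro nn_integral_minorized [OF N \<nu> \<epsilon> minor]) auto
  moreover have "(\<integral>\<^sup>+x. f x \<partial>\<nu>) = ennreal (\<integral>x. f x \<partial>\<nu>)" "(\<integral>\<^sup>+x. f x \<partial>N) = ennreal (\<integral>x. f x \<partial>N)"
    using f(2) P(3) Q(3) by (intro nn_integral_eq_integral bmeas_integrable [OF f(1)] N \<nu> AE_I2; simp)+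
  ultimately have "ennreal (\<epsilon> * (\<integral>x. f x \<partial>\<nu>)) \<le> ennreal (\<integral>x. f x \<partial>N)"
    using \<epsilon> by (simp add: ennreal_mult')
  moreover have "0 \<le> (\<integral>x. f x \<partial>N)"
    using f(2) P(3) by (intro Bochner_Integration.integral_nonneg) simp
  ultimately show ?thesis
    by simp
qed

context kernel
begin

lemma kop_cong:
  assumes "\<And>x. x \<in> space S \<Longrightarrow> \<phi> x = \<psi> x" "x \<in> space S"
  shows "kop P \<phi> x = kop P \<psi> x"
  unfolding kop_def using assms prob_algebraD(3) [OF kernel_space [OF assms(2)]]
  by (intro Bochner_Integration.integral_cong) auto

lemma kop_funpow_mono:
  assumes "bmeas S \<phi>" "bmeas S \<psi>" "\<And>x. x \<in> space S \<Longrightarrow> \<phi> x \<le> \<psi> x" "x \<in> space S"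
  shows "(kop P ^^ n) \<phi> x \<le> (kop P ^^ n) \<psi> x"
  using assms(4)
proof (induction n arbitrary: x)
  case (Suc n)
  then show ?case
    by (auto intro!: kop_mono bmeas_kop_funpow assms)
qed (use assms in auto)

lemma kop_funpow_cmult: "(kop P ^^ n) (\<lambda>x. c * \<phi> x) x = c * (kop P ^^ n) \<phi> x"
proof (induction n arbitrary: x)
  case (Suc n)
  have "kop P (\<lambda>x. c * h x) x = c * kop P h x" for h
    by (simp add: kop_def)
  moreover have "(kop P ^^ n) (\<lambda>x. c * \<phi> x) = (\<lambda>x. c * (kop P ^^ n) \<phi> x)"
    using Suc by (simp add: fun_eq_iff)
  ultimately show ?case by simp
qed simp

lemma bind_kernel_power_stationary:
  assumes \<pi>: "\<pi> \<in> space (prob_algebra S)" "\<pi> \<bind> P = \<pi>"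
  shows "\<pi> \<bind> kernel_power S P n = \<pi>"
proof (induction n)
  case 0
  have "kernel_power S P 0 = return S"
    by (simp add: fun_eq_iff)
  then show ?case
    using prob_algebraD(2) [OF \<pi>(1)] by (simp add: bind_return'')
next
  case (Suc n)
  have "\<pi> \<bind> kernel_power S P (Suc n) = \<pi> \<bind> (\<lambda>x. kernel_power S P n x \<bind> P)"
    by (simp add: kernel_power.simps(2) [abs_def])
  also have "\<dots> = (\<pi> \<bind> kernel_power S P n) \<bind> P"
    using kernel_power_measurable [of n] prob_algebraD(2) [OF \<pi>(1)]
    by (intro bind_assoc [symmetric, where N = S and R = S])
       (auto cong: measurable_cong_sets intro: measurable_prob_algebraD)
  also have "\<dots> = \<pi>"
    by (simp add: Suc \<pi>)
  finally show ?case .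
qed

end

section \<open>Moments of the Lyapunov function under the iterates and the stationary law\<close>

locale drift_kernel = kernel S P for S :: "'a measure" and P +
  fixes V :: "'a \<Rightarrow> ennreal" and C :: "'a set" and \<kappa> B :: real
  assumes V [measurable]: "V \<in> borel_measurable S"
    and V_ge_1: "x \<in> space S \<Longrightarrow> 1 \<le> V x"
    and C [measurable]: "C \<in> sets S"
    and V_C: "x \<in> C \<Longrightarrow> V x = 1"
    and drift_off: "x \<in> space S \<Longrightarrow> x \<notin> C \<Longrightarrow> ennreal \<kappa> * (\<integral>\<^sup>+y. V y \<partial>P x) \<le> V x"
    and drift_on: "x \<in> C \<Longrightarrow> (\<integral>\<^sup>+y. V y \<partial>P x) \<le> ennreal B"
    and \<kappa>: "1 < \<kappa>" and B: "0 \<le> B"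
begin

definition "W x = enn2real (V x)"

definition "good = {x\<in>space S. V x < \<infinity>}"

text \<open>The fixed point of \<open>t \<mapsto> t / \<kappa> + B\<close>, hence one additive drift
  constant for all iterates of \<open>P\<close>.\<close>

definition "B' = B / (1 - 1 / \<kappa>)"

lemma C_space: "x \<in> C \<Longrightarrow> x \<in> space S"
  using C sets.sets_into_space by blast

lemma C_good: "x \<in> C \<Longrightarrow> x \<in> good"
  by (simp add: good_def C_space V_C)

lemma goodD: "x \<in> good \<Longrightarrow> x \<in> space S" "x \<in> good \<Longrightarrow> V x < \<infinity>"
  by (auto simp: good_def)

lemma W_ge_1: "x \<in> good \<Longrightarrow> 1 \<le> W x"
  using enn2real_mono [OF V_ge_1 [of x]] by (simp add: good_def W_def)

lemma V_eq_W: "x \<in> good \<Longrightarrow> V x = ennreal (W x)"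
  by (simp add: good_def W_def)

lemma W_C: "x \<in> C \<Longrightarrow> W x = 1"
  by (simp add: W_def V_C)

lemma W_nonneg: "0 \<le> W x"
  by (simp add: W_def)

lemma W_measurable [measurable]: "W \<in> borel_measurable S"
  unfolding W_def by measurable

lemma B'_nonneg: "0 \<le> B'" and B'_eq: "B' / \<kappa> + B = B'"
  using \<kappa> B by (auto simp: B'_def field_simps)

lemma ennreal_power_step: "ennreal (1 / \<kappa>) * (ennreal ((1 / \<kappa>) ^ n) * v) = ennreal ((1 / \<kappa>) ^ Suc n) * v"
proof -
  have "ennreal ((1 / \<kappa>) ^ Suc n) = ennreal (1 / \<kappa>) * ennreal ((1 / \<kappa>) ^ n)"
    unfolding power_Suc using \<kappa> by (intro ennreal_mult') simp
  then show ?thesis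
    by (simp only: mult.assoc)
qed

lemma ennreal_B'_step: "ennreal (1 / \<kappa>) * ennreal B' + ennreal B = ennreal B'"
proof -
  have "ennreal (1 / \<kappa>) * ennreal B' + ennreal B = ennreal (1 / \<kappa> * B' + B)"
  proof -
    have "0 \<le> 1 / \<kappa> * B'"
      using \<kappa> B'_nonneg by simp
    then show ?thesis
      using B B'_nonneg by (simp only: ennreal_plus ennreal_mult'')
  qed
  then show ?thesis
    using B'_eq by simp
qed

lemma drift_off': "x \<in> space S \<Longrightarrow> x \<notin> C \<Longrightarrow> (\<integral>\<^sup>+y. V y \<partial>P x) \<le> ennreal (1 / \<kappa>) * V x"
proof -
  assume x: "x \<in> space S" "x \<notin> C"
  have "(\<integral>\<^sup>+y. V y \<partial>P x) = ennreal (1 / \<kappa>) * (ennreal \<kappa> * (\<integral>\<^sup>+y. V y \<partial>P x))"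
    using \<kappa> by (simp add: mult.assoc [symmetric] ennreal_mult'' [symmetric])
  also have "\<dots> \<le> ennreal (1 / \<kappa>) * V x"
    using drift_off [OF x] by (rule mult_left_mono) simp
  finally show ?thesis .
qed

lemma drift: "x \<in> space S \<Longrightarrow> (\<integral>\<^sup>+y. V y \<partial>P x) \<le> ennreal (1 / \<kappa>) * V x + ennreal B"
  using drift_off' [of x] drift_on [of x] by (cases "x \<in> C") (auto intro: add_increasing add_increasing2)

lemma drift_iterate:
  assumes x: "x \<in> space S"
  shows "(\<integral>\<^sup>+y. V y \<partial>kernel_power S P n x) \<le> ennreal ((1 / \<kappa>) ^ n) * V x + ennreal B'"
proof (induction n)
  case 0
  then show ?case using x by (simp add: nn_integral_return)
next
  case (Suc n)
  note K = prob_algebraD [OF kernel_power_space [OF x], of n]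
  interpret K: prob_space "kernel_power S P n x" by (rule K)
  have [measurable_cong]: "sets (kernel_power S P n x) = sets S" by (rule K)
  have "(\<integral>\<^sup>+y. V y \<partial>kernel_power S P (Suc n) x) = (\<integral>\<^sup>+z. \<integral>\<^sup>+y. V y \<partial>P z \<partial>kernel_power S P n x)"
    unfolding kernel_power.simps by (intro nn_integral_bind [where B = S]) auto
  also have "\<dots> \<le> (\<integral>\<^sup>+z. ennreal (1 / \<kappa>) * V z + ennreal B \<partial>kernel_power S P n x)"
    using drift K(3) by (intro nn_integral_mono) auto
  also have "\<dots> = ennreal (1 / \<kappa>) * (\<integral>\<^sup>+z. V z \<partial>kernel_power S P n x) + ennreal B"
    by (simp add: nn_integral_add nn_integral_cmult K.emeasure_space_1)
  also have "\<dots> \<le> ennreal (1 / \<kappa>) * (ennreal ((1 / \<kappa>) ^ n) * V x + ennreal B') + ennreal B"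
    by (intro add_mono mult_left_mono Suc) auto
  also have "\<dots> = ennreal ((1 / \<kappa>) ^ Suc n) * V x + ennreal B'"
    by (simp only: distrib_left add.assoc ennreal_power_step ennreal_B'_step)
  finally show ?case .
qed

text \<open>If \<open>C\<close> is never charged, the constant \<open>B\<close> never enters. For
  finite \<open>V x\<close> the mean of \<open>V\<close> then tends to 0, against
  \<open>V \<ge> 1\<close>; this shows that \<open>C\<close> has positive stationary mass.\<close>

lemma drift_iterate_unreached:
  assumes x: "x \<in> space S" and unreached: "\<And>k. emeasure (kernel_power S P k x) C = 0"
  shows "(\<integral>\<^sup>+y. V y \<partial>kernel_power S P n x) \<le> ennreal ((1 / \<kappa>) ^ n) * V x"
proof (induction n)
  case 0
  then show ?case using x by (simp add: nn_integral_return)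
next
  case (Suc n)
  note K = prob_algebraD [OF kernel_power_space [OF x], of n]
  interpret K: prob_space "kernel_power S P n x" by (rule K)
  have [measurable_cong]: "sets (kernel_power S P n x) = sets S" by (rule K)
  have "AE z in kernel_power S P n x. z \<notin> C"
    using unreached [of n] K(2) by (intro AE_not_in) (auto simp: null_sets_def)
  then have ae: "AE z in kernel_power S P n x. (\<integral>\<^sup>+y. V y \<partial>P z) \<le> ennreal (1 / \<kappa>) * V z"
    using drift_off' K(3) by (auto elim!: AE_mp)
  have "(\<integral>\<^sup>+y. V y \<partial>kernel_power S P (Suc n) x) = (\<integral>\<^sup>+z. \<integral>\<^sup>+y. V y \<partial>P z \<partial>kernel_power S P n x)"
    unfolding kernel_power.simps by (intro nn_integral_bind [where B = S]) auto
  also have "\<dots> \<le> (\<integral>\<^sup>+z. ennreal (1 / \<kappa>) * V z \<partial>kernel_power S P n x)"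
    using ae by (rule nn_integral_mono_AE)
  also have "\<dots> = ennreal (1 / \<kappa>) * (\<integral>\<^sup>+z. V z \<partial>kernel_power S P n x)"
    by (simp add: nn_integral_cmult)
  also have "\<dots> \<le> ennreal (1 / \<kappa>) * (ennreal ((1 / \<kappa>) ^ n) * V x)"
    by (intro mult_left_mono Suc) auto
  also have "\<dots> = ennreal ((1 / \<kappa>) ^ Suc n) * V x"
    by (rule ennreal_power_step)
  finally show ?case .
qed

lemma good_moment:
  assumes N: "N \<in> space (prob_algebra S)" and le: "(\<integral>\<^sup>+y. V y \<partial>N) \<le> ennreal b" and b: "0 \<le> b"
  shows "AE y in N. y \<in> good" "integrable N W" "(\<integral>y. W y \<partial>N) \<le> b"
  using prob_integrable_enn2real [OF N V le b] prob_algebraD(3) [OF N]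
  by (auto simp: good_def W_def [abs_def])

lemma kernel_power_moment:
  assumes x: "x \<in> good"
  shows "AE y in kernel_power S P n x. y \<in> good" "integrable (kernel_power S P n x) W"
    "(\<integral>y. W y \<partial>kernel_power S P n x) \<le> (1 / \<kappa>) ^ n * W x + B'"
proof -
  have nonneg: "0 \<le> (1 / \<kappa>) ^ n * W x"
    using \<kappa> W_nonneg by simp
  then have "ennreal ((1 / \<kappa>) ^ n) * V x + ennreal B' = ennreal ((1 / \<kappa>) ^ n * W x + B')"
    using B'_nonneg W_nonneg by (simp add: V_eq_W [OF x] ennreal_plus ennreal_mult'')
  then have le: "(\<integral>\<^sup>+y. V y \<partial>kernel_power S P n x) \<le> ennreal ((1 / \<kappa>) ^ n * W x + B')"
    using drift_iterate [OF goodD(1) [OF x], of n] by metis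
  have "0 \<le> (1 / \<kappa>) ^ n * W x + B'"
    using nonneg B'_nonneg by simp
  then show "AE y in kernel_power S P n x. y \<in> good" "integrable (kernel_power S P n x) W"
    "(\<integral>y. W y \<partial>kernel_power S P n x) \<le> (1 / \<kappa>) ^ n * W x + B'"
    by (rule good_moment [OF kernel_power_space [OF goodD(1) [OF x]] le])+
qed

lemma good_off:
  assumes x: "x \<in> good" "x \<notin> C"
  shows "AE y in P x. y \<in> good" "integrable (P x) W" "(\<integral>y. W y \<partial>P x) \<le> W x / \<kappa>"
proof -
  have "(\<integral>\<^sup>+y. V y \<partial>P x) \<le> ennreal (W x / \<kappa>)"
    using drift_off' [OF goodD(1) [OF x(1)] x(2)] \<kappa> W_nonneg [of x]
    by (simp add: V_eq_W [OF x(1)] flip: ennreal_mult')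
  moreover have "0 \<le> W x / \<kappa>"
    using \<kappa> W_nonneg by simp
  ultimately show "AE y in P x. y \<in> good" "integrable (P x) W" "(\<integral>y. W y \<partial>P x) \<le> W x / \<kappa>"
    by (rule good_moment [OF kernel_space [OF goodD(1) [OF x(1)]]])+
qed

text \<open>The truncation at \<open>N\<close> is needed because \<open>V\<close> is not known to be integrable beforehand.\<close>

lemma stationary_moment:
  assumes \<pi>: "\<pi> \<in> space (prob_algebra S)" "\<pi> \<bind> P = \<pi>" and fin: "AE x in \<pi>. V x < \<infinity>"
  shows "(\<integral>\<^sup>+x. V x \<partial>\<pi>) \<le> ennreal B'"
proof -
  note K = prob_algebraD [OF \<pi>(1)]
  interpret prob_space \<pi> by (rule K)
  have [measurable_cong]: "sets \<pi> = sets S" by (rule K)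
  have trunc: "(\<integral>\<^sup>+x. min (V x) (of_nat N) \<partial>\<pi>) \<le> ennreal B'" for N :: nat
  proof -
    \<comment> \<open>Stationarity allows the truncated mean to be computed after \<open>n\<close>
      steps, where the drift shrinks the contribution of \<open>V\<close> by
      \<open>(1 / \<kappa>) ^ n\<close>; \<open>n\<close> and then \<open>N\<close> tend to
      infinity.\<close>
    have le: "(\<integral>\<^sup>+x. min (V x) (of_nat N) \<partial>\<pi>)
        \<le> (\<integral>\<^sup>+x. min (ennreal ((1 / \<kappa>) ^ n) * V x) (of_nat N) \<partial>\<pi>) + ennreal B'" for n
    proof -
      have "(\<integral>\<^sup>+x. min (V x) (of_nat N) \<partial>\<pi>)
          = (\<integral>\<^sup>+x. \<integral>\<^sup>+y. min (V y) (of_nat N) \<partial>kernel_power S P n x \<partial>\<pi>)"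
        by (subst bind_kernel_power_stationary [OF \<pi>, symmetric, of n], intro nn_integral_bind [where B = S])
           (auto intro: measurable_prob_algebraD)
      also have "\<dots> \<le> (\<integral>\<^sup>+x. min (ennreal ((1 / \<kappa>) ^ n) * V x) (of_nat N) + ennreal B' \<partial>\<pi>)"
      proof (rule nn_integral_mono)
        fix x assume "x \<in> space \<pi>"
        then have x: "x \<in> space S" using K by simp
        interpret Kx: prob_space "kernel_power S P n x"
          by (rule prob_algebraD [OF kernel_power_space [OF x]])
        have "(\<integral>\<^sup>+y. min (V y) (of_nat N) \<partial>kernel_power S P n x) \<le> (\<integral>\<^sup>+y. V y \<partial>kernel_power S P n x)"
          by (intro nn_integral_mono) auto
        also have "\<dots> \<le> ennreal ((1 / \<kappa>) ^ n) * V x + ennreal B'"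
          by (rule drift_iterate [OF x])
        finally have 1: "(\<integral>\<^sup>+y. min (V y) (of_nat N) \<partial>kernel_power S P n x)
            \<le> ennreal ((1 / \<kappa>) ^ n) * V x + ennreal B'" .
        have "(\<integral>\<^sup>+y. min (V y) (of_nat N) \<partial>kernel_power S P n x)
            \<le> (\<integral>\<^sup>+y. of_nat N \<partial>kernel_power S P n x)"
          by (intro nn_integral_mono) auto
        also have "\<dots> \<le> of_nat N + ennreal B'"
          by (simp add: Kx.emeasure_space_1)
        finally show "(\<integral>\<^sup>+y. min (V y) (of_nat N) \<partial>kernel_power S P n x)
            \<le> min (ennreal ((1 / \<kappa>) ^ n) * V x) (of_nat N) + ennreal B'"
          using 1 by (auto simp: min_def)
      qed
      also have "\<dots> = (\<integral>\<^sup>+x. min (ennreal ((1 / \<kappa>) ^ n) * V x) (of_nat N) \<partial>\<pi>) + ennreal B'"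
        by (simp add: nn_integral_add emeasure_space_1)
      finally show ?thesis .
    qed
    have "(\<lambda>n. \<integral>\<^sup>+x. min (ennreal ((1 / \<kappa>) ^ n) * V x) (of_nat N) \<partial>\<pi>) \<longlonglongrightarrow> (\<integral>\<^sup>+x. 0 \<partial>\<pi>)"
    proof (rule nn_integral_dominated_convergence [where w = "\<lambda>_. of_nat N"])
      show "AE x in \<pi>. (\<lambda>n. min (ennreal ((1 / \<kappa>) ^ n) * V x) (of_nat N)) \<longlonglongrightarrow> 0"
        using fin
      proof eventually_elim
        case (elim x)
        have "(\<lambda>n. (1 / \<kappa>) ^ n * enn2real (V x)) \<longlonglongrightarrow> 0 * enn2real (V x)"
          using \<kappa> by (intro tendsto_mult tendsto_const LIMSEQ_power_zero) auto
        then have "(\<lambda>n. ennreal ((1 / \<kappa>) ^ n * enn2real (V x))) \<longlonglongrightarrow> 0"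
          using tendsto_ennrealI by fastforce
        then have "(\<lambda>n. ennreal ((1 / \<kappa>) ^ n) * V x) \<longlonglongrightarrow> 0"
          using elim \<kappa> by (simp add: ennreal_mult')
        then show ?case
          using tendsto_min [of "\<lambda>n. ennreal ((1 / \<kappa>) ^ n) * V x" 0 _ "\<lambda>n. of_nat N" "of_nat N"]
          by simp
      qed
      show "(\<integral>\<^sup>+x. of_nat N \<partial>\<pi>) < \<infinity>"
        by (simp add: emeasure_space_1 less_top [symmetric])
    qed auto
    then have "(\<lambda>n. (\<integral>\<^sup>+x. min (ennreal ((1 / \<kappa>) ^ n) * V x) (of_nat N) \<partial>\<pi>) + ennreal B') \<longlonglongrightarrow> 0 + ennreal B'"
      by (intro tendsto_add tendsto_const) simp
    then show ?thesis
      using le by (intro LIMSEQ_le_const [of _ "ennreal B'"]) auto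
  qed
  have "(SUP N. min (V x) (of_nat N)) = V x" for x
    by (simp add: ennreal_SUP_of_nat_eq_top flip: inf_SUP inf_min)
  then have "(\<integral>\<^sup>+x. V x \<partial>\<pi>) = (\<integral>\<^sup>+x. (SUP N. min (V x) (of_nat N)) \<partial>\<pi>)"
    by simp
  also have "\<dots> = (SUP N. \<integral>\<^sup>+x. min (V x) (of_nat N) \<partial>\<pi>)"
    by (intro nn_integral_monotone_convergence_SUP) (auto simp: incseq_def le_fun_def min.coboundedI2)
  also have "\<dots> \<le> ennreal B'"
    using trunc by (intro SUP_least)
  finally show ?thesis .
qed

end

section \<open>Stationary mass of \<open>C\<close>, small sublevel sets, contraction\<close>

context drift_kernel
begin

text \<open>From a point of \<open>C\<close> no iterate charges the set where \<open>V\<close> is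
  infinite, so by irreducibility this set has no stationary mass.\<close>

lemma stationary_good:
  assumes irr: "irreducible_aperiodic_positive S P \<pi>" and "C \<noteq> {}"
  shows "AE x in \<pi>. V x < \<infinity>"
proof -
  have \<pi>: "\<pi> \<in> space (prob_algebra S)"
    using irr by (simp add: irreducible_aperiodic_positive_def stationary_distribution_def)
  interpret prob_space \<pi> by (rule prob_algebraD [OF \<pi>])
  obtain c where c: "c \<in> C" using \<open>C \<noteq> {}\<close> by blast
  define A where "A = {x\<in>space S. \<not> V x < \<infinity>}"
  have A: "A \<in> sets S" unfolding A_def by measurable
  have null: "measure (kernel_power S P n c) A = 0" for n
  proof -
    interpret K: prob_space "kernel_power S P n c"
      by (rule prob_algebraD [OF kernel_power_space [OF C_space [OF c]]])
    have "AE y in kernel_power S P n c. y \<notin> A"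
      using kernel_power_moment(1) [OF C_good [OF c], of n] by eventually_elim (auto simp: A_def good_def)
    then show ?thesis
      using A prob_algebraD(2) [OF kernel_power_space [OF C_space [OF c]], of n] by (subst K.prob_eq_0) auto
  qed
  have "measure \<pi> A = 0"
  proof (rule ccontr)
    assume "measure \<pi> A \<noteq> 0"
    then have "0 < measure \<pi> A" by (simp add: zero_less_measure_iff)
    then have "\<forall>\<^sub>F n in sequentially. measure (kernel_power S P n c) A > 0"
      using irr A C_space [OF c] by (simp add: irreducible_aperiodic_positive_def)
    then show False
      using null by simp
  qed
  then have "AE x in \<pi>. x \<notin> A"
    using A prob_algebraD(2) [OF \<pi>] by (subst (asm) prob_eq_0) auto
  then show ?thesis
    using AE_space [of \<pi>] by eventually_elim (use prob_algebraD(3) [OF \<pi>] in \<open>auto simp: A_def\<close>)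
qed

text \<open>If \<pi> gave \<open>C\<close> no mass, stationarity would provide a point with finite
  \<open>V\<close> from which \<open>C\<close> is never charged, and there the drift without its
  constant pushes the mean of \<open>V\<close> below 1.\<close>

lemma stationary_C_pos:
  assumes irr: "irreducible_aperiodic_positive S P \<pi>" and "C \<noteq> {}"
  shows "0 < measure \<pi> C"
proof (rule ccontr)
  assume "\<not> 0 < measure \<pi> C"
  then have zero: "measure \<pi> C = 0" by (simp add: zero_less_measure_iff)
  have \<pi>: "\<pi> \<in> space (prob_algebra S)" "\<pi> \<bind> P = \<pi>"
    using irr by (simp_all add: irreducible_aperiodic_positive_def stationary_distribution_def)
  interpret prob_space \<pi> by (rule prob_algebraD [OF \<pi>(1)])
  have [measurable_cong]: "sets \<pi> = sets S" by (rule prob_algebraD [OF \<pi>(1)])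
  have "AE x in \<pi>. emeasure (kernel_power S P k x) C = 0" for k
  proof -
    have "(\<integral>\<^sup>+x. emeasure (kernel_power S P k x) C \<partial>\<pi>) = emeasure \<pi> C"
      using emeasure_bind_prob_algebra [OF \<pi>(1) kernel_power_measurable C, of k]
      by (simp add: bind_kernel_power_stationary [OF \<pi>])
    also have "\<dots> = 0"
      using zero by (simp add: emeasure_eq_measure)
    finally have "(\<integral>\<^sup>+x. emeasure (kernel_power S P k x) C \<partial>\<pi>) = 0" .
    moreover have "(\<lambda>x. emeasure (kernel_power S P k x) C) \<in> borel_measurable S"
      by (rule measurable_compose [OF measurable_prob_algebraD [OF kernel_power_measurable]
            measurable_emeasure_subprob_algebra [OF C]])
    then have "(\<lambda>x. emeasure (kernel_power S P k x) C) \<in> borel_measurable \<pi>"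
      by measurable
    ultimately show ?thesis
      by (simp add: nn_integral_0_iff_AE)
  qed
  then have "AE x in \<pi>. \<forall>k. emeasure (kernel_power S P k x) C = 0"
    by (simp add: AE_all_countable)
  with stationary_good [OF assms] AE_space [of \<pi>]
  have reach: "AE x in \<pi>. x \<in> good \<and> (\<forall>k. emeasure (kernel_power S P k x) C = 0)"
    by eventually_elim (use prob_algebraD(3) [OF \<pi>(1)] in \<open>auto simp: good_def\<close>)
  have "\<exists>x. x \<in> good \<and> (\<forall>k. emeasure (kernel_power S P k x) C = 0)"
  proof (rule ccontr)
    assume no: "\<nexists>x. x \<in> good \<and> (\<forall>k. emeasure (kernel_power S P k x) C = 0)"
    from reach have "AE x in \<pi>. False"
      by eventually_elim (use no in blast)
    then show False
      by (simp add: AE_False)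
  qed
  then obtain x where x: "x \<in> good" and unreached: "\<And>k. emeasure (kernel_power S P k x) C = 0"
    by blast
  have "1 \<le> (1 / \<kappa>) ^ n * W x" for n
  proof -
    interpret K: prob_space "kernel_power S P n x"
      by (rule prob_algebraD [OF kernel_power_space [OF goodD(1) [OF x]]])
    have "1 = (\<integral>\<^sup>+y. 1 \<partial>kernel_power S P n x)"
      by (simp add: K.emeasure_space_1)
    also have "\<dots> \<le> (\<integral>\<^sup>+y. V y \<partial>kernel_power S P n x)"
      using V_ge_1 prob_algebraD(3) [OF kernel_power_space [OF goodD(1) [OF x]], of n]
      by (intro nn_integral_mono) auto
    also have "\<dots> \<le> ennreal ((1 / \<kappa>) ^ n) * V x"
      by (rule drift_iterate_unreached [OF goodD(1) [OF x] unreached])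
    also have "\<dots> = ennreal ((1 / \<kappa>) ^ n * W x)"
      using W_nonneg by (simp add: V_eq_W [OF x] ennreal_mult'')
    finally show ?thesis
      by (simp add: ennreal_le_iff2 flip: ennreal_1)
  qed
  moreover have "(\<lambda>n. (1 / \<kappa>) ^ n * W x) \<longlonglongrightarrow> 0 * W x"
    using \<kappa> by (intro tendsto_mult tendsto_const LIMSEQ_power_zero) auto
  ultimately have "1 \<le> 0 * W x"
    by (intro LIMSEQ_le_const) auto
  then show False by simp
qed

context
  fixes m :: nat and \<nu> :: "'a measure" and \<delta> :: real
  assumes \<nu>: "\<nu> \<in> space (prob_algebra S)" and \<delta>: "0 < \<delta>"
    and minor: "\<And>x A. x \<in> C \<Longrightarrow> A \<in> sets S \<Longrightarrow> \<delta> * measure \<nu> A \<le> measure (kernel_power S P m x) A"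
begin

lemma minor_integral:
  assumes "x \<in> C" "bmeas S f" "\<And>x. x \<in> space S \<Longrightarrow> 0 \<le> f x"
  shows "\<delta> * (\<integral>y. f y \<partial>\<nu>) \<le> (kop P ^^ m) f x"
  using minorization_integral [OF kernel_power_space [OF C_space [OF assms(1)]] \<nu> \<delta> minor [OF assms(1)] assms(2,3)]
  by (simp add: integral_kernel_power [OF assms(2) C_space [OF assms(1)]])

text \<open>This is the only place where aperiodicity enters.\<close>

lemma return_from_\<nu>:
  assumes irr: "irreducible_aperiodic_positive S P \<pi>" and "C \<noteq> {}"
  obtains n\<^sub>0 where "\<And>n. n\<^sub>0 \<le> n \<Longrightarrow> 0 < (\<integral>y. (kop P ^^ n) (indicator C) y \<partial>\<nu>)"
proof -
  interpret \<nu>: prob_space \<nu> by (rule prob_algebraD [OF \<nu>])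
  have sets_\<nu> [measurable_cong]: "sets \<nu> = sets S" by (rule prob_algebraD [OF \<nu>])
  have sp: "space \<nu> = space S" by (rule prob_algebraD [OF \<nu>])
  define h where "h n = (kop P ^^ n) (indicator C)" for n
  have h: "bmeas S (h n)" for n
    unfolding h_def by (intro bmeas_kop_funpow bmeas_indicator C)
  have h0: "0 \<le> h n x" if "x \<in> space S" for n x
    using measure_kernel_power [OF that C, of n] measure_nonneg [of "kernel_power S P n x" C] by (simp add: h_def)
  have [measurable]: "h n \<in> borel_measurable S" for n
    by (rule bmeas_measurable [OF h])
  \<comment> \<open>The time from which on \<open>C\<close> is charged depends on the point. The
    sets \<open>D k\<close> exhaust the space, so one of them has positive \<nu>-mass, and its index
    is the required uniform time.\<close>
  define D where "D k = {y\<in>space S. \<forall>n\<ge>k. 0 < h n y}" for k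
  have D: "D k \<in> sets S" for k
    unfolding D_def by measurable
  have "(\<Union>k. D k) = space S"
  proof (intro equalityI subsetI)
    fix y assume y: "y \<in> space S"
    then have "\<forall>\<^sub>F n in sequentially. 0 < measure (kernel_power S P n y) C"
      using irr C stationary_C_pos [OF assms] unfolding irreducible_aperiodic_positive_def by blast
    then have "\<forall>\<^sub>F n in sequentially. 0 < h n y"
      by (simp add: measure_kernel_power [OF y C] h_def)
    then show "y \<in> (\<Union>k. D k)"
      using y by (auto simp: D_def eventually_sequentially)
  qed (auto simp: D_def)
  have "\<exists>k. emeasure \<nu> (D k) \<noteq> 0"
  proof (rule ccontr)
    assume "\<nexists>k. emeasure \<nu> (D k) \<noteq> 0"
    then have "emeasure \<nu> (\<Union>k. D k) = 0"
      using D sets_\<nu> by (intro emeasure_UN_eq_0) auto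
    then show False
      using \<nu>.emeasure_space_1 sp \<open>(\<Union>k. D k) = space S\<close> by simp
  qed
  then obtain k where k: "emeasure \<nu> (D k) \<noteq> 0" by blast
  show ?thesis
  proof (rule that [of k], rule ccontr)
    fix n assume "k \<le> n" "\<not> 0 < (\<integral>y. (kop P ^^ n) (indicator C) y \<partial>\<nu>)"
    then have "\<not> 0 < (\<integral>y. h n y \<partial>\<nu>)" by (simp add: h_def)
    moreover have "0 \<le> (\<integral>y. h n y \<partial>\<nu>)"
      using h0 sp by (intro Bochner_Integration.integral_nonneg) auto
    ultimately have "(\<integral>y. h n y \<partial>\<nu>) = 0" by simp
    then have "AE y in \<nu>. h n y = 0"
      using h0 sp by (subst (asm) integral_nonneg_eq_0_iff_AE [OF bmeas_integrable [OF h \<nu>]]) auto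
    then have "AE y in \<nu>. y \<notin> D k"
      by eventually_elim (use \<open>k \<le> n\<close> in \<open>auto simp: D_def\<close>)
    then have "emeasure \<nu> (D k) = 0"
      using D sets_\<nu> by (intro AE_iff_measurable [THEN iffD1, rotated 2]) (auto simp: D_def sp)
    with k show False by simp
  qed
qed

text \<open>From \<open>C\<close> to \<nu> in \<open>m\<close> steps, back to \<open>C\<close> in
  \<open>n\<close>, and to \<nu> again in \<open>m\<close>. The minorizing measure is the same for
  every \<open>n\<close>, so visits to \<open>C\<close> at different times can be synchronised to
  one final time.\<close>

lemma minor_later:
  assumes x: "x \<in> C" and A: "A \<in> sets S"
  shows "\<delta> * (\<integral>y. (kop P ^^ n) (indicator C) y \<partial>\<nu>) * (\<delta> * measure \<nu> A)
    \<le> (kop P ^^ (m + n + m)) (indicator A) x"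
proof -
  define c where "c = \<delta> * measure \<nu> A"
  have c: "0 \<le> c" using \<delta> by (simp add: c_def)
  have b: "bmeas S (indicator A :: 'a \<Rightarrow> real)" "bmeas S (indicator C :: 'a \<Rightarrow> real)"
    using A by (auto intro: bmeas_indicator)
  have bC: "bmeas S (\<lambda>y. c * indicator C y)"
    by (intro bmeas_mult bmeas_const b)
  have low: "c * indicator C y \<le> (kop P ^^ m) (indicator A) y" if y: "y \<in> space S" for y
    using minor [of y A] A measure_kernel_power [OF y A, of m]
      measure_nonneg [of "kernel_power S P m y" A] by (auto simp: c_def split: split_indicator)
  have "\<delta> * (\<integral>y. (kop P ^^ n) (\<lambda>y. c * indicator C y) y \<partial>\<nu>)
      \<le> (kop P ^^ m) ((kop P ^^ n) (\<lambda>y. c * indicator C y)) x"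
  proof (rule minor_integral [OF x bmeas_kop_funpow [OF bC]])
    fix y assume y: "y \<in> space S"
    show "0 \<le> (kop P ^^ n) (\<lambda>y. c * indicator C y) y"
      using c measure_kernel_power [OF y C, of n] measure_nonneg [of "kernel_power S P n y" C]
      by (simp add: kop_funpow_cmult)
  qed
  also have "\<dots> \<le> (kop P ^^ m) ((kop P ^^ n) ((kop P ^^ m) (indicator A))) x"
    by (intro kop_funpow_mono bmeas_kop_funpow b bC low C_space [OF x])
  finally show ?thesis
    unfolding kop_funpow_cmult funpow_add o_def by (simp add: c_def mult_ac)
qed

text \<open>
  The factor \<open>1 - (1 / \<kappa>) ^ k * W x\<close> below is Markov's lower bound for the probability of hitting
  \<open>C\<close> within \<open>k\<close> steps from \<open>x\<close>.
\<close>

lemma sublevel_small: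
  assumes irr: "irreducible_aperiodic_positive S P \<pi>" and "C \<noteq> {}"
  obtains T \<epsilon> where "0 < T" "0 < \<epsilon>" "\<epsilon> < 1"
    "\<And>x A. x \<in> space S \<Longrightarrow> V x \<le> ennreal R \<Longrightarrow> A \<in> sets S \<Longrightarrow>
       \<epsilon> * measure \<nu> A \<le> measure (kernel_power S P T x) A"
proof -
  obtain n\<^sub>0 where n\<^sub>0: "\<And>n. n\<^sub>0 \<le> n \<Longrightarrow> 0 < (\<integral>y. (kop P ^^ n) (indicator C) y \<partial>\<nu>)"
    using return_from_\<nu> [OF assms] by blast
  define c where "c n = \<delta> * (\<integral>y. (kop P ^^ n) (indicator C) y \<partial>\<nu>) * \<delta>" for n
  \<comment> \<open>Chosen so that the Markov factor with \<open>k = N\<close> is at least 1/2 on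
    the sublevel set.\<close>
  obtain N where N: "(1 / \<kappa>) ^ N < 1 / (2 * max 1 R)"
    using real_arch_pow_inv [of "1 / (2 * max 1 R)" "1 / \<kappa>"] \<kappa> by auto
  \<comment> \<open>The minimum over the possible waiting times after the visit; inserting 1 keeps
    \<open>\<eta> / 2\<close> below 1. Starting at \<open>n\<^sub>0 + 1\<close> makes the total time
    positive even for \<open>m = 0\<close>.\<close>
  define \<eta> where "\<eta> = Min (insert 1 (c ` {n\<^sub>0 + 1..n\<^sub>0 + 1 + N}))"
  have \<eta>: "0 < \<eta>" "\<eta> \<le> 1"
    using n\<^sub>0 \<delta> by (auto simp: \<eta>_def c_def)
  have \<eta>_le: "\<eta> \<le> c (n\<^sub>0 + 1 + k)" if "k \<le> N" for k
    unfolding \<eta>_def using that by (intro Min_le insertI2 imageI) auto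
  define l where "l = m + (n\<^sub>0 + 1) + m"
  have key: "\<eta> * measure \<nu> A * (1 - (1 / \<kappa>) ^ k * W x) \<le> (kop P ^^ (l + k)) (indicator A) x"
    if "k \<le> N" "x \<in> good" and A: "A \<in> sets S" for k x A
    using that(1,2)
  proof (induction k arbitrary: x)
    case 0
    have "\<eta> * measure \<nu> A * (1 - W x) \<le> 0"
      using \<eta> W_ge_1 [OF 0(2)] by (simp add: mult_le_0_iff)
    also have "\<dots> \<le> (kop P ^^ l) (indicator A) x"
      using measure_kernel_power [OF goodD(1) [OF 0(2)] A, of l] measure_nonneg by metis
    finally show ?case by simp
  next
    case (Suc k)
    note x = goodD(1) [OF Suc.prems(2)]
    show ?case
    proof (cases "x \<in> C")
      case True
      have "\<eta> * measure \<nu> A * (1 - (1 / \<kappa>) ^ Suc k * W x) \<le> \<eta> * measure \<nu> A * 1"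
        using \<eta> \<kappa> W_nonneg [of x] by (intro mult_left_mono) auto
      also have "\<dots> \<le> c (n\<^sub>0 + 1 + Suc k) * measure \<nu> A"
        using \<eta>_le [OF Suc.prems(1)] by (simp add: mult_right_mono)
      also have "\<dots> \<le> (kop P ^^ (m + (n\<^sub>0 + 1 + Suc k) + m)) (indicator A) x"
        using minor_later [OF True A, of "n\<^sub>0 + 1 + Suc k"] by (simp add: c_def mult_ac)
      also have "m + (n\<^sub>0 + 1 + Suc k) + m = l + Suc k"
        by (simp add: l_def)
      finally show ?thesis .
    next
      case False
      interpret Px: prob_space "P x" by (rule prob_algebraD [OF kernel_space [OF x]])
      note off = good_off [OF Suc.prems(2) False]
      let ?a = "\<eta> * measure \<nu> A"
      have "?a * (1 - (1 / \<kappa>) ^ Suc k * W x) = ?a * (1 - (1 / \<kappa>) ^ k * (W x / \<kappa>))"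
        by simp
      also have "\<dots> \<le> ?a * (1 - (1 / \<kappa>) ^ k * (\<integral>y. W y \<partial>P x))"
        using \<eta> \<kappa> off(3) by (intro mult_left_mono diff_left_mono) auto
      also have "\<dots> = (\<integral>y. ?a * (1 - (1 / \<kappa>) ^ k * W y) \<partial>P x)"
        using off(2) by (simp add: Px.prob_space)
      also have "\<dots> \<le> (\<integral>y. (kop P ^^ (l + k)) (indicator A) y \<partial>P x)"
      proof (rule integral_mono_AE)
        show "integrable (P x) ((kop P ^^ (l + k)) (indicator A))"
          by (intro bmeas_integrable [OF _ kernel_space [OF x]] bmeas_kop_funpow bmeas_indicator A)
        show "AE y in P x. ?a * (1 - (1 / \<kappa>) ^ k * W y) \<le> (kop P ^^ (l + k)) (indicator A) y"
          using off(1) by eventually_elim (use Suc in auto)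
      qed (use off(2) in auto)
      finally show ?thesis
        by (simp add: kop_def [of P "(kop P ^^ (l + k)) (indicator A)"])
    qed
  qed
  show ?thesis
  proof (rule that [of "l + N" "\<eta> / 2"])
    fix x A assume x: "x \<in> space S" "V x \<le> ennreal R" and A: "A \<in> sets S"
    then have good: "x \<in> good"
      by (auto simp: good_def intro: le_less_trans)
    have "ennreal (W x) \<le> ennreal (max 1 R)"
      unfolding V_eq_W [OF good, symmetric] by (rule order_trans [OF x(2) ennreal_leI]) simp
    then have "W x \<le> max 1 R"
      by (subst (asm) ennreal_le_iff) auto
    then have "(1 / \<kappa>) ^ N * W x \<le> 1 / (2 * max 1 R) * max 1 R"
      using N \<kappa> W_nonneg [of x] by (intro mult_mono) auto
    also have "1 / (2 * max 1 R) * max 1 R = 1 / 2"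
      by (simp add: max_def)
    finally have "1 / 2 \<le> 1 - (1 / \<kappa>) ^ N * W x"
      by simp
    then have "\<eta> * measure \<nu> A * (1 / 2) \<le> \<eta> * measure \<nu> A * (1 - (1 / \<kappa>) ^ N * W x)"
      using \<eta> by (intro mult_left_mono) auto
    then show "\<eta> / 2 * measure \<nu> A \<le> measure (kernel_power S P (l + N) x) A"
      using key [OF order_refl good A] measure_kernel_power [OF x(1) A, of "l + N"] by simp
  qed (use \<eta> in \<open>auto simp: l_def\<close>)
qed

text \<open>The exponent \<open>T\<close> depends on the level \<open>R\<close>, so \<open>R\<close>
  has to be chosen first. This is possible because all iterates of positive order share the drift
  constant \<open>B'\<close> and a coefficient at most \<open>1 / \<kappa>\<close>. A
  \<open>T\<close>-th root spreads the contraction over single steps, and the remainder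
  \<open>n mod T\<close> costs the factor \<open>1 / \<alpha>\<close>.\<close>

lemma geometric_contraction:
  assumes irr: "irreducible_aperiodic_positive S P \<pi>" and "C \<noteq> {}"
  obtains A \<rho> where "1 \<le> A" "0 < \<rho>" "\<rho> < 1"
    "\<And>\<phi> x y n. \<phi> \<in> borel_measurable S \<Longrightarrow> (\<And>z. z \<in> space S \<Longrightarrow> \<bar>\<phi> z\<bar> \<le> 1) \<Longrightarrow> x \<in> good \<Longrightarrow> y \<in> good \<Longrightarrow>
       (kop P ^^ n) \<phi> x - (kop P ^^ n) \<phi> y \<le> A * \<rho> ^ n * (W x + W y)"
proof -
  define R where "R = 2 * B' / (1 - 1 / \<kappa>) + 1"
  obtain T \<epsilon> where T: "0 < T" and \<epsilon>: "0 < \<epsilon>" "\<epsilon> < 1"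
    and small: "\<And>x A. x \<in> space S \<Longrightarrow> V x \<le> ennreal R \<Longrightarrow> A \<in> sets S \<Longrightarrow>
       \<epsilon> * measure \<nu> A \<le> measure (kernel_power S P T x) A"
    using sublevel_small [OF assms, of R] by blast
  interpret Q: kernel S "kernel_power S P T"
    by unfold_locales (rule kernel_power_measurable)
  let ?Q = "kernel_power S P T"
  have g: "0 \<le> (1 / \<kappa>) ^ T" "(1 / \<kappa>) ^ T \<le> 1 / \<kappa>" "(1 / \<kappa>) ^ T < 1"
    using \<kappa> T power_decreasing [of 1 T "1 / \<kappa>"] by (auto simp: power_less_one_iff)
  have pos: "0 < 1 - 1 / \<kappa>" using \<kappa> by simp
  have R0: "0 < R"
    using B'_nonneg pos by (simp add: R_def add_nonneg_pos)
  have "p * (2 * B' / p + 1) = 2 * B' + p" if "0 < p" for p :: real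
    using that by (simp add: field_simps)
  from this [OF pos] pos have "2 * B' < (1 - 1 / \<kappa>) * R"
    by (simp only: R_def)
  also have "\<dots> \<le> (1 - (1 / \<kappa>) ^ T) * R"
    using g R0 by (intro mult_right_mono) auto
  finally have R: "2 * B' < (1 - (1 / \<kappa>) ^ T) * R" .
  obtain \<alpha> where \<alpha>: "0 < \<alpha>" "\<alpha> < 1"
    and contr: "\<And>\<phi> x y n. \<phi> \<in> borel_measurable S \<Longrightarrow> (\<And>z. z \<in> space S \<Longrightarrow> \<bar>\<phi> z\<bar> \<le> 1) \<Longrightarrow>
       x \<in> space S \<Longrightarrow> V x < \<infinity> \<Longrightarrow> y \<in> space S \<Longrightarrow> V y < \<infinity> \<Longrightarrow>
       (kop ?Q ^^ n) \<phi> x - (kop ?Q ^^ n) \<phi> y \<le> 2 * \<alpha> ^ n * (enn2real (V x) + enn2real (V y))"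
    using Q.harris_iterate [OF V V_ge_1 drift_iterate g(1) g(3) B'_nonneg R0 R \<nu> \<epsilon> small] by blast
  have kopQ: "(kop ?Q ^^ q) \<phi> x = (kop P ^^ (T * q)) \<phi> x" if "bmeas S \<phi>" "x \<in> space S" for \<phi> x q
    using that(2)
  proof (induction q arbitrary: x)
    case (Suc q)
    have "(kop ?Q ^^ Suc q) \<phi> x = kop ?Q ((kop P ^^ (T * q)) \<phi>) x"
      using Q.kop_cong [OF Suc.IH Suc.prems] by simp
    also have "\<dots> = (kop P ^^ T) ((kop P ^^ (T * q)) \<phi>) x"
      unfolding kop_def [of ?Q] by (intro integral_kernel_power bmeas_kop_funpow that Suc.prems)
    finally show ?case
      by (simp add: funpow_add)
  qed simp
  define \<rho> where "\<rho> = root T \<alpha>"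
  have \<rho>: "0 < \<rho>" "\<rho> < 1" "\<rho> ^ T = \<alpha>"
    using T \<alpha> by (auto simp: \<rho>_def)
  show ?thesis
  proof (rule that [of "2 / \<alpha>" \<rho>])
    show "1 \<le> 2 / \<alpha>" using \<alpha> by simp
    fix \<phi> :: "'a \<Rightarrow> real" and x y n
    assume \<phi>: "\<phi> \<in> borel_measurable S" "\<And>z. z \<in> space S \<Longrightarrow> \<bar>\<phi> z\<bar> \<le> 1" and xy: "x \<in> good" "y \<in> good"
    define q r where "q = n div T" and "r = n mod T"
    have n: "n = T * q + r" by (simp add: q_def r_def)
    have r: "r \<le> T" using T by (simp add: r_def less_imp_le)
    let ?\<psi> = "(kop P ^^ r) \<phi>"
    have b\<phi>: "bmeas S \<phi>" using \<phi> by (rule bmeasI)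
    have b: "bmeas S ?\<psi>" by (rule bmeas_kop_funpow [OF b\<phi>])
    have "(kop P ^^ n) \<phi> z = (kop ?Q ^^ q) ?\<psi> z" if "z \<in> space S" for z
      using kopQ [OF b that] by (simp add: n funpow_add)
    then have "(kop P ^^ n) \<phi> x - (kop P ^^ n) \<phi> y \<le> 2 * \<alpha> ^ q * (W x + W y)"
      using contr [OF bmeas_measurable [OF b] kop_funpow_abs_le [OF \<phi>], of x y q] xy
      by (simp add: good_def W_def)
    also have "\<dots> \<le> 2 * (\<rho> ^ n / \<alpha>) * (W x + W y)"
    proof (intro mult_right_mono mult_left_mono)
      have "\<alpha> ^ q * \<alpha> = \<rho> ^ (T * q + T)"
        using \<rho>(3) by (simp add: power_add power_mult)
      also have "\<dots> \<le> \<rho> ^ n"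
        using \<rho> r by (intro power_decreasing) (auto simp: n)
      finally show "\<alpha> ^ q \<le> \<rho> ^ n / \<alpha>"
        using \<alpha> by (simp add: field_simps)
    qed (auto simp: W_nonneg)
    finally show "(kop P ^^ n) \<phi> x - (kop P ^^ n) \<phi> y \<le> 2 / \<alpha> * \<rho> ^ n * (W x + W y)"
      by simp
  qed (use \<rho> in auto)
qed

end

end

subsection \<open>Exponential moments for small influence constants\<close>

lemma exp_le_quadratic:
  fixes x :: real
  shows "exp x \<le> 1 + x + x\<^sup>2 * exp \<bar>x\<bar>"
proof -
  obtain t where t: "\<bar>t\<bar> \<le> \<bar>x\<bar>" "exp x = (\<Sum>m<2. x ^ m / fact m) + exp t / fact 2 * x ^ 2"
    using Maclaurin_exp_le [of x 2] by blast
  have "exp t / 2 * x\<^sup>2 \<le> exp \<bar>x\<bar> * x\<^sup>2"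
  proof (rule mult_right_mono)
    have "exp t \<le> exp \<bar>x\<bar>" using t(1) by simp
    then show "exp t / 2 \<le> exp \<bar>x\<bar>"
      using exp_gt_zero [of t] by linarith
  qed simp
  then show ?thesis
    using t(2) by (simp add: numeral_2_eq_2 mult.commute)
qed

text \<open>Truncated subtraction makes the weights before \<open>j\<close> equal to 1, which
  accounts for \<open>j - k\<close>; the rest is a geometric series.\<close>

lemma sum_power_diff_le:
  fixes \<rho> :: real
  assumes "0 \<le> \<rho>" "\<rho> < 1" "k \<le> j"
  shows "(\<Sum>l\<in>{k..<n}. \<rho> ^ (l - j)) \<le> real (j - k) + 1 / (1 - \<rho>)"
proof -
  have geo: "(\<Sum>l\<in>{j..<p}. \<rho> ^ (l - j)) \<le> 1 / (1 - \<rho>)" for p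
  proof -
    have "(\<Sum>l\<in>{j..<p}. \<rho> ^ (l - j)) = (\<Sum>i<p - j. \<rho> ^ i)"
      by (rule sum.reindex_bij_witness [of _ "\<lambda>i. i + j" "\<lambda>l. l - j"]) auto
    also have "\<dots> \<le> (\<Sum>i. \<rho> ^ i)"
      using assms by (intro sum_le_suminf summable_geometric) auto
    also have "\<dots> = 1 / (1 - \<rho>)"
      using assms by (intro suminf_geometric) auto
    finally show ?thesis .
  qed
  have "(\<Sum>l\<in>{k..<n}. \<rho> ^ (l - j)) \<le> (\<Sum>l\<in>{k..<j} \<union> {j..<n}. \<rho> ^ (l - j))"
    using assms by (intro sum_mono2) auto
  also have "\<dots> = (\<Sum>l\<in>{k..<j}. \<rho> ^ (l - j)) + (\<Sum>l\<in>{j..<n}. \<rho> ^ (l - j))"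
    by (intro sum.union_disjoint) auto
  also have "\<dots> \<le> real (j - k) + 1 / (1 - \<rho>)"
    using geo [of n] by simp
  finally show ?thesis .
qed

section \<open>Freezing coordinates\<close>

context chain
begin

definition freeze :: "'a \<Rightarrow> nat set \<Rightarrow> (nat \<Rightarrow> 'a) \<Rightarrow> (nat \<Rightarrow> 'a)" where
  "freeze z J w = (\<lambda>i. if i \<in> J then z else w i)"

lemma freeze_path_space: "z \<in> space S \<Longrightarrow> w \<in> space path_space \<Longrightarrow> freeze z J w \<in> space path_space"
  by (simp add: path_space_iff freeze_def)

lemma freeze_measurable:
  assumes "z \<in> space S"
  shows "freeze z J \<in> path_space \<rightarrow>\<^sub>M path_space"
proof (rule measurable_PiM_single')
  show "(\<lambda>w. freeze z J w i) \<in> path_space \<rightarrow>\<^sub>M S" for i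
    using assms by (cases "i \<in> J") (auto simp: freeze_def)
qed (use assms in \<open>auto simp: freeze_def space_PiM\<close>)

lemma bmeas_freeze:
  assumes "bmeas path_space f" "z \<in> space S"
  shows "bmeas path_space (\<lambda>w. f (freeze z J w))"
proof -
  obtain b where "\<And>w. w \<in> space path_space \<Longrightarrow> \<bar>f w\<bar> \<le> b"
    using assms by (metis bmeas_bounded)
  then show ?thesis
    using freeze_path_space [OF assms(2)] measurable_compose [OF freeze_measurable [OF assms(2)] bmeas_measurable [OF assms(1)]]
    by (intro bmeasI [where b = b]) auto
qed

lemma freeze_insert: "freeze z (insert i J) w = (freeze z J w)(i := z)"
  by (auto simp: freeze_def fun_eq_iff)

definition influence :: "nat \<Rightarrow> (nat \<Rightarrow> real) \<Rightarrow> ((nat \<Rightarrow> 'a) \<Rightarrow> real) \<Rightarrow> bool" where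
  "influence n L f \<longleftrightarrow> (\<forall>i<n. \<forall>w\<in>space path_space. \<forall>y\<in>space S. \<bar>f w - f (w(i := y))\<bar> \<le> L i)"

lemma influenceD:
  "influence n L f \<Longrightarrow> i < n \<Longrightarrow> w \<in> space path_space \<Longrightarrow> y \<in> space S \<Longrightarrow> \<bar>f w - f (w(i := y))\<bar> \<le> L i"
  by (simp add: influence_def)

lemma freeze_diff_le:
  assumes "influence n L f" "z \<in> space S" "w \<in> space path_space" "finite J" "J \<subseteq> {..<n}"
  shows "\<bar>f w - f (freeze z J w)\<bar> \<le> sum L J"
  using assms(4,5)
proof (induction J rule: finite_induct)
  case empty
  then show ?case by (simp add: freeze_def)
next
  case (insert i J)
  have "\<bar>f (freeze z J w) - f (freeze z (insert i J) w)\<bar> \<le> L i"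
    unfolding freeze_insert using insert.prems
    by (intro influenceD [OF assms(1)] freeze_path_space assms) auto
  then show ?case
    using insert by simp
qed

end

section \<open>Conditional expectations at visits to \<open>C\<close>\<close>

locale contracting_chain = drift_kernel S P V C \<kappa> B + chain S P \<mu>
  for S :: "'a measure" and P V C \<kappa> B \<mu> +
  fixes A \<rho> b :: real
  assumes A: "1 \<le> A" and \<rho>: "0 < \<rho>" "\<rho> < 1"
    and contraction: "\<And>\<phi> x y n. \<phi> \<in> borel_measurable S \<Longrightarrow> (\<And>z. z \<in> space S \<Longrightarrow> \<bar>\<phi> z\<bar> \<le> 1) \<Longrightarrow>
       x \<in> good \<Longrightarrow> y \<in> good \<Longrightarrow> (kop P ^^ n) \<phi> x - (kop P ^^ n) \<phi> y \<le> A * \<rho> ^ n * (W x + W y)"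
    and initial_moment: "(\<integral>\<^sup>+x. V x \<partial>\<mu>) \<le> ennreal b"
    and b: "B \<le> b"
begin

text \<open>The 2 pays for coordinates up to \<open>j\<close>, where a trivial bound is used. In the
  other term \<open>b + B'\<close> bounds the mean weight of the law of coordinate \<open>j\<close>,
  1 is the weight of a point of \<open>C\<close>, and the division by \<rho> makes up for
  contracting over \<open>l - j - 1\<close> steps only.\<close>

definition "gap_const = 2 + A * (b + B' + 1) / \<rho>"

lemma b_nonneg: "0 \<le> b"
  using b B by simp

lemma gap_const_ge: "2 \<le> gap_const" "A * (b + B' + 1) \<le> gap_const * \<rho>"
proof -
  have "0 \<le> A * (b + B' + 1)"
    using A b_nonneg B'_nonneg by (intro mult_nonneg_nonneg) auto
  then show "2 \<le> gap_const" "A * (b + B' + 1) \<le> gap_const * \<rho>"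
    using \<rho> by (auto simp: gap_const_def field_simps)
qed

lemma contraction_scaled:
  assumes \<phi>: "\<phi> \<in> borel_measurable S" "\<And>z. z \<in> space S \<Longrightarrow> \<bar>\<phi> z\<bar> \<le> c" and xy: "x \<in> good" "y \<in> good"
  shows "\<bar>(kop P ^^ n) \<phi> x - (kop P ^^ n) \<phi> y\<bar> \<le> c * A * \<rho> ^ n * (W x + W y)"
proof (cases "c = 0")
  case True
  then show ?thesis
    using kop_funpow_abs_le [OF \<phi> goodD(1) [OF xy(1)], of n] kop_funpow_abs_le [OF \<phi> goodD(1) [OF xy(2)], of n]
    by simp
next
  case False
  then have c: "0 < c"
    using \<phi>(2) [OF goodD(1) [OF xy(1)]] by linarith
  define \<psi> where "\<psi> z = 1 / c * \<phi> z" for z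
  have "\<psi> \<in> borel_measurable S"
    unfolding \<psi>_def using \<phi>(1) by measurable
  moreover have "\<bar>\<psi> z\<bar> \<le> 1" if "z \<in> space S" for z
    using \<phi>(2) [OF that] c by (simp add: \<psi>_def abs_mult)
  ultimately have "\<bar>(kop P ^^ n) \<psi> x - (kop P ^^ n) \<psi> y\<bar> \<le> A * \<rho> ^ n * (W x + W y)"
    using contraction [of \<psi> x y n] contraction [of \<psi> y x n] xy by (simp add: abs_le_iff add.commute)
  moreover have "(kop P ^^ n) \<psi> z = (kop P ^^ n) \<phi> z / c" for z
    unfolding \<psi>_def kop_funpow_cmult by simp
  ultimately have "\<bar>(kop P ^^ n) \<phi> x - (kop P ^^ n) \<phi> y\<bar> / c \<le> A * \<rho> ^ n * (W x + W y)"
    using c by (simp add: diff_divide_distrib [symmetric])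
  then show ?thesis
    using c by (simp add: pos_divide_le_eq mult_ac)
qed

lemma contraction_integral:
  assumes \<phi>: "\<phi> \<in> borel_measurable S" "\<And>z. z \<in> space S \<Longrightarrow> \<bar>\<phi> z\<bar> \<le> c" and z: "z \<in> good"
    and N: "N \<in> space (prob_algebra S)" "(\<integral>\<^sup>+x. V x \<partial>N) \<le> ennreal d" "0 \<le> d"
  shows "\<bar>(\<integral>x. (kop P ^^ n) \<phi> x \<partial>N) - (kop P ^^ n) \<phi> z\<bar> \<le> c * A * \<rho> ^ n * (d + W z)"
proof -
  interpret N: prob_space N by (rule prob_algebraD [OF N(1)])
  have b\<phi>: "bmeas S \<phi>" using \<phi> by (rule bmeasI)
  note m = good_moment [OF N]
  have c: "0 \<le> c"
    using \<phi>(2) [OF goodD(1) [OF z]] by linarith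
  have int: "integrable N ((kop P ^^ n) \<phi>)"
    by (intro bmeas_integrable [OF bmeas_kop_funpow N(1)] b\<phi>)
  have "\<bar>(\<integral>x. (kop P ^^ n) \<phi> x \<partial>N) - (kop P ^^ n) \<phi> z\<bar> = \<bar>\<integral>x. (kop P ^^ n) \<phi> x - (kop P ^^ n) \<phi> z \<partial>N\<bar>"
    using int by (simp add: N.prob_space)
  also have "\<dots> \<le> (\<integral>x. \<bar>(kop P ^^ n) \<phi> x - (kop P ^^ n) \<phi> z\<bar> \<partial>N)"
    by (rule integral_abs_bound)
  also have "\<dots> \<le> (\<integral>x. c * A * \<rho> ^ n * (W x + W z) \<partial>N)"
    using int m(2)
    by (intro integral_mono_AE eventually_mono [OF m(1)] contraction_scaled \<phi> z) auto
  also have "\<dots> = c * A * \<rho> ^ n * ((\<integral>x. W x \<partial>N) + W z)"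
    using m(2) by (simp add: N.prob_space)
  also have "\<dots> \<le> c * A * \<rho> ^ n * (d + W z)"
    using m(3) c A \<rho> by (intro mult_left_mono) auto
  finally show ?thesis .
qed

lemma moment_iterate:
  assumes N: "N \<in> space (prob_algebra S)" "(\<integral>\<^sup>+x. V x \<partial>N) \<le> ennreal d" "0 \<le> d"
  shows "(\<integral>\<^sup>+x. V x \<partial>(N \<bind> kernel_power S P n)) \<le> ennreal (d + B')"
proof -
  interpret N: prob_space N by (rule prob_algebraD [OF N(1)])
  have [measurable_cong]: "sets N = sets S" by (rule prob_algebraD [OF N(1)])
  have "(\<integral>\<^sup>+x. V x \<partial>(N \<bind> kernel_power S P n)) = (\<integral>\<^sup>+x. \<integral>\<^sup>+y. V y \<partial>kernel_power S P n x \<partial>N)"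
    by (intro nn_integral_bind [where B = S]) (auto intro: measurable_prob_algebraD)
  also have "\<dots> \<le> (\<integral>\<^sup>+x. V x + ennreal B' \<partial>N)"
  proof (rule nn_integral_mono)
    fix x assume "x \<in> space N"
    then have x: "x \<in> space S" using prob_algebraD [OF N(1)] by simp
    have "ennreal ((1 / \<kappa>) ^ n) * V x \<le> ennreal 1 * V x"
      using \<kappa> by (intro mult_right_mono ennreal_leI power_le_one) auto
    then show "(\<integral>\<^sup>+y. V y \<partial>kernel_power S P n x) \<le> V x + ennreal B'"
      using drift_iterate [OF x, of n] by (auto intro: order_trans add_right_mono)
  qed
  also have "\<dots> = (\<integral>\<^sup>+x. V x \<partial>N) + ennreal B'"
    by (simp add: nn_integral_add N.emeasure_space_1)
  also have "\<dots> \<le> ennreal d + ennreal B'"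
    by (intro add_right_mono N)
  finally show ?thesis
    using N(3) B'_nonneg by simp
qed

text \<open>Time 0 counts as a renewal: the condition is vacuous there, and the initial law obeys
  the same moment bound \<open>b\<close> as a step out of \<open>C\<close>.\<close>

definition renewal :: "nat \<Rightarrow> (nat \<Rightarrow> 'a) \<Rightarrow> bool" where
  "renewal k w \<longleftrightarrow> (\<forall>i. Suc i = k \<longrightarrow> w i \<in> C)"

lemma chain_step_moment:
  assumes "renewal k w"
  shows "(\<integral>\<^sup>+x. V x \<partial>chain_step P \<mu> k w) \<le> ennreal b"
proof (cases k)
  case 0
  then show ?thesis using initial_moment by (simp add: chain_step_def)
next
  case (Suc i)
  then have "(\<integral>\<^sup>+x. V x \<partial>chain_step P \<mu> k w) \<le> ennreal B"
    using assms drift_on by (simp add: chain_step_def renewal_def)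
  also have "\<dots> \<le> ennreal b"
    using b by (rule ennreal_leI)
  finally show ?thesis .
qed

text \<open>Since \<Delta> ignores the coordinates from \<open>k\<close> to \<open>l - 1\<close>,
  its conditional expectation at index \<open>l\<close> is a function of coordinate
  \<open>l - 1\<close> once the past is fixed. Its means are compared for two laws of coordinate
  \<open>j\<close>: a point mass in \<open>C\<close>, and the law given the past before
  \<open>k\<close>.\<close>

lemma cexp_tail_diff_le:
  assumes \<Delta>: "bmeas path_space \<Delta>" "\<And>w. w \<in> space path_space \<Longrightarrow> \<bar>\<Delta> w\<bar> \<le> c"
    and dep: "depends_on S ({..<k} \<union> {l..<n}) \<Delta>"
    and kj: "k \<le> j" "j < l" "l \<le> n"
    and w: "w \<in> space path_space" "w' \<in> space path_space" "\<And>i. i < k \<Longrightarrow> w' i = w i"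
    and ren: "renewal k w" "w' j \<in> C"
  shows "\<bar>cexp P \<mu> (Suc j) (n - Suc j) \<Delta> w' - cexp P \<mu> k (n - k) \<Delta> w\<bar> \<le> c * gap_const * \<rho> ^ (l - j)"
proof -
  define \<Phi> where "\<Phi> = cexp P \<mu> l (n - l) \<Delta>"
  define \<phi> where "\<phi> x = \<Phi> (w(l - 1 := x))" for x
  have \<Phi>: "bmeas path_space \<Phi>" "\<And>w. w \<in> space path_space \<Longrightarrow> \<bar>\<Phi> w\<bar> \<le> c"
    unfolding \<Phi>_def using bmeas_cexp [OF \<Delta>(1)] cexp_abs_le [OF \<Delta>] by auto
  have "depends_on S ({..<k} \<union> {i. Suc i = l}) \<Phi>"
    unfolding \<Phi>_def using dep kj by (intro depends_on_cexp) simp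
  then have dep\<Phi>: "depends_on S ({..<k} \<union> {l - 1}) \<Phi>"
    by (rule depends_on_mono) auto
  have \<phi>: "bmeas S \<phi>" "\<And>x. x \<in> space S \<Longrightarrow> \<bar>\<phi> x\<bar> \<le> c"
    unfolding \<phi>_def using bmeas_fun_upd [OF \<Phi>(1) w(1)] \<Phi>(2) fun_upd_path_space [OF w(1)] by auto
  have c: "0 \<le> c"
    using \<Delta>(2) [OF w(1)] by linarith
  have \<Phi>_eq: "\<Phi> v = \<phi> (v (l - 1))" if v: "v \<in> space path_space" "\<And>i. i < k \<Longrightarrow> v i = w i" for v
    unfolding \<phi>_def
  proof (rule depends_onD [OF dep\<Phi> v(1)])
    show "w(l - 1 := v (l - 1)) \<in> space path_space"
      using v(1) w(1) by (simp add: path_space_iff)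
  qed (use v kj in auto)
  define a where "a = l - Suc j"
  have idx: "n - Suc j = a + (n - l)" "Suc j + a = l" "l - 1 = j + a"
    using kj by (auto simp: a_def)
  have "cexp P \<mu> (Suc j) (n - Suc j) \<Delta> w' = cexp P \<mu> (Suc j) a \<Phi> w'"
    unfolding idx(1) cexp_add idx(2) \<Phi>_def ..
  also have "\<dots> = cexp P \<mu> (Suc j) a (\<lambda>v. \<phi> (v (j + a))) w'"
    using w kj by (intro cexp_cong) (auto simp: \<Phi>_eq idx(3) simp del: One_nat_def)
  also have "\<dots> = (kop P ^^ a) \<phi> (w' j)"
    by (rule cexp_coordinate [OF \<phi>(1) w(2)])
  finally have left: "cexp P \<mu> (Suc j) (n - Suc j) \<Delta> w' = (kop P ^^ a) \<phi> (w' j)" .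
  define d where "d = (j - k) + a"
  have idx': "n - k = Suc d + (n - l)" "k + Suc d = l" "l - 1 = k + d"
    using kj by (auto simp: d_def a_def)
  let ?N = "chain_step P \<mu> k w"
  note N = chain_step_space [OF w(1), of k]
  have "cexp P \<mu> k (n - k) \<Delta> w = cexp P \<mu> k (Suc d) \<Phi> w"
    unfolding idx'(1) cexp_add idx'(2) \<Phi>_def ..
  also have "\<dots> = cexp P \<mu> k (Suc d) (\<lambda>v. \<phi> (v (k + d))) w"
    using w kj by (intro cexp_cong) (auto simp: \<Phi>_eq idx'(3) simp del: One_nat_def)
  also have "\<dots> = (\<integral>y. (kop P ^^ d) \<phi> y \<partial>?N)"
    unfolding cexp.simps
  proof (intro Bochner_Integration.integral_cong refl)
    fix y assume "y \<in> space ?N"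
    then have y: "y \<in> space S" using prob_algebraD [OF N] by simp
    show "cexp P \<mu> (Suc k) d (\<lambda>v. \<phi> (v (k + d))) (w(k := y)) = (kop P ^^ d) \<phi> y"
      using cexp_coordinate [OF \<phi>(1), of "w(k := y)" k d] fun_upd_path_space [OF w(1) y, of k]
      by (simp add: fun_upd_same del: fun_upd_apply)
  qed
  \<comment> \<open>The first \<open>j - k\<close> steps move into the law, so that both sides have
    the same number \<open>a\<close> of steps left.\<close>
  also have "\<dots> = (\<integral>y. (kop P ^^ a) \<phi> y \<partial>(?N \<bind> kernel_power S P (j - k)))"
  proof -
    have "(\<integral>y. (kop P ^^ a) \<phi> y \<partial>(?N \<bind> kernel_power S P (j - k)))
        = (\<integral>x. \<integral>y. (kop P ^^ a) \<phi> y \<partial>kernel_power S P (j - k) x \<partial>?N)"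
      by (rule integral_bind_bmeas [OF N kernel_power_measurable bmeas_kop_funpow [OF \<phi>(1)]])
    also have "\<dots> = (\<integral>x. (kop P ^^ (j - k)) ((kop P ^^ a) \<phi>) x \<partial>?N)"
      using prob_algebraD [OF N]
      by (intro Bochner_Integration.integral_cong refl integral_kernel_power bmeas_kop_funpow \<phi>) auto
    finally show ?thesis
      by (simp add: d_def funpow_add)
  qed
  finally have right: "cexp P \<mu> k (n - k) \<Delta> w = (\<integral>y. (kop P ^^ a) \<phi> y \<partial>(?N \<bind> kernel_power S P (j - k)))" .
  have NK: "?N \<bind> kernel_power S P (j - k) \<in> space (prob_algebra S)"
    using measurable_bind_prob_space [of "\<lambda>_. ?N" "count_space UNIV" S "kernel_power S P (j - k)" S] N
      kernel_power_measurable by (auto dest!: measurable_space)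
  have "\<bar>(\<integral>y. (kop P ^^ a) \<phi> y \<partial>(?N \<bind> kernel_power S P (j - k))) - (kop P ^^ a) \<phi> (w' j)\<bar>
      \<le> c * A * \<rho> ^ a * ((b + B') + W (w' j))"
    using b_nonneg B'_nonneg
    by (intro contraction_integral bmeas_measurable \<phi> C_good ren NK moment_iterate N chain_step_moment) auto
  also have "\<dots> = c * \<rho> ^ a * (A * (b + B' + 1))"
    by (simp add: W_C [OF ren(2)])
  also have "\<dots> \<le> c * \<rho> ^ a * (gap_const * \<rho>)"
    using gap_const_ge c \<rho> by (intro mult_left_mono) auto
  also have "\<dots> = c * gap_const * \<rho> ^ (l - j)"
  proof -
    have "l - j = Suc a" using kj by (simp add: a_def)
    then show ?thesis by simp
  qed
  finally show ?thesis
    unfolding left right by (simp add: abs_minus_commute)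
qed

text \<open>
  Freezing the coordinates one after the other writes \<open>f\<close> as a sum of functions of the future, so
  that the contraction in total variation suffices and no coupling of trajectories is needed.
\<close>

lemma cexp_diff_le:
  assumes f: "bmeas path_space f" "depends_on S {..<n} f" "influence n L f"
    and kj: "k \<le> j" "j < n"
    and w: "w \<in> space path_space" "w' \<in> space path_space" "\<And>i. i < k \<Longrightarrow> w' i = w i"
    and ren: "renewal k w" "w' j \<in> C \<or> Suc j = n"
  shows "\<bar>cexp P \<mu> (Suc j) (n - Suc j) f w' - cexp P \<mu> k (n - k) f w\<bar>
    \<le> gap_const * (\<Sum>l\<in>{k..<n}. L l * \<rho> ^ (l - j))"
proof -
  have z: "w 0 \<in> space S" using w(1) by (simp add: path_space_iff)
  \<comment> \<open>\<open>F k\<close> is \<open>f\<close>, and \<open>F n\<close> depends on the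
    past before \<open>k\<close> only, where both trajectories agree; the differences are telescoped
    from \<open>n\<close> down to \<open>k\<close>.\<close>
  define F where "F p v = f (freeze (w 0) {k..<p} v)" for p v
  define g where "g p = cexp P \<mu> (Suc j) (n - Suc j) (F p) w' - cexp P \<mu> k (n - k) (F p) w" for p
  have F: "bmeas path_space (F p)" for p
    unfolding F_def by (intro bmeas_freeze f z)
  have "\<bar>g p\<bar> \<le> gap_const * (\<Sum>l\<in>{p..<n}. L l * \<rho> ^ (l - j))" if "k \<le> p" "p \<le> n" for p
    using that(2,1)
  proof (induction p rule: inc_induct)
    case base
    have eq: "F n v = F n w" if v: "v \<in> space path_space" "\<And>i. i < k \<Longrightarrow> v i = w i" for v
      unfolding F_def using v(2)
      by (intro depends_onD [OF f(2)] freeze_path_space z v w) (auto simp: freeze_def)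
    have "cexp P \<mu> (Suc j) (n - Suc j) (F n) w' = cexp P \<mu> (Suc j) (n - Suc j) (\<lambda>_. F n w) w'"
      using w kj by (intro cexp_cong eq) auto
    moreover have "cexp P \<mu> k (n - k) (F n) w = cexp P \<mu> k (n - k) (\<lambda>_. F n w) w"
      using w by (intro cexp_cong eq) auto
    ultimately show ?case
      by (simp add: g_def cexp_const w)
  next
    case (step p)
    define \<Delta> where "\<Delta> v = F p v - F (Suc p) v" for v
    have fz: "freeze (w 0) {k..<Suc p} v = (freeze (w 0) {k..<p} v)(p := w 0)" for v
      using step.prems by (simp add: atLeastLessThanSuc freeze_insert)
    have \<Delta>: "bmeas path_space \<Delta>"
      unfolding \<Delta>_def by (intro bmeas_diff F)
    have \<Delta>_le: "\<bar>\<Delta> v\<bar> \<le> L p" if "v \<in> space path_space" for v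
      unfolding \<Delta>_def F_def fz using step.hyps
      by (intro influenceD [OF f(3)] freeze_path_space z that)
    have Lp: "0 \<le> L p" using \<Delta>_le [OF w(1)] by linarith
    have split: "g p - g (Suc p) = cexp P \<mu> (Suc j) (n - Suc j) \<Delta> w' - cexp P \<mu> k (n - k) \<Delta> w"
      unfolding g_def \<Delta>_def cexp_diff [OF F F w(1)] cexp_diff [OF F F w(2)] by simp
    have "\<bar>g p - g (Suc p)\<bar> \<le> L p * gap_const * \<rho> ^ (p - j)"
    proof (cases "p \<le> j")
      case True
      \<comment> \<open>Here \<open>p - j\<close> truncates to 0, so the trivial bound already has
        the required form.\<close>
      have "\<bar>g p - g (Suc p)\<bar> \<le> 2 * L p"
        unfolding split using cexp_abs_le [OF \<Delta> \<Delta>_le w(2), of "Suc j" "n - Suc j"]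
          cexp_abs_le [OF \<Delta> \<Delta>_le w(1), of k "n - k"] by simp
      also have "\<dots> \<le> gap_const * L p"
        using gap_const_ge(1) Lp by (intro mult_right_mono) auto
      finally show ?thesis
        using True by (simp add: mult_ac)
    next
      case False
      have "depends_on S ({..<k} \<union> {p..<n}) \<Delta>"
      proof (rule depends_onI)
        fix v v' assume v: "v \<in> space path_space" "v' \<in> space path_space"
          and eq: "\<And>i. i \<in> {..<k} \<union> {p..<n} \<Longrightarrow> v i = v' i"
        have "F q v = F q v'" if "p \<le> q" for q
          unfolding F_def using that eq
          by (intro depends_onD [OF f(2)] freeze_path_space z v) (auto simp: freeze_def)
        then show "\<Delta> v = \<Delta> v'"
          by (simp add: \<Delta>_def)
      qed
      \<comment> \<open>For \<open>Suc j = n\<close> there is no \<open>p\<close> with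
        \<open>j < p < n\<close>, so \<open>w' j\<close> lies in \<open>C\<close> in this
        case.\<close>
      then show ?thesis
        unfolding split using False kj step.hyps ren w \<Delta>_le
        by (intro cexp_tail_diff_le \<Delta>) auto
    qed
    moreover have "\<bar>g (Suc p)\<bar> \<le> gap_const * (\<Sum>l\<in>{Suc p..<n}. L l * \<rho> ^ (l - j))"
      using step by simp
    moreover have "(\<Sum>l\<in>{p..<n}. L l * \<rho> ^ (l - j)) = L p * \<rho> ^ (p - j) + (\<Sum>l\<in>{Suc p..<n}. L l * \<rho> ^ (l - j))"
      using step.hyps by (simp add: sum.atLeast_Suc_lessThan)
    ultimately show ?case
      by (simp add: distrib_left mult_ac)
  qed
  moreover have "F k = f"
    by (simp add: F_def freeze_def fun_eq_iff)
  ultimately show ?thesis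
    using kj by (fastforce simp: g_def)
qed

end

section \<open>Induction over the excursions away from \<open>C\<close>\<close>

context contracting_chain
begin

text \<open>The part of the bound in \<open>deviation_le\<close> that does not grow with the length
  of the excursion.\<close>

definition "excursion_const \<epsilon> = gap_const\<^sup>2 * exp (gap_const * \<epsilon> / (1 - \<rho>))"

context
  fixes n :: nat and L :: "nat \<Rightarrow> real" and f :: "(nat \<Rightarrow> 'a) \<Rightarrow> real" and \<epsilon> :: real
  assumes f: "bmeas path_space f" "depends_on S {..<n} f" "influence n L f"
    and \<epsilon>: "exp (gap_const * \<epsilon>) * \<rho>\<^sup>2 \<le> 1" "1 \<le> \<kappa> * \<rho> ^ 4"
    and L: "\<And>i. i < n \<Longrightarrow> 0 \<le> L i" "\<And>i. i < n \<Longrightarrow> L i \<le> \<epsilon>"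
begin

abbreviation "c \<equiv> excursion_const \<epsilon>"

definition "tail_weight k = (\<Sum>l\<in>{k..<n}. L l * \<rho> ^ (l - k))"

definition "energy k = (\<Sum>i\<in>{k..<n}. (tail_weight i)\<^sup>2)"

abbreviation "G k \<equiv> cexp P \<mu> k (n - k) (\<lambda>w. exp (f w))"

abbreviation "g k \<equiv> cexp P \<mu> k (n - k) f"

lemma c_nonneg: "0 \<le> c"
  by (simp add: excursion_const_def)

lemma energy_mono: "k \<le> j \<Longrightarrow> energy j \<le> energy k"
  unfolding energy_def by (intro sum_mono2) auto

lemma energy_Suc: "k < n \<Longrightarrow> energy k = (tail_weight k)\<^sup>2 + energy (Suc k)"
  unfolding energy_def by (simp add: sum.atLeast_Suc_lessThan)

lemma cexp_unfold:
  assumes "k < n"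
  shows "cexp P \<mu> k (n - k) h w = (\<integral>y. cexp P \<mu> (Suc k) (n - Suc k) h (w(k := y)) \<partial>chain_step P \<mu> k w)"
proof -
  have "n - k = Suc (n - Suc k)" using assms by simp
  then show ?thesis by (simp only: cexp.simps)
qed

text \<open>With \<open>q = j - k\<close>, discounting from \<open>j\<close> instead of
  \<open>k\<close> costs \<open>\<rho> ^ (- q)\<close>, squared in the quadratic term, and the
  exponential costs \<open>exp (gap_const * \<epsilon>) ^ q\<close>. The conditions on \<epsilon>
  and \<rho> bound the product by \<open>\<kappa> ^ q\<close>.\<close>

lemma deviation_le:
  assumes kj: "k \<le> j" "j < n" and d: "\<bar>d\<bar> \<le> gap_const * (\<Sum>l\<in>{k..<n}. L l * \<rho> ^ (l - j))"
  shows "d\<^sup>2 * exp \<bar>d\<bar> \<le> c * (tail_weight k)\<^sup>2 * \<kappa> ^ (j - k)"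
proof -
  have \<epsilon>0: "0 \<le> \<epsilon>"
    using L [OF kj(2)] by linarith
  have E0: "0 \<le> gap_const" using gap_const_ge by simp
  define q where "q = j - k"
  define v where "v = (\<Sum>l\<in>{k..<n}. L l * \<rho> ^ (l - j))"
  have v0: "0 \<le> v"
    unfolding v_def using L \<rho> by (intro sum_nonneg mult_nonneg_nonneg) auto
  have "\<rho> ^ q * v = (\<Sum>l\<in>{k..<n}. L l * \<rho> ^ ((l - j) + q))"
    by (simp add: v_def sum_distrib_left power_add mult_ac)
  also have "\<dots> \<le> tail_weight k"
    unfolding tail_weight_def using L \<rho> kj
    by (intro sum_mono mult_left_mono power_decreasing) (auto simp: q_def)
  finally have vu: "\<rho> ^ q * v \<le> tail_weight k" .
  have "v \<le> (\<Sum>l\<in>{k..<n}. \<epsilon> * \<rho> ^ (l - j))"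
    unfolding v_def using L \<rho> by (intro sum_mono mult_right_mono) auto
  also have "\<dots> \<le> \<epsilon> * (real q + 1 / (1 - \<rho>))"
    unfolding sum_distrib_left [symmetric] q_def using \<epsilon>0 \<rho> kj
    by (intro mult_left_mono sum_power_diff_le) auto
  finally have "gap_const * v \<le> gap_const * (\<epsilon> * (real q + 1 / (1 - \<rho>)))"
    using E0 by (rule mult_left_mono)
  then have "\<bar>d\<bar> \<le> real q * (gap_const * \<epsilon>) + gap_const * \<epsilon> / (1 - \<rho>)"
    using d by (simp add: v_def algebra_simps)
  then have "exp \<bar>d\<bar> \<le> exp (real q * (gap_const * \<epsilon>) + gap_const * \<epsilon> / (1 - \<rho>))"
    by simp
  also have "\<dots> = exp (gap_const * \<epsilon>) ^ q * exp (gap_const * \<epsilon> / (1 - \<rho>))"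
    by (simp add: exp_add exp_of_nat_mult)
  finally have e: "exp \<bar>d\<bar> \<le> exp (gap_const * \<epsilon>) ^ q * exp (gap_const * \<epsilon> / (1 - \<rho>))" .
  have "d\<^sup>2 \<le> (gap_const * v)\<^sup>2"
    using d by (simp add: v_def abs_le_square_iff [symmetric])
  then have "d\<^sup>2 * exp \<bar>d\<bar> \<le> (gap_const * v)\<^sup>2 * (exp (gap_const * \<epsilon>) ^ q * exp (gap_const * \<epsilon> / (1 - \<rho>)))"
    using e by (intro mult_mono) auto
  also have "\<dots> = c * v\<^sup>2 * exp (gap_const * \<epsilon>) ^ q"
    by (simp add: excursion_const_def power_mult_distrib mult_ac)
  also have "\<dots> \<le> c * v\<^sup>2 * (\<rho> ^ (2 * q) * \<kappa> ^ q)"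
  proof (intro mult_left_mono)
    \<comment> \<open>One factor \<open>\<rho>\<^sup>2\<close> of \<open>\<rho> ^ 4\<close> tames
      the exponential; the other is kept to pass from \<open>v\<^sup>2\<close> to the squared tail
      weight.\<close>
    have "exp (gap_const * \<epsilon>) \<le> exp (gap_const * \<epsilon>) * (\<kappa> * \<rho> ^ 4)"
      using \<epsilon>(2) mult_left_mono [of 1 "\<kappa> * \<rho> ^ 4" "exp (gap_const * \<epsilon>)"] by simp
    also have "\<dots> = (exp (gap_const * \<epsilon>) * \<rho>\<^sup>2) * (\<rho>\<^sup>2 * \<kappa>)"
      by (simp add: power2_eq_square eval_nat_numeral)
    also have "\<dots> \<le> 1 * (\<rho>\<^sup>2 * \<kappa>)"
      using \<epsilon>(1) \<kappa> by (intro mult_right_mono) auto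
    finally have "exp (gap_const * \<epsilon>) ^ q \<le> (\<rho>\<^sup>2 * \<kappa>) ^ q"
      by (intro power_mono) auto
    then show "exp (gap_const * \<epsilon>) ^ q \<le> \<rho> ^ (2 * q) * \<kappa> ^ q"
      by (simp add: power_mult_distrib power_mult)
  qed (use c_nonneg in auto)
  also have "\<dots> = c * \<kappa> ^ q * (\<rho> ^ q * v)\<^sup>2"
    by (simp add: power_mult_distrib power_mult power2_eq_square mult_ac)
  also have "\<dots> \<le> c * \<kappa> ^ q * (tail_weight k)\<^sup>2"
    using vu v0 \<rho> c_nonneg \<kappa> by (intro mult_left_mono power_mono) auto
  finally show ?thesis
    by (simp add: q_def mult_ac)
qed

text \<open>
  Between two visits to \<open>C\<close> the exponential is linearised around its conditional mean at the
  first visit. The linear term is a martingale and the quadratic error is carried by the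
  Lyapunov function, which compensates for the factor \<open>\<kappa>\<close> per step away from \<open>C\<close>.
\<close>

lemma excursion_bound:
  assumes IH: "\<And>j w. k < j \<Longrightarrow> j \<le> n \<Longrightarrow> w \<in> space path_space \<Longrightarrow> renewal j w \<Longrightarrow> G j w \<le> exp (g j w + c * b * energy j)"
    and w: "w \<in> space path_space" "renewal k w"
    and kj: "k \<le> j" "j < n"
    and w': "w' \<in> space path_space" "\<And>i. i < k \<Longrightarrow> w' i = w i" "w' j \<in> good"
  shows "G (Suc j) w' \<le> exp (g k w + c * b * energy (Suc k)) *
           (1 + (g (Suc j) w' - g k w) + c * (tail_weight k)\<^sup>2 * \<kappa> ^ (j - k) * W (w' j))"
  using kj w'
proof (induction "n - j" arbitrary: j w' rule: less_induct)
  case less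
  define r where "r = g k w"
  define e where "e = exp (r + c * b * energy (Suc k))"
  show ?case
  proof (cases "w' j \<in> C \<or> Suc j = n")
    case True
    \<comment> \<open>The excursion ends here: either \<open>w' j\<close> is in \<open>C\<close>, so
      that \<open>Suc j\<close> is a renewal and the outer hypothesis applies, or the horizon is
      reached and \<open>G\<close> is \<open>exp\<close> of \<open>f\<close> itself.\<close>
    define d where "d = g (Suc j) w' - r"
    have "\<bar>d\<bar> \<le> gap_const * (\<Sum>l\<in>{k..<n}. L l * \<rho> ^ (l - j))"
      unfolding d_def r_def using less.prems w True by (intro cexp_diff_le f) auto
    then have d: "d\<^sup>2 * exp \<bar>d\<bar> \<le> c * (tail_weight k)\<^sup>2 * \<kappa> ^ (j - k)"
      using less.prems by (intro deviation_le)
    have "G (Suc j) w' \<le> exp (g (Suc j) w' + c * b * energy (Suc j))"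
    proof (cases "Suc j = n")
      case True
      have "0 \<le> c * b * energy (Suc j)"
        unfolding energy_def using c_nonneg b_nonneg by (intro mult_nonneg_nonneg sum_nonneg) auto
      with True show ?thesis by simp
    next
      case False
      with True less.prems show ?thesis
        by (intro IH) (auto simp: renewal_def)
    qed
    also have "\<dots> \<le> exp (g (Suc j) w' + c * b * energy (Suc k))"
      using energy_mono [of "Suc k" "Suc j"] less.prems c_nonneg b_nonneg by (simp add: mult_left_mono)
    also have "\<dots> = e * exp d"
      by (simp add: e_def d_def exp_add [symmetric] algebra_simps)
    also have "\<dots> \<le> e * (1 + d + c * (tail_weight k)\<^sup>2 * \<kappa> ^ (j - k) * W (w' j))"
    proof (intro mult_left_mono)
      have "c * (tail_weight k)\<^sup>2 * \<kappa> ^ (j - k) * 1 \<le> c * (tail_weight k)\<^sup>2 * \<kappa> ^ (j - k) * W (w' j)"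
        using W_ge_1 [OF less.prems(5)] c_nonneg \<kappa> by (intro mult_left_mono) auto
      then show "exp d \<le> 1 + d + c * (tail_weight k)\<^sup>2 * \<kappa> ^ (j - k) * W (w' j)"
        using exp_le_quadratic [of d] d by simp
    qed (simp add: e_def)
    finally show ?thesis
      by (simp add: d_def e_def r_def)
  next
    case False
    then have j: "Suc j < n" "w' j \<notin> C"
      using less.prems by auto
    \<comment> \<open>One more step brings one more power of \<kappa>, which the drift offsets by
      dividing the mean of \<open>W\<close> by \<kappa>; so the bound keeps its form.\<close>
    define q where "q = c * (tail_weight k)\<^sup>2 * \<kappa> ^ (Suc j - k)"
    have q: "0 \<le> q"
      using c_nonneg \<kappa> by (simp add: q_def)
    have step: "chain_step P \<mu> (Suc j) w' = P (w' j)"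
      by (simp add: chain_step_def)
    interpret Pj: prob_space "P (w' j)"
      by (rule prob_algebraD [OF kernel_space [OF goodD(1) [OF less.prems(5)]]])
    note Psp = prob_algebraD(3) [OF kernel_space [OF goodD(1) [OF less.prems(5)]]]
    note off = good_off [OF less.prems(5) j(2)]
    have int: "integrable (P (w' j)) (\<lambda>y. cexp P \<mu> i d h (w'(Suc j := y)))"
      if "bmeas path_space h" for i d h
      using cexp_step_integrable [OF that less.prems(3), of "Suc j"] by (simp add: step)
    have "G (Suc j) w' = (\<integral>y. G (Suc (Suc j)) (w'(Suc j := y)) \<partial>P (w' j))"
      by (simp only: cexp_unfold [OF j(1)] step)
    also have "\<dots> \<le> (\<integral>y. e * (1 + (g (Suc (Suc j)) (w'(Suc j := y)) - r) + q * W y) \<partial>P (w' j))"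
    proof (rule integral_mono_AE)
      show "AE y in P (w' j). G (Suc (Suc j)) (w'(Suc j := y))
          \<le> e * (1 + (g (Suc (Suc j)) (w'(Suc j := y)) - r) + q * W y)"
        using off(1)
      proof eventually_elim
        case (elim y)
        have "G (Suc (Suc j)) (w'(Suc j := y)) \<le> exp (g k w + c * b * energy (Suc k)) *
           (1 + (g (Suc (Suc j)) (w'(Suc j := y)) - g k w) + c * (tail_weight k)\<^sup>2 * \<kappa> ^ (Suc j - k) * W ((w'(Suc j := y)) (Suc j)))"
        proof (rule less.hyps)
          show "w'(Suc j := y) \<in> space path_space"
            by (rule fun_upd_path_space [OF less.prems(3) goodD(1) [OF elim]])
        qed (use less.prems j elim in auto)
        then show ?case
          by (simp add: e_def r_def q_def fun_upd_same del: fun_upd_apply)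
      qed
    qed (use off(2) int f(1) in \<open>auto intro!: bmeas_exp\<close>)
    also have "\<dots> = e * (1 + ((\<integral>y. g (Suc (Suc j)) (w'(Suc j := y)) \<partial>P (w' j)) - r) + q * (\<integral>y. W y \<partial>P (w' j)))"
      using off(2) int [OF f(1)] by (simp add: Pj.prob_space)
    also have "\<dots> = e * (1 + (g (Suc j) w' - r) + q * (\<integral>y. W y \<partial>P (w' j)))"
      by (simp only: cexp_unfold [OF j(1)] step)
    also have "\<dots> \<le> e * (1 + (g (Suc j) w' - r) + q * (W (w' j) / \<kappa>))"
      using off(3) q by (intro mult_left_mono add_left_mono) (auto simp: e_def)
    also have "q * (W (w' j) / \<kappa>) = c * (tail_weight k)\<^sup>2 * \<kappa> ^ (j - k) * W (w' j)"
      using \<kappa> less.prems by (simp add: q_def Suc_diff_le)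
    finally show ?thesis
      by (simp add: e_def r_def)
  qed
qed

text \<open>Backward induction: later renewals feed \<open>excursion_bound\<close>, used at
  \<open>j = k\<close>. Integrating over coordinate \<open>k\<close> kills the linear term, since
  \<open>g\<close> is a martingale, and bounds the mean of \<open>W\<close> by \<open>b\<close>;
  then \<open>1 + x \<le> exp x\<close> adds the share of \<open>k\<close> to the energy.\<close>

lemma cexp_exp_le:
  assumes "k \<le> n" "w \<in> space path_space" "renewal k w"
  shows "G k w \<le> exp (g k w + c * b * energy k)"
  using assms
proof (induction "n - k" arbitrary: k w rule: less_induct)
  case less
  show ?case
  proof (cases "k = n")
    case True
    then show ?thesis by (simp add: energy_def)
  next
    case False
    then have k: "k < n" using less.prems by simp
    let ?N = "chain_step P \<mu> k w"
    note N = chain_step_space [OF less.prems(2), of k]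
    interpret N: prob_space ?N by (rule prob_algebraD [OF N])
    note m = good_moment [OF N chain_step_moment [OF less.prems(3)] b_nonneg]
    define r where "r = g k w"
    define e where "e = exp (r + c * b * energy (Suc k))"
    have IH: "G j w \<le> exp (g j w + c * b * energy j)"
      if "k < j" "j \<le> n" "w \<in> space path_space" "renewal j w" for j w
      using that by (intro less.hyps) auto
    note int = cexp_step_integrable [OF _ less.prems(2), of _ k "Suc k"]
    have "G k w = (\<integral>y. G (Suc k) (w(k := y)) \<partial>?N)"
      by (rule cexp_unfold [OF k])
    also have "\<dots> \<le> (\<integral>y. e * (1 + (g (Suc k) (w(k := y)) - r) + c * (tail_weight k)\<^sup>2 * W y) \<partial>?N)"
    proof (rule integral_mono_AE)
      show "AE y in ?N. G (Suc k) (w(k := y)) \<le> e * (1 + (g (Suc k) (w(k := y)) - r) + c * (tail_weight k)\<^sup>2 * W y)"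
        using m(1)
      proof eventually_elim
        case (elim y)
        have "G (Suc k) (w(k := y)) \<le> exp (g k w + c * b * energy (Suc k)) *
           (1 + (g (Suc k) (w(k := y)) - g k w) + c * (tail_weight k)\<^sup>2 * \<kappa> ^ (k - k) * W ((w(k := y)) k))"
        proof (rule excursion_bound [OF IH less.prems(2,3)])
          show "w(k := y) \<in> space path_space"
            by (rule fun_upd_path_space [OF less.prems(2) goodD(1) [OF elim]])
        qed (use k elim in auto)
        then show ?case
          by (simp add: e_def r_def fun_upd_same del: fun_upd_apply)
      qed
    qed (use m(2) int f(1) in \<open>auto intro!: bmeas_exp\<close>)
    also have "\<dots> = e * (1 + ((\<integral>y. g (Suc k) (w(k := y)) \<partial>?N) - r) + c * (tail_weight k)\<^sup>2 * (\<integral>y. W y \<partial>?N))"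
      using m(2) int [OF f(1)] by (simp add: N.prob_space)
    also have "\<dots> = e * (1 + c * (tail_weight k)\<^sup>2 * (\<integral>y. W y \<partial>?N))"
      unfolding cexp_unfold [OF k, symmetric] r_def by simp
    also have "\<dots> \<le> e * (1 + c * (tail_weight k)\<^sup>2 * b)"
      using m(3) c_nonneg by (intro mult_left_mono add_left_mono) (auto simp: e_def)
    also have "\<dots> \<le> e * exp (c * (tail_weight k)\<^sup>2 * b)"
      using exp_ge_add_one_self [of "c * (tail_weight k)\<^sup>2 * b"] by (intro mult_left_mono) (auto simp: e_def)
    also have "\<dots> = exp (g k w + c * b * energy k)"
      by (simp add: e_def r_def energy_Suc [OF k] exp_add [symmetric] algebra_simps)
    finally show ?thesis .
  qed
qed

text \<open>Cauchy-Schwarz with weights \<open>\<rho> ^ (l - k)\<close> and an exchange of sums;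
  each of the two geometric series contributes a factor \<open>1 / (1 - \<rho>)\<close>.\<close>

lemma energy_le: "energy 0 \<le> (\<Sum>i<n. (L i)\<^sup>2) / (1 - \<rho>)\<^sup>2"
proof -
  have geo: "(\<Sum>l\<in>{k..<n}. \<rho> ^ (l - k)) \<le> 1 / (1 - \<rho>)" for k
    using sum_power_diff_le [of \<rho> k k n] \<rho> by simp
  have geo': "(\<Sum>k\<in>{..<Suc l}. \<rho> ^ (l - k)) \<le> 1 / (1 - \<rho>)" for l
  proof -
    have "(\<Sum>k\<in>{..<Suc l}. \<rho> ^ (l - k)) = (\<Sum>i\<in>{0..<Suc l}. \<rho> ^ (i - 0))"
      by (rule sum.reindex_bij_witness [of _ "\<lambda>i. l - i" "\<lambda>k. l - k"]) auto
    also have "\<dots> \<le> real (0 - 0) + 1 / (1 - \<rho>)"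
      using \<rho> by (intro sum_power_diff_le) auto
    finally show ?thesis
      by simp
  qed
  have "(tail_weight k)\<^sup>2 \<le> 1 / (1 - \<rho>) * (\<Sum>l\<in>{k..<n}. \<rho> ^ (l - k) * (L l)\<^sup>2)" for k
  proof -
    have "(tail_weight k)\<^sup>2 = (\<Sum>l\<in>{k..<n}. sqrt (\<rho> ^ (l - k)) * (sqrt (\<rho> ^ (l - k)) * L l))\<^sup>2"
    proof -
      have "L l * x = sqrt x * (sqrt x * L l)" if "0 \<le> x" for l x
        using that by (simp flip: mult.assoc)
      then show ?thesis
        unfolding tail_weight_def using \<rho> by (intro arg_cong [where f = "\<lambda>x. x\<^sup>2"] sum.cong) auto
    qed
    also have "\<dots> \<le> (\<Sum>l\<in>{k..<n}. (sqrt (\<rho> ^ (l - k)))\<^sup>2) * (\<Sum>l\<in>{k..<n}. (sqrt (\<rho> ^ (l - k)) * L l)\<^sup>2)"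
      by (rule Cauchy_Schwarz_ineq_sum)
    also have "\<dots> = (\<Sum>l\<in>{k..<n}. \<rho> ^ (l - k)) * (\<Sum>l\<in>{k..<n}. \<rho> ^ (l - k) * (L l)\<^sup>2)"
      using \<rho> by (simp add: power_mult_distrib)
    also have "\<dots> \<le> 1 / (1 - \<rho>) * (\<Sum>l\<in>{k..<n}. \<rho> ^ (l - k) * (L l)\<^sup>2)"
      using \<rho> by (intro mult_right_mono geo sum_nonneg) auto
    finally show ?thesis .
  qed
  then have "energy 0 \<le> (\<Sum>k\<in>{0..<n}. 1 / (1 - \<rho>) * (\<Sum>l\<in>{k..<n}. \<rho> ^ (l - k) * (L l)\<^sup>2))"
    unfolding energy_def by (intro sum_mono)
  also have "\<dots> = 1 / (1 - \<rho>) * (\<Sum>k\<in>{..<n}. \<Sum>l\<in>{l\<in>{..<n}. k < Suc l}. \<rho> ^ (l - k) * (L l)\<^sup>2)"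
    unfolding sum_distrib_left [symmetric] 
    by (intro arg_cong2 [where f = "(*)"] sum.cong refl) (auto simp: lessThan_atLeast0)
  also have "\<dots> = 1 / (1 - \<rho>) * (\<Sum>l\<in>{..<n}. \<Sum>k\<in>{k\<in>{..<n}. k < Suc l}. \<rho> ^ (l - k) * (L l)\<^sup>2)"
    by (subst sum.swap_restrict) auto
  also have "\<dots> = 1 / (1 - \<rho>) * (\<Sum>l<n. (\<Sum>k\<in>{..<Suc l}. \<rho> ^ (l - k)) * (L l)\<^sup>2)"
    unfolding sum_distrib_right
    by (intro arg_cong2 [where f = "(*)"] sum.cong refl) auto
  also have "\<dots> \<le> 1 / (1 - \<rho>) * (\<Sum>l<n. 1 / (1 - \<rho>) * (L l)\<^sup>2)"
    using \<rho> by (intro mult_left_mono sum_mono mult_right_mono geo') auto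
  also have "\<dots> = (\<Sum>i<n. (L i)\<^sup>2) / (1 - \<rho>)\<^sup>2"
    by (simp add: sum_divide_distrib [symmetric] power2_eq_square)
  finally show ?thesis .
qed

lemma exp_moment_small:
  "(\<integral>w. exp (f w) \<partial>law) \<le> exp ((\<integral>w. f w \<partial>law) + c * b / (1 - \<rho>)\<^sup>2 * (\<Sum>i<n. (L i)\<^sup>2))"
proof -
  obtain z where z: "z \<in> space S"
    using prob_space.not_empty [OF prob_algebraD(1) [OF initial]] prob_algebraD [OF initial] by blast
  define w :: "nat \<Rightarrow> 'a" where "w = (\<lambda>_. z)"
  have w: "w \<in> space path_space" using z by (simp add: path_space_iff w_def)
  have "depends_on S {..<n} (\<lambda>w. exp (f w))"
    by (intro depends_onI arg_cong [where f = exp] depends_onD [OF f(2)])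
  then have "(\<integral>w. exp (f w) \<partial>law) = G 0 w"
    using integral_law [OF bmeas_exp [OF f(1)] _ w] by simp
  also have "\<dots> \<le> exp (g 0 w + c * b * energy 0)"
    by (rule cexp_exp_le) (auto simp: renewal_def w)
  also have "g 0 w = (\<integral>w. f w \<partial>law)"
    using integral_law [OF f(1,2) w] by simp
  also have "exp ((\<integral>w. f w \<partial>law) + c * b * energy 0)
      \<le> exp ((\<integral>w. f w \<partial>law) + c * b * ((\<Sum>i<n. (L i)\<^sup>2) / (1 - \<rho>)\<^sup>2))"
    using energy_le c_nonneg b_nonneg by (intro iffD2 [OF exp_le_cancel_iff] add_left_mono mult_left_mono) auto
  finally show ?thesis
    by simp
qed

end

end

subsection \<open>Concentration\<close>

lemma (in prob_space) subgaussian_upper_tail: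
  fixes f :: "'a \<Rightarrow> real"
  assumes mgf: "\<And>l. 0 < l \<Longrightarrow> expectation (\<lambda>x. exp (l * f x)) \<le> exp (l * expectation f + l\<^sup>2 * v)"
    and int: "\<And>l. 0 < l \<Longrightarrow> integrable M (\<lambda>x. exp (l * f x))" and f: "f \<in> borel_measurable M"
    and t: "0 < t" and v: "0 < v"
  shows "prob {x\<in>space M. t < f x - expectation f} \<le> exp (- (t\<^sup>2 / (4 * v)))"
proof -
  \<comment> \<open>The minimiser of \<open>l\<^sup>2 * v - l * t\<close>.\<close>
  define l where "l = t / (2 * v)"
  have l: "0 < l" using t v by (simp add: l_def)
  have "prob {x\<in>space M. t < f x - expectation f}
      \<le> prob {x\<in>space M. exp (l * (expectation f + t)) \<le> exp (l * f x)}"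
    using f l by (intro finite_measure_mono) (auto simp: mult_le_cancel_left_pos)
  also have "\<dots> \<le> expectation (\<lambda>x. exp (l * f x)) / exp (l * (expectation f + t))"
    by (rule integral_Markov_inequality_measure [OF int [OF l], where A = "{}"]) auto
  also have "\<dots> \<le> exp (l * expectation f + l\<^sup>2 * v) / exp (l * (expectation f + t))"
    using mgf [OF l] by (intro divide_right_mono) auto
  also have "\<dots> = exp (l\<^sup>2 * v - l * t)"
    by (simp add: exp_diff [symmetric] algebra_simps)
  also have "l\<^sup>2 * v - l * t = - (t\<^sup>2 / (4 * v))"
    using v by (simp add: l_def power2_eq_square field_simps)
  finally show ?thesis .
qed

lemma (in prob_space) subgaussian_tail:
  fixes f :: "'a \<Rightarrow> real"
  assumes mgf: "\<And>l. expectation (\<lambda>x. exp (l * f x)) \<le> exp (l * expectation f + l\<^sup>2 * v)"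
    and int: "\<And>l. integrable M (\<lambda>x. exp (l * f x))" and f: "f \<in> borel_measurable M"
    and t: "0 < t" and v: "0 < v"
  shows "prob {x\<in>space M. t < \<bar>f x - expectation f\<bar>} \<le> 2 * exp (- (t\<^sup>2 / (4 * v)))"
proof -
  have "prob {x\<in>space M. t < \<bar>f x - expectation f\<bar>}
      \<le> prob ({x\<in>space M. t < f x - expectation f} \<union> {x\<in>space M. t < - f x - expectation (\<lambda>x. - f x)})"
    using f by (intro finite_measure_mono) auto
  also have "\<dots> \<le> prob {x\<in>space M. t < f x - expectation f} + prob {x\<in>space M. t < - f x - expectation (\<lambda>x. - f x)}"
    using f by (intro measure_Un_le) auto
  also have "\<dots> \<le> exp (- (t\<^sup>2 / (4 * v))) + exp (- (t\<^sup>2 / (4 * v)))"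
    using mgf [of "- l" for l] int [of "- l" for l] f
    by (intro add_mono subgaussian_upper_tail mgf int f t v) auto
  finally show ?thesis by simp
qed

context contracting_chain
begin

text \<open>Freezing costs the sum of squares over \<epsilon> twice, once inside the exponential and
  once in the mean; hence the 2.\<close>

definition "mgf_const \<epsilon> = excursion_const \<epsilon> * b / (1 - \<rho>)\<^sup>2 + 2 / \<epsilon>"

lemma mgf_const_pos: "0 < \<epsilon> \<Longrightarrow> 0 < mgf_const \<epsilon>"
  using b_nonneg by (auto simp: mgf_const_def excursion_const_def intro!: add_nonneg_pos)

text \<open>
  Excursions have exponential tails only, so large \<open>L i\<close> cannot be treated by the martingale
  argument. Freezing the corresponding coordinates costs \<open>L i \<le> (L i)\<^sup>2 / \<epsilon>\<close>.
\<close>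

lemma exp_moment:
  assumes f: "bmeas path_space f" "depends_on S {..<n} f" "influence n L f"
    and \<epsilon>: "0 < \<epsilon>" "exp (gap_const * \<epsilon>) * \<rho>\<^sup>2 \<le> 1" "1 \<le> \<kappa> * \<rho> ^ 4"
    and L: "\<And>i. i < n \<Longrightarrow> 0 \<le> L i"
  shows "(\<integral>w. exp (f w) \<partial>law) \<le> exp ((\<integral>w. f w \<partial>law) + mgf_const \<epsilon> * (\<Sum>i<n. (L i)\<^sup>2))"
proof -
  interpret law: prob_space law by (rule prob_algebraD [OF law_space])
  obtain z where z: "z \<in> space S"
    using prob_space.not_empty [OF prob_algebraD(1) [OF initial]] prob_algebraD [OF initial] by blast
  define J where "J = {i\<in>{..<n}. \<epsilon> < L i}"
  define f' where "f' w = f (freeze z J w)" for w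
  define L' where "L' i = (if \<epsilon> < L i then 0 else L i)" for i
  define v where "v = (\<Sum>i<n. (L i)\<^sup>2)"
  have f': "bmeas path_space f'"
    unfolding f'_def by (intro bmeas_freeze f z)
  have dep': "depends_on S {..<n} f'"
    unfolding f'_def
    by (intro depends_onI depends_onD [OF f(2)] freeze_path_space z) (auto simp: freeze_def)
  have inf': "influence n L' f'"
    unfolding influence_def
  proof (intro allI impI ballI)
    fix i w y assume i: "i < n" and w: "w \<in> space path_space" and y: "y \<in> space S"
    show "\<bar>f' w - f' (w(i := y))\<bar> \<le> L' i"
    proof (cases "\<epsilon> < L i")
      case True
      then have "freeze z J (w(i := y)) = freeze z J w"
        using i by (auto simp: freeze_def J_def fun_eq_iff)
      with True show ?thesis by (simp add: f'_def L'_def)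
    next
      case False
      then have "freeze z J (w(i := y)) = (freeze z J w)(i := y)"
        by (auto simp: freeze_def J_def fun_eq_iff)
      with False show ?thesis
        unfolding f'_def L'_def using influenceD [OF f(3) i freeze_path_space [OF z w] y] by simp
    qed
  qed
  have "sum L J \<le> (\<Sum>i\<in>J. (L i)\<^sup>2 / \<epsilon>)"
  proof (rule sum_mono)
    fix i assume "i \<in> J"
    then have "\<epsilon> * L i \<le> L i * L i"
      using \<epsilon>(1) by (intro mult_right_mono) (auto simp: J_def)
    then show "L i \<le> (L i)\<^sup>2 / \<epsilon>"
      using \<epsilon>(1) by (simp add: pos_le_divide_eq power2_eq_square mult.commute)
  qed
  also have "\<dots> \<le> (\<Sum>i<n. (L i)\<^sup>2 / \<epsilon>)"
    using \<epsilon>(1) by (intro sum_mono2) (auto simp: J_def)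
  finally have sumJ: "sum L J \<le> v / \<epsilon>"
    by (simp add: v_def sum_divide_distrib)
  have close: "\<bar>f w - f' w\<bar> \<le> v / \<epsilon>" if "w \<in> space path_space" for w
  proof -
    have "\<bar>f w - f' w\<bar> \<le> sum L J"
      unfolding f'_def using f(3) z that by (rule freeze_diff_le) (auto simp: J_def)
    with sumJ show ?thesis by simp
  qed
  note sp = prob_algebraD(3) [OF law_space]
  note int = bmeas_integrable [OF _ law_space]
  have mean: "(\<integral>w. f' w \<partial>law) \<le> (\<integral>w. f w \<partial>law) + v / \<epsilon>"
  proof -
    have "(\<integral>w. f' w \<partial>law) \<le> (\<integral>w. f w + v / \<epsilon> \<partial>law)"
    proof (rule integral_mono)
      show "f' w \<le> f w + v / \<epsilon>" if "w \<in> space law" for w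
        using close [of w] that sp by (simp add: abs_le_iff)
    qed (use int f' f(1) in auto)
    then show ?thesis
      using int [OF f(1)] by (simp add: law.prob_space)
  qed
  have "(\<integral>w. exp (f w) \<partial>law) \<le> (\<integral>w. exp (v / \<epsilon>) * exp (f' w) \<partial>law)"
  proof (rule integral_mono)
    show "exp (f w) \<le> exp (v / \<epsilon>) * exp (f' w)" if "w \<in> space law" for w
      using close [of w] that sp by (simp add: exp_add [symmetric] abs_le_iff)
  qed (use int f' f(1) in \<open>auto intro!: bmeas_exp\<close>)
  also have "\<dots> = exp (v / \<epsilon>) * (\<integral>w. exp (f' w) \<partial>law)"
    by simp
  also have "\<dots> \<le> exp (v / \<epsilon>) * exp ((\<integral>w. f' w \<partial>law) + excursion_const \<epsilon> * b / (1 - \<rho>)\<^sup>2 * (\<Sum>i<n. (L' i)\<^sup>2))"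
    using L \<epsilon> by (intro mult_left_mono exp_moment_small f' dep' inf') (auto simp: L'_def)
  also have "\<dots> \<le> exp (v / \<epsilon>) * exp ((\<integral>w. f w \<partial>law) + v / \<epsilon> + excursion_const \<epsilon> * b / (1 - \<rho>)\<^sup>2 * v)"
  proof -
    have "(\<Sum>i<n. (L' i)\<^sup>2) \<le> v"
      unfolding v_def L'_def by (intro sum_mono) auto
    then have "excursion_const \<epsilon> * b / (1 - \<rho>)\<^sup>2 * (\<Sum>i<n. (L' i)\<^sup>2) \<le> excursion_const \<epsilon> * b / (1 - \<rho>)\<^sup>2 * v"
      using b_nonneg by (intro mult_left_mono) (auto simp: excursion_const_def)
    with mean show ?thesis by (intro mult_left_mono) auto
  qed
  also have "\<dots> = exp ((\<integral>w. f w \<partial>law) + mgf_const \<epsilon> * v)"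
    by (simp add: mgf_const_def exp_add [symmetric] algebra_simps)
  finally show ?thesis
    by (simp add: v_def)
qed

lemma deviation_bound:
  assumes K: "K \<in> borel_measurable (PiM {..<n} (\<lambda>_. S))" "separately_bounded S n K L"
    and L: "\<And>i. i < n \<Longrightarrow> 0 \<le> L i"
    and \<epsilon>: "0 < \<epsilon>" "exp (gap_const * \<epsilon>) * \<rho>\<^sup>2 \<le> 1" "1 \<le> \<kappa> * \<rho> ^ 4" and t: "0 < t"
  shows "deviation_prob law n K t \<le> concentration_bound (4 * mgf_const \<epsilon>) n L t"
proof -
  interpret law: prob_space law by (rule prob_algebraD [OF law_space])
  note sp = prob_algebraD(3) [OF law_space]
  obtain z where z: "z \<in> space S"
    using prob_space.not_empty [OF prob_algebraD(1) [OF initial]] prob_algebraD [OF initial] by blast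
  define f where "f w = K (restrict w {..<n})" for w
  have inf: "influence n L f"
    unfolding influence_def
  proof (intro allI impI ballI)
    fix i w y assume i: "i < n" and w: "w \<in> space path_space" and y: "y \<in> space S"
    have "restrict (w(i := y)) {..<n} = (restrict w {..<n})(i := y)"
      using i by (auto simp: restrict_def fun_eq_iff)
    moreover have "restrict w {..<n} \<in> PiE {..<n} (\<lambda>_. space S)"
      using w by (auto simp: path_space_iff)
    ultimately show "\<bar>f w - f (w(i := y))\<bar> \<le> L i"
      using K(2) i y by (simp add: f_def separately_bounded_def)
  qed
  have dep: "depends_on S {..<n} f"
    unfolding f_def by (intro depends_onI arg_cong [where f = K]) (auto simp: restrict_def)
  \<comment> \<open>Freezing all \<open>n\<close> coordinates changes \<open>f\<close> by at most
    the sum of the \<open>L i\<close>, so \<open>K\<close> is automatically bounded and the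
    integrals exist.\<close>
  have near: "\<bar>f w - f (\<lambda>_. z)\<bar> \<le> sum L {..<n}" if w: "w \<in> space path_space" for w
  proof -
    have "f (freeze z {..<n} w) = f (\<lambda>_. z)"
      using z by (intro depends_onD [OF dep] freeze_path_space w) (auto simp: freeze_def path_space_iff)
    then show ?thesis
      using freeze_diff_le [OF inf z w, of "{..<n}"] by simp
  qed
  have f: "bmeas path_space f"
  proof (rule bmeasI)
    show "f \<in> borel_measurable path_space"
      unfolding f_def by (rule measurable_compose [OF measurable_restrict_subset K(1)]) simp
    show "\<bar>f w\<bar> \<le> \<bar>f (\<lambda>_. z)\<bar> + sum L {..<n}" if "w \<in> space path_space" for w
      using near [OF that] by linarith
  qed
  have dev: "deviation_prob law n K t = law.prob {w\<in>space law. t < \<bar>f w - law.expectation f\<bar>}"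
    by (simp add: deviation_prob_def f_def [abs_def])
  define v where "v = (\<Sum>i<n. (L i)\<^sup>2)"
  show ?thesis
  proof (cases "v = 0")
    case True
    \<comment> \<open>In the degenerate case \<open>f\<close> is constant on the path space, so the
      event is empty.\<close>
    then have "L i = 0" if "i < n" for i
      using that unfolding v_def by (subst (asm) sum_nonneg_eq_0_iff) auto
    then have const: "f w = f (\<lambda>_. z)" if "w \<in> space path_space" for w
      using near [OF that] by simp
    then have "law.expectation f = law.expectation (\<lambda>_. f (\<lambda>_. z))"
      using sp by (intro Bochner_Integration.integral_cong) auto
    then have "law.expectation f = f (\<lambda>_. z)"
      by (simp add: law.prob_space)
    then have empty: "{w\<in>space law. t < \<bar>f w - law.expectation f\<bar>} = {}"
      using t const sp by auto
    show ?thesis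
      using True unfolding dev empty by (simp add: concentration_bound_def v_def)
  next
    case False
    then have v: "0 < v"
      using sum_nonneg [of "{..<n}" "\<lambda>i. (L i)\<^sup>2"] by (simp add: v_def less_le)
    have lf: "bmeas path_space (\<lambda>w. l * f w)" for l
      by (intro bmeas_mult bmeas_const f)
    have mgf: "law.expectation (\<lambda>w. exp (l * f w)) \<le> exp (l * law.expectation f + l\<^sup>2 * (mgf_const \<epsilon> * v))" for l
    proof -
      \<comment> \<open>The scaled influences \<open>\<bar>l\<bar> * L i\<close> can be arbitrarily
        large; \<open>exp_moment\<close> holds for them with a constant independent of
        \<open>l\<close>.\<close>
      have infl: "influence n (\<lambda>i. \<bar>l\<bar> * L i) (\<lambda>w. l * f w)"
        unfolding influence_def
        by (auto simp: abs_mult right_diff_distrib [symmetric] intro!: mult_left_mono influenceD [OF inf])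
      have depl: "depends_on S {..<n} (\<lambda>w. l * f w)"
        by (intro depends_onI arg_cong [where f = "\<lambda>x. l * x"] depends_onD [OF dep])
      have "law.expectation (\<lambda>w. exp (l * f w))
          \<le> exp (law.expectation (\<lambda>w. l * f w) + mgf_const \<epsilon> * (\<Sum>i<n. (\<bar>l\<bar> * L i)\<^sup>2))"
        using L by (intro exp_moment lf infl depl \<epsilon>) auto
      also have "(\<Sum>i<n. (\<bar>l\<bar> * L i)\<^sup>2) = l\<^sup>2 * v"
        by (simp add: v_def sum_distrib_left power_mult_distrib)
      finally show ?thesis
        by (simp add: mult_ac)
    qed
    have fm: "f \<in> borel_measurable law"
      using bmeas_measurable [OF f] prob_algebraD(2) [OF law_space] by (simp cong: measurable_cong_sets)
    have pos: "0 < mgf_const \<epsilon> * v"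
      using mgf_const_pos [OF \<epsilon>(1)] v by simp
    have int: "integrable law (\<lambda>w. exp (l * f w))" for l
      using bmeas_exp [OF lf] law_space by (rule bmeas_integrable)
    have "t\<^sup>2 / (4 * (mgf_const \<epsilon> * v)) = inverse (4 * mgf_const \<epsilon>) * t\<^sup>2 / v"
      by (simp add: inverse_eq_divide)
    then have eq: "concentration_bound (4 * mgf_const \<epsilon>) n L t = 2 * exp (- (t\<^sup>2 / (4 * (mgf_const \<epsilon> * v))))"
      using False unfolding concentration_bound_def v_def by (simp only: if_False)
    show ?thesis
      unfolding dev eq
      by (rule law.subgaussian_tail [where f = f and v = "mgf_const \<epsilon> * v", OF mgf int fm t pos])
  qed
qed

end

theorem theorem2:
  fixes S :: "'a measure" and P :: "'a \<Rightarrow> 'a measure" and \<pi> :: "'a measure" and C :: "'a set"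
  assumes "countably_generated S"
    and "markov_kernel S P"
    and "irreducible_aperiodic_positive S P \<pi>"
    and "geometrically_ergodic S P \<pi>"
    and "geometric_small_set S P C"
  shows "\<exists>M\<^sub>0>0. \<forall>(n::nat) (K :: (nat \<Rightarrow> 'a) \<Rightarrow> real) (L :: nat \<Rightarrow> real).
           K \<in> borel_measurable (PiM {..<n} (\<lambda>_. S)) \<longrightarrow>
           (\<forall>i<n. L i \<ge> 0) \<longrightarrow>
           separately_bounded S n K L \<longrightarrow>
           (\<forall>t>0. deviation_prob (markov_law S P \<pi>) n K t \<le> concentration_bound M\<^sub>0 n L t) \<and>
           (\<forall>t>0. \<forall>x\<in>C.
              deviation_prob (markov_law_from S P x) n K t \<le> concentration_bound M\<^sub>0 n L t)"
proof -
  interpret kernel S P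
    using assms(2) by unfold_locales (simp add: markov_kernel_def)
  obtain m \<nu> \<delta> \<kappa> where C_sets: "C \<in> sets S" and C_ne: "C \<noteq> {}" and \<nu>: "\<nu> \<in> space (prob_algebra S)" and \<delta>: "0 < \<delta>"
    and \<kappa>: "1 < \<kappa>"
    and minor: "\<And>x A. x \<in> C \<Longrightarrow> A \<in> sets S \<Longrightarrow> \<delta> * measure \<nu> A \<le> measure (kernel_power S P m x) A"
    and moment: "(SUP x\<in>C. \<integral>\<^sup>+w. power_enat \<kappa> (return_time C w) \<partial>markov_law_from S P x) < \<infinity>"
    using assms(5) unfolding geometric_small_set_def by blast
  define B where "B = enn2real (SUP x\<in>C. \<integral>\<^sup>+w. power_enat \<kappa> (return_time C w) \<partial>markov_law_from S P x)"
  have B: "(\<integral>\<^sup>+w. power_enat \<kappa> (return_time C w) \<partial>markov_law_from S P x) \<le> ennreal B" if "x \<in> C" for x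
    unfolding B_def using moment that by (auto intro: SUP_upper)
  have C_sub: "x \<in> space S" if "x \<in> C" for x
    using C_sets that sets.sets_into_space by blast
  \<comment> \<open>Off \<open>C\<close> the drift is built into \<open>lyapunov\<close>; on
    \<open>C\<close> it comes from the return time moment.\<close>
  interpret drift_kernel S P "lyapunov \<kappa> C" C \<kappa> B
  proof unfold_locales
    show "(\<integral>\<^sup>+y. lyapunov \<kappa> C y \<partial>P x) \<le> ennreal B" if "x \<in> C" for x
      unfolding nn_integral_lyapunov [OF C_sets \<kappa> C_sub [OF that]]
      using kop_hit_moment_le [OF C_sets \<kappa> C_sub [OF that]] B [OF that] by (intro SUP_least) (rule order_trans)
  qed (use C_sets \<kappa> lyapunov_measurable lyapunov_ge_1 lyapunov_eq_1 lyapunov_drift in \<open>auto simp: B_def\<close>)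
  have \<pi>: "\<pi> \<in> space (prob_algebra S)" "\<pi> \<bind> P = \<pi>"
    using assms(3) by (simp_all add: irreducible_aperiodic_positive_def stationary_distribution_def)
  obtain A \<rho>\<^sub>0 where A: "1 \<le> A" and \<rho>\<^sub>0: "0 < \<rho>\<^sub>0" "\<rho>\<^sub>0 < 1"
    and contr: "\<And>\<phi> x y n. \<phi> \<in> borel_measurable S \<Longrightarrow> (\<And>z. z \<in> space S \<Longrightarrow> \<bar>\<phi> z\<bar> \<le> 1) \<Longrightarrow> x \<in> good \<Longrightarrow> y \<in> good \<Longrightarrow>
       (kop P ^^ n) \<phi> x - (kop P ^^ n) \<phi> y \<le> A * \<rho>\<^sub>0 ^ n * (W x + W y)"
    using geometric_contraction [OF \<nu> \<delta> minor assms(3) C_ne] by blast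
  \<comment> \<open>Enlarging the rate weakens the contraction but secures
    \<open>1 \<le> \<kappa> * \<rho> ^ 4\<close>.\<close>
  define \<rho> where "\<rho> = max \<rho>\<^sub>0 (1 / root 4 \<kappa>)"
  have \<rho>: "0 < \<rho>" "\<rho> < 1" "\<rho>\<^sub>0 \<le> \<rho>"
    using \<rho>\<^sub>0 \<kappa> by (auto simp: \<rho>_def)
  have "(1 / root 4 \<kappa>) ^ 4 \<le> \<rho> ^ 4"
    using \<kappa> by (intro power_mono) (auto simp: \<rho>_def)
  then have \<kappa>\<rho>: "1 \<le> \<kappa> * \<rho> ^ 4"
    using \<kappa> by (simp add: power_divide field_simps)
  \<comment> \<open>One moment bound for a step out of \<open>C\<close> (\<open>B\<close>), the
    stationary law (\<open>B'\<close>) and a point mass in \<open>C\<close> (1).\<close>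
  define b where "b = max B (max B' 1)"
  have chain: "contracting_chain S P (lyapunov \<kappa> C) C \<kappa> B \<mu> A \<rho> b"
    if "\<mu> \<in> space (prob_algebra S)" "(\<integral>\<^sup>+x. lyapunov \<kappa> C x \<partial>\<mu>) \<le> ennreal b" for \<mu>
  proof unfold_locales
    fix \<phi> :: "'a \<Rightarrow> real" and x y n
    assume "\<phi> \<in> borel_measurable S" "\<And>z. z \<in> space S \<Longrightarrow> \<bar>\<phi> z\<bar> \<le> 1" "x \<in> good" "y \<in> good"
    then have "(kop P ^^ n) \<phi> x - (kop P ^^ n) \<phi> y \<le> A * \<rho>\<^sub>0 ^ n * (W x + W y)"
      by (rule contr)
    also have "\<dots> \<le> A * \<rho> ^ n * (W x + W y)"
      using A \<rho>\<^sub>0 \<rho> W_nonneg by (intro mult_right_mono mult_left_mono power_mono) auto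
    finally show "(kop P ^^ n) \<phi> x - (kop P ^^ n) \<phi> y \<le> A * \<rho> ^ n * (W x + W y)" .
  qed (use that A \<rho> in \<open>auto simp: b_def\<close>)
  have chain_\<pi>: "contracting_chain S P (lyapunov \<kappa> C) C \<kappa> B \<pi> A \<rho> b"
  proof (rule chain [OF \<pi>(1)])
    show "(\<integral>\<^sup>+x. lyapunov \<kappa> C x \<partial>\<pi>) \<le> ennreal b"
      using stationary_moment [OF \<pi> stationary_good [OF assms(3) C_ne]]
      by (rule order_trans) (auto simp: b_def intro!: ennreal_leI)
  qed
  have chain_x: "contracting_chain S P (lyapunov \<kappa> C) C \<kappa> B (return S x) A \<rho> b" if x: "x \<in> C" for x
  proof (rule chain)
    show "return S x \<in> space (prob_algebra S)"
      using measurable_space [OF measurable_return_prob_space C_sub [OF x]] .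
    have "(\<integral>\<^sup>+y. lyapunov \<kappa> C y \<partial>return S x) = 1"
      using C_sub [OF x] by (simp add: nn_integral_return V V_C [OF x])
    also have "\<dots> \<le> ennreal b"
      by (simp add: b_def flip: ennreal_1)
    finally show "(\<integral>\<^sup>+y. lyapunov \<kappa> C y \<partial>return S x) \<le> ennreal b" .
  qed
  \<comment> \<open>\<open>gap_const\<close> and \<open>mgf_const\<close> see the initial law only
    through \<open>b\<close>, so their values for \<pi> serve every starting point in
    \<open>C\<close>.\<close>
  interpret \<pi>: contracting_chain S P "lyapunov \<kappa> C" C \<kappa> B \<pi> A \<rho> b
    by (rule chain_\<pi>)
  have gap_const: "0 < \<pi>.gap_const" using \<pi>.gap_const_ge(1) by simp
  \<comment> \<open>The solution of
    \<open>exp (gap_const * \<epsilon>) * \<rho>\<^sup>2 = 1\<close>.\<close>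
  define \<epsilon> where "\<epsilon> = - 2 * ln \<rho> / \<pi>.gap_const"
  have \<epsilon>: "0 < \<epsilon>"
    using \<rho> gap_const by (simp add: \<epsilon>_def divide_neg_pos)
  have "exp (\<pi>.gap_const * \<epsilon>) = exp (- ln \<rho>) * exp (- ln \<rho>)"
    using gap_const by (simp add: \<epsilon>_def exp_add [symmetric])
  then have \<epsilon>': "exp (\<pi>.gap_const * \<epsilon>) * \<rho>\<^sup>2 \<le> 1"
    using \<rho> by (simp add: exp_minus power2_eq_square field_simps)
  show ?thesis
  proof (intro exI [of _ "4 * \<pi>.mgf_const \<epsilon>"] conjI allI impI ballI)
    show "0 < 4 * \<pi>.mgf_const \<epsilon>"
      using \<pi>.mgf_const_pos [OF \<epsilon>] by simp
    fix n K L and t :: real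
    assume K: "K \<in> borel_measurable (PiM {..<n} (\<lambda>_. S))" "\<forall>i<n. 0 \<le> L i" "separately_bounded S n K L"
      and t: "0 < t"
    show "deviation_prob (markov_law S P \<pi>) n K t \<le> concentration_bound (4 * \<pi>.mgf_const \<epsilon>) n L t"
      using K(2) by (intro \<pi>.deviation_bound K t \<epsilon> \<epsilon>' \<kappa>\<rho>) auto
    show "deviation_prob (markov_law_from S P x) n K t \<le> concentration_bound (4 * \<pi>.mgf_const \<epsilon>) n L t"
      if "x \<in> C" for x
      using K(2) by (intro contracting_chain.deviation_bound [OF chain_x [OF that]] K t \<epsilon> \<epsilon>' \<kappa>\<rho>) auto
  qed
qed

end
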